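(* Let $(M,\omega)$ be a compact locally conformal Kähler manifold with pointwise nonpositive constant (Chern) holomorphic sectional curvature, i.e. there is a function $c:M\to(-\infty,0]$ such that $H(X)=c(p)$ for every $p\in M$ and every nonzero $X\in T^{1,0}_pM$. Then $(M,\omega)$ is globally conformal Kähler.
   Context: A Hermitian manifold $(M,\omega)$ is a complex manifold, of complex dimension $n\ge 2$, with Hermitian metric $h$, $\omega=\sqrt{-1}\,h_{i\bar j}dz^i\wedge d\bar z^j$ in local holomorphic coordinates. The Chern connection has Christoffel symbols $\Gamma_{ij}^k=h^{k\bar l}\partial_i h_{j\bar l}$ and curvature $R_{i\bar jk\bar l}=-h_{p\bar l}\,\partial_{\bar j}\Gamma^p_{ik}$. The holomorphic sectional curvature is $H(X)=R(X,\bar X,X,\bar X)/|X|^4$ for nonzero $X=X^i\frac{\partial}{\partial z^i}\in T^{1,0}_pM$, where $R(X,\bar X,X,\bar X)=R_{i\bar jk\bar l}X^i\overline{X^j}X^k\overline{X^l}$ and $|X|^2=h_{i\bar j}X^i\overline{X^j}$. $(M,\omega)$ is locally conformal Kähler if $d\omega=\theta\wedge\omega$ for a closed real 1-form $\theta$ (the Lee form); equivalently, $\omega$ is locally conformal to a Kähler metric. It is globally conformal Kähler if $\omega=e^{f}\omega_0$ for some smooth real function $f$ on $M$ and some Kähler metric $\omega_0$ on $M$ (Kähler metrics are included). *)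

theory Defs
  imports "HOL-Analysis.Analysis"
begin

section \<open>Smooth and holomorphic maps in coordinates\<close>

text \<open>On an open set \<open>S\<close>, \<open>Ck_on k S f\<close> says that \<open>f\<close> is of class \<open>C\<^sup>k\<close> in the real sense:
  all iterated directional derivatives up to order \<open>k\<close> exist as Frechet derivatives and
  are continuous.\<close>

primrec Ck_on :: "nat \<Rightarrow> 'v::real_normed_vector set \<Rightarrow> ('v \<Rightarrow> 'w::real_normed_vector) \<Rightarrow> bool" where
  "Ck_on 0 S f \<longleftrightarrow> continuous_on S f"
| "Ck_on (Suc k) S f \<longleftrightarrow>
     (\<forall>x\<in>S. f differentiable (at x)) \<and>
     (\<forall>v. Ck_on k S (\<lambda>x. frechet_derivative f (at x) v))"

definition smooth_on :: "'v::real_normed_vector set \<Rightarrow> ('v \<Rightarrow> 'w::real_normed_vector) \<Rightarrow> bool" where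
  "smooth_on S f \<longleftrightarrow> (\<forall>k. Ck_on k S f)"

definition vec_holomorphic_on :: "(complex^'n \<Rightarrow> complex^'m) \<Rightarrow> (complex^'n) set \<Rightarrow> bool" where
  "vec_holomorphic_on f S \<longleftrightarrow>
     (\<forall>z\<in>S. \<exists>L. (f has_derivative L) (at z) \<and> (\<forall>a v. L (a *s v) = a *s L v))"

text \<open>Wirtinger derivatives \<open>\<partial>/\<partial>z\<^sup>i\<close> and \<open>\<partial>/\<partial>(cnj z\<^sup>i)\<close> at \<open>z\<close>.\<close>

definition dz :: "'n::finite \<Rightarrow> (complex^'n \<Rightarrow> complex) \<Rightarrow> complex^'n \<Rightarrow> complex" where
  "dz i f z = (frechet_derivative f (at z) (axis i 1)
               - \<i> * frechet_derivative f (at z) (axis i \<i>)) / 2"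

definition dzbar :: "'n::finite \<Rightarrow> (complex^'n \<Rightarrow> complex) \<Rightarrow> complex^'n \<Rightarrow> complex" where
  "dzbar i f z = (frechet_derivative f (at z) (axis i 1)
                  + \<i> * frechet_derivative f (at z) (axis i \<i>)) / 2"

section \<open>Complex manifolds\<close>

text \<open>A chart is a domain together with a coordinate map; the values of the coordinate map
  outside the domain are irrelevant.\<close>

type_synonym ('a, 'n) chart = "'a set \<times> ('a \<Rightarrow> complex^'n)"

definition chart_image :: "('a, 'n::finite) chart \<Rightarrow> (complex^'n) set" where
  "chart_image \<phi> = snd \<phi> ` fst \<phi>"

definition chart_inv :: "('a, 'n::finite) chart \<Rightarrow> complex^'n \<Rightarrow> 'a" where
  "chart_inv \<phi> = inv_into (fst \<phi>) (snd \<phi>)"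

definition chart_on :: "'a topology \<Rightarrow> ('a, 'n::finite) chart \<Rightarrow> bool" where
  "chart_on M \<phi> \<longleftrightarrow>
     openin M (fst \<phi>) \<and> open (chart_image \<phi>) \<and>
     homeomorphic_map (subtopology M (fst \<phi>)) (top_of_set (chart_image \<phi>)) (snd \<phi>)"

definition overlap :: "('a, 'n::finite) chart \<Rightarrow> ('a, 'n) chart \<Rightarrow> (complex^'n) set" where
  "overlap \<phi> \<psi> = snd \<phi> ` (fst \<phi> \<inter> fst \<psi>)"

definition transition :: "('a, 'n::finite) chart \<Rightarrow> ('a, 'n) chart \<Rightarrow> complex^'n \<Rightarrow> complex^'n" where
  "transition \<phi> \<psi> = snd \<psi> \<circ> chart_inv \<phi>"

text \<open>The atlas need not be maximal, and the manifold need not be connected.\<close>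

definition complex_manifold :: "'a topology \<Rightarrow> ('a, 'n::finite) chart set \<Rightarrow> bool" where
  "complex_manifold M A \<longleftrightarrow>
     Hausdorff_space M \<and> second_countable M \<and>
     (\<forall>\<phi>\<in>A. chart_on M \<phi>) \<and> (\<Union>\<phi>\<in>A. fst \<phi>) = topspace M \<and>
     (\<forall>\<phi>\<in>A. \<forall>\<psi>\<in>A. vec_holomorphic_on (transition \<phi> \<psi>) (overlap \<phi> \<psi>))"

definition smooth_function :: "('a, 'n::finite) chart set \<Rightarrow> ('a \<Rightarrow> real) \<Rightarrow> bool" where
  "smooth_function A f \<longleftrightarrow> (\<forall>\<phi>\<in>A. smooth_on (chart_image \<phi>) (f \<circ> chart_inv \<phi>))"

section \<open>Differential forms\<close>

text \<open>Forms on an open subset of \<open>\<complex>\<^sup>n\<close> (as a real vector space) are functions of a point and of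
  tangent vectors.  A real tangent vector at \<open>z\<close> is identified with its vector \<open>v\<close> of
  holomorphic components \<open>v $ i = dz\<^sup>i(v)\<close>, which is also the component vector of its
  \<open>(1,0)\<close>-part.  The exterior derivatives below use constant vector fields, so that no Lie
  bracket terms occur; the normalisation is the one for which
  \<open>(\<alpha> \<and> \<beta>)(u,v) = \<alpha>(u) \<beta>(v) - \<alpha>(v) \<beta>(u)\<close>.\<close>

type_synonym ('n, 'b) form1 = "complex^'n \<Rightarrow> complex^'n \<Rightarrow> 'b"
type_synonym ('n, 'b) form2 = "complex^'n \<Rightarrow> complex^'n \<Rightarrow> complex^'n \<Rightarrow> 'b"
type_synonym ('n, 'b) form3 = "complex^'n \<Rightarrow> complex^'n \<Rightarrow> complex^'n \<Rightarrow> complex^'n \<Rightarrow> 'b"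

definition ext_d1 :: "('n::finite, 'b::real_normed_vector) form1 \<Rightarrow> ('n, 'b) form2" where
  "ext_d1 \<alpha> z u v =
     frechet_derivative (\<lambda>x. \<alpha> x v) (at z) u - frechet_derivative (\<lambda>x. \<alpha> x u) (at z) v"

definition ext_d2 :: "('n::finite, 'b::real_normed_vector) form2 \<Rightarrow> ('n, 'b) form3" where
  "ext_d2 \<beta> z u v w =
     frechet_derivative (\<lambda>x. \<beta> x v w) (at z) u
     - frechet_derivative (\<lambda>x. \<beta> x u w) (at z) v
     + frechet_derivative (\<lambda>x. \<beta> x u v) (at z) w"

definition wedge12 :: "('n::finite, real) form1 \<Rightarrow> ('n, 'b::real_normed_vector) form2 \<Rightarrow> ('n, 'b) form3" where
  "wedge12 \<alpha> \<beta> z u v w =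
     \<alpha> z u *\<^sub>R \<beta> z v w - \<alpha> z v *\<^sub>R \<beta> z u w + \<alpha> z w *\<^sub>R \<beta> z u v"

text \<open>Global real 1-forms: families of local 1-forms, one for each chart of the atlas, that
  correspond to each other under pullback by the coordinate changes.\<close>

definition real_one_form :: "('a, 'n::finite) chart set \<Rightarrow> (('a, 'n) chart \<Rightarrow> ('n, real) form1) \<Rightarrow> bool" where
  "real_one_form A \<theta> \<longleftrightarrow>
     (\<forall>\<phi>\<in>A. (\<forall>z\<in>chart_image \<phi>. linear (\<theta> \<phi> z)) \<and>
            (\<forall>v. smooth_on (chart_image \<phi>) (\<lambda>z. \<theta> \<phi> z v))) \<and>
     (\<forall>\<phi>\<in>A. \<forall>\<psi>\<in>A. \<forall>z\<in>overlap \<phi> \<psi>. \<forall>v.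
        \<theta> \<phi> z v = \<theta> \<psi> (transition \<phi> \<psi> z) (frechet_derivative (transition \<phi> \<psi>) (at z) v))"

definition closed_one_form :: "('a, 'n::finite) chart set \<Rightarrow> (('a, 'n) chart \<Rightarrow> ('n, real) form1) \<Rightarrow> bool" where
  "closed_one_form A \<theta> \<longleftrightarrow> (\<forall>\<phi>\<in>A. \<forall>z\<in>chart_image \<phi>. \<forall>u v. ext_d1 (\<theta> \<phi>) z u v = 0)"

section \<open>Hermitian metrics\<close>

text \<open>In a chart, a Hermitian metric is a matrix-valued function \<open>g\<close> of the coordinates, where
  \<open>g z $ i $ j\<close> is the component with barred second index \<open>j\<close>.\<close>

type_synonym 'n local_metric = "complex^'n \<Rightarrow> complex^'n^'n"

definition herm :: "complex^'n^'n \<Rightarrow> complex^'n \<Rightarrow> complex^'n \<Rightarrow> complex" where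
  "herm H u v = (\<Sum>i\<in>UNIV. \<Sum>j\<in>UNIV. H $ i $ j * u $ i * cnj (v $ j))"

definition hermitian_metric ::
    "('a, 'n::finite) chart set \<Rightarrow> (('a, 'n) chart \<Rightarrow> 'n local_metric) \<Rightarrow> bool" where
  "hermitian_metric A h \<longleftrightarrow>
     (\<forall>\<phi>\<in>A.
        (\<forall>i j. smooth_on (chart_image \<phi>) (\<lambda>z. h \<phi> z $ i $ j)) \<and>
        (\<forall>z\<in>chart_image \<phi>.
           (\<forall>i j. h \<phi> z $ j $ i = cnj (h \<phi> z $ i $ j)) \<and>
           (\<forall>X. X \<noteq> 0 \<longrightarrow> Re (herm (h \<phi> z) X X) > 0))) \<and>
     (\<forall>\<phi>\<in>A. \<forall>\<psi>\<in>A. \<forall>z\<in>overlap \<phi> \<psi>. \<forall>u v.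
        herm (h \<phi> z) u v =
        herm (h \<psi> (transition \<phi> \<psi> z))
          (frechet_derivative (transition \<phi> \<psi>) (at z) u)
          (frechet_derivative (transition \<phi> \<psi>) (at z) v))"

text \<open>\<open>\<omega> = \<i> h\<^sub>i\<^sub>j dz\<^sup>i \<and> cnj dz\<^sup>j\<close> (second index barred), evaluated on real tangent vectors.\<close>

definition fundamental_form :: "'n::finite local_metric \<Rightarrow> ('n, complex) form2" where
  "fundamental_form g z u v =
     \<i> * (\<Sum>i\<in>UNIV. \<Sum>j\<in>UNIV. g z $ i $ j * (u $ i * cnj (v $ j) - v $ i * cnj (u $ j)))"

definition kaehler_metric ::
    "('a, 'n::finite) chart set \<Rightarrow> (('a, 'n) chart \<Rightarrow> 'n local_metric) \<Rightarrow> bool" where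
  "kaehler_metric A h \<longleftrightarrow> hermitian_metric A h \<and>
     (\<forall>\<phi>\<in>A. \<forall>z\<in>chart_image \<phi>. \<forall>u v w. ext_d2 (fundamental_form (h \<phi>)) z u v w = 0)"

definition locally_conformal_kaehler ::
    "('a, 'n::finite) chart set \<Rightarrow> (('a, 'n) chart \<Rightarrow> 'n local_metric) \<Rightarrow> bool" where
  "locally_conformal_kaehler A h \<longleftrightarrow> hermitian_metric A h \<and>
     (\<exists>\<theta>. real_one_form A \<theta> \<and> closed_one_form A \<theta> \<and>
        (\<forall>\<phi>\<in>A. \<forall>z\<in>chart_image \<phi>. \<forall>u v w.
           ext_d2 (fundamental_form (h \<phi>)) z u v w =
           wedge12 (\<theta> \<phi>) (fundamental_form (h \<phi>)) z u v w))"

definition globally_conformal_kaehler ::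
    "('a, 'n::finite) chart set \<Rightarrow> (('a, 'n) chart \<Rightarrow> 'n local_metric) \<Rightarrow> bool" where
  "globally_conformal_kaehler A h \<longleftrightarrow> hermitian_metric A h \<and>
     (\<exists>f h0. smooth_function A f \<and> kaehler_metric A h0 \<and>
        (\<forall>\<phi>\<in>A. \<forall>z\<in>chart_image \<phi>. \<forall>u v.
           fundamental_form (h \<phi>) z u v =
           exp (f (chart_inv \<phi> z)) *\<^sub>R fundamental_form (h0 \<phi>) z u v))"

section \<open>Chern connection and holomorphic sectional curvature\<close>

text \<open>\<open>chern_Gamma g i j k z\<close> has lower indices \<open>i, j\<close> and upper index \<open>k\<close>.  The inverse
  metric with indices \<open>k\<close> and barred \<open>l\<close> is determined by
  \<open>\<Sum>l. h\<^sub>j\<^sub>l h\<^sup>k\<^sup>l = \<delta>\<^sub>j\<^sup>k\<close>, so it is the \<open>(l, k)\<close> entry of the inverse matrix.\<close>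

definition chern_Gamma :: "'n::finite local_metric \<Rightarrow> 'n \<Rightarrow> 'n \<Rightarrow> 'n \<Rightarrow> complex^'n \<Rightarrow> complex" where
  "chern_Gamma g i j k z =
     (\<Sum>l\<in>UNIV. matrix_inv (g z) $ l $ k * dz i (\<lambda>x. g x $ j $ l) z)"

text \<open>In \<open>chern_R g i j k l z\<close> the indices \<open>j\<close> and \<open>l\<close> are barred.\<close>

definition chern_R :: "'n::finite local_metric \<Rightarrow> 'n \<Rightarrow> 'n \<Rightarrow> 'n \<Rightarrow> 'n \<Rightarrow> complex^'n \<Rightarrow> complex" where
  "chern_R g i j k l z = - (\<Sum>p\<in>UNIV. g z $ p $ l * dzbar j (chern_Gamma g i k p) z)"

text \<open>\<open>H(X) = R(X, cnj X, X, cnj X) / |X|\<^sup>4\<close>, with \<open>herm (g z) X X = |X|\<^sup>2\<close>.\<close>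

definition hol_sect_curv :: "'n::finite local_metric \<Rightarrow> complex^'n \<Rightarrow> complex^'n \<Rightarrow> complex" where
  "hol_sect_curv g z X =
     (\<Sum>i\<in>UNIV. \<Sum>j\<in>UNIV. \<Sum>k\<in>UNIV. \<Sum>l\<in>UNIV.
        chern_R g i j k l z * X $ i * cnj (X $ j) * X $ k * cnj (X $ l))
     / (herm (g z) X X)\<^sup>2"

text \<open>The curvature value at a point \<open>p\<close> is tested in every chart around \<open>p\<close>; a vector in the
  holomorphic tangent space at \<open>p\<close> is given by its components \<open>X\<close> in that chart.\<close>

definition pointwise_hol_sect_curv ::
    "('a, 'n::finite) chart set \<Rightarrow> (('a, 'n) chart \<Rightarrow> 'n local_metric) \<Rightarrow> ('a \<Rightarrow> real) \<Rightarrow> bool" where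
  "pointwise_hol_sect_curv A h c \<longleftrightarrow>
     (\<forall>\<phi>\<in>A. \<forall>p\<in>fst \<phi>. \<forall>X. X \<noteq> 0 \<longrightarrow>
        hol_sect_curv (h \<phi>) (snd \<phi> p) X = complex_of_real (c p))"

end

theory Submission
  imports Defs "HOL-Complex_Analysis.Cauchy_Integral_Formula"
begin

text \<open>Polarising the curvature condition and contracting it with the metric shows that
  \<open>4 \<mu> h\<^sub>i\<^sub>j = \<partial>\<^sub>j B\<^sub>i\<close> (barred \<open>j\<close>), where \<open>4 \<mu> = tr\<^sub>h \<nabla>\<theta> + 2 (n + 1) c\<close> and \<open>B\<close> is built from the Lee form and the trace
  of the Chern connection.  Differentiating once more and using the torsion gives, because \<open>n \<ge> 2\<close>,
  \<open>d\<mu> = - \<mu> \<theta>\<close> for the globally defined function \<open>\<mu>\<close>.  So the zero set of \<open>\<mu>\<close> is open and closed.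
  Off this set \<open>\<theta> = d (- ln \<bar>\<mu>\<bar>)\<close>.  On it \<open>tr\<^sub>h \<nabla>\<theta> = - 2 (n + 1) c \<ge> 0\<close>, and the divergence of the vector field dual
  to \<open>\<theta>\<close> is \<open>tr\<^sub>h \<nabla>\<theta> + (n - 1) \<bar>\<theta>\<bar>\<^sup>2 \<ge> 0\<close>; its integral is \<open>0\<close>, hence \<open>\<theta> = 0\<close> there.  In both cases
  \<open>\<theta>\<close> has a global potential \<open>f\<close>, and \<open>exp (- f) h\<close> is Kaehler.\<close>

section \<open>Smooth functions\<close>

text \<open>The function \<open>c\<close> carries no regularity, so \<mu> cannot be differentiated
  through its formula; it is smooth because it is the quotient of a derivative of \<open>pot\<close>
  by a diagonal entry of the metric. The equation for \<open>d \<mu>\<close> is linear, hence a zero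
  of \<mu> spreads to a neighbourhood. The manifold may be disconnected, so both kinds of component
  can occur at once. The indicator of the zero set is locally constant and can be inserted in the
  divergence theorem without a boundary term, which localises the integral to the components where
  the sign of the divergence is known. Two obstacles shape the middle part. The integral over the
  manifold is never formed: integrals live in charts and are glued by a partition of unity and the
  change of variables formula. Coordinate changes are only assumed complex differentiable at each
  point, so the continuity of their derivative and its holomorphy along complex lines are derived
  from Cauchy's estimates; the latter makes the trace of \<open>lee_hess\<close>, and with it \<mu>,
  independent of the chart.\<close>

lemma frechet_derivative_cong_open:
  assumes "open S" "x \<in> S" "\<And>y. y \<in> S \<Longrightarrow> f y = g y"
  shows "frechet_derivative f (at x) = frechet_derivative g (at x)"
proof -
  have "(f has_derivative D) (at x) \<longleftrightarrow> (g has_derivative D) (at x)" for D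
    using has_derivative_transform_within_open[OF _ assms(1,2)] assms(3) by metis
  then show ?thesis unfolding frechet_derivative_def by simp
qed

lemma frechet_derivative_bounded_linear:
  assumes "bounded_linear F" "f differentiable (at x)"
  shows "frechet_derivative (\<lambda>x. F (f x)) (at x) = (\<lambda>v. F (frechet_derivative f (at x) v))"
proof -
  have "((\<lambda>x. F (f x)) has_derivative (\<lambda>v. F (frechet_derivative f (at x) v))) (at x)"
    by (rule bounded_linear.has_derivative[OF assms(1)])
       (rule frechet_derivative_works[THEN iffD1, OF assms(2)])
  then show ?thesis by (rule frechet_derivative_at[symmetric])
qed

lemma frechet_derivative_plus:
  assumes "f differentiable (at x)" "g differentiable (at x)"
  shows "frechet_derivative (\<lambda>x. f x + g x) (at x) =
    (\<lambda>v. frechet_derivative f (at x) v + frechet_derivative g (at x) v)"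
  by (rule frechet_derivative_at[symmetric])
     (intro has_derivative_add assms[unfolded frechet_derivative_works])

lemma frechet_derivative_minus:
  assumes "f differentiable (at x)" "g differentiable (at x)"
  shows "frechet_derivative (\<lambda>x. f x - g x) (at x) =
    (\<lambda>v. frechet_derivative f (at x) v - frechet_derivative g (at x) v)"
  by (rule frechet_derivative_at[symmetric])
     (intro has_derivative_diff assms[unfolded frechet_derivative_works])

lemma differentiable_cong_open:
  assumes "open S" "x \<in> S" "\<And>y. y \<in> S \<Longrightarrow> f y = g y"
  shows "f differentiable (at x) \<longleftrightarrow> g differentiable (at x)"
  unfolding differentiable_def
  using has_derivative_transform_within_open[OF _ assms(1,2)] assms(3) by metis

lemma Ck_on_cong:
  assumes "open S" "\<And>y. y \<in> S \<Longrightarrow> f y = g y"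
  shows "Ck_on k S f \<longleftrightarrow> Ck_on k S g"
  using assms(2)
proof (induction k arbitrary: f g)
  case 0
  then show ?case using continuous_on_cong by (metis Ck_on.simps(1))
next
  case (Suc k)
  have "Ck_on k S (\<lambda>x. frechet_derivative f (at x) v) \<longleftrightarrow>
        Ck_on k S (\<lambda>x. frechet_derivative g (at x) v)" for v
    by (rule Suc.IH) (simp add: frechet_derivative_cong_open[OF assms(1) _ Suc.prems])
  moreover have "(\<forall>x\<in>S. f differentiable (at x)) \<longleftrightarrow> (\<forall>x\<in>S. g differentiable (at x))"
    by (intro ball_cong refl differentiable_cong_open[OF assms(1)] Suc.prems)
  ultimately show ?case by simp
qed

lemma Ck_on_SucD: "Ck_on (Suc k) S f \<Longrightarrow> Ck_on k S f"
proof (induction k arbitrary: f)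
  case 0
  then show ?case
    by (auto intro!: continuous_at_imp_continuous_on differentiable_imp_continuous_within)
next
  case (Suc k)
  then show ?case by (metis Ck_on.simps(2))
qed

lemma smooth_onD:
  assumes "smooth_on S f"
  shows "x \<in> S \<Longrightarrow> f differentiable (at x)"
    and "smooth_on S (\<lambda>x. frechet_derivative f (at x) v)"
    and "continuous_on S f"
  using assms unfolding smooth_on_def
  by (metis Ck_on.simps(2), metis Ck_on.simps(2), metis Ck_on.simps(1))

text \<open>\<open>Ck_on (Suc k)\<close> speaks only of differentiability and of the directional
  derivatives, so smooth derivatives give every positive order at once. The conformal factor is
  proved smooth in this way, its derivative being the Lee form.\<close>

lemma smooth_onI:
  assumes "\<And>x. x \<in> S \<Longrightarrow> f differentiable (at x)"
    and "\<And>v. smooth_on S (\<lambda>x. frechet_derivative f (at x) v)"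
  shows "smooth_on S f"
  unfolding smooth_on_def
proof
  fix k
  have "Ck_on (Suc k) S f" for k using assms by (simp add: smooth_on_def)
  then show "Ck_on k S f" using Ck_on_SucD by blast
qed

lemma smooth_on_cong:
  assumes "open S" "\<And>y. y \<in> S \<Longrightarrow> f y = g y"
  shows "smooth_on S f \<longleftrightarrow> smooth_on S g"
  using Ck_on_cong[OF assms] by (simp add: smooth_on_def)

lemma Ck_on_const: "Ck_on k S (\<lambda>x. c)"
  by (induction k arbitrary: c) (auto simp: frechet_derivative_const)

lemma Ck_on_add:
  assumes "open S" "Ck_on k S f" "Ck_on k S g"
  shows "Ck_on k S (\<lambda>x. f x + g x)"
  using assms(2,3)
proof (induction k arbitrary: f g)
  case 0
  then show ?case by (auto intro: continuous_on_add)
next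
  case (Suc k)
  have "Ck_on k S (\<lambda>x. frechet_derivative (\<lambda>x. f x + g x) (at x) v)" for v
  proof (subst Ck_on_cong[OF assms(1)])
    show "frechet_derivative (\<lambda>x. f x + g x) (at y) v =
        frechet_derivative f (at y) v + frechet_derivative g (at y) v" if "y \<in> S" for y
      using Suc.prems that by (subst frechet_derivative_plus) auto
    show "Ck_on k S (\<lambda>y. frechet_derivative f (at y) v + frechet_derivative g (at y) v)"
      using Suc.prems by (intro Suc.IH) (simp_all only: Ck_on.simps)
  qed
  with Suc.prems show ?case by (simp add: differentiable_add)
qed

lemma Ck_on_bounded_linear:
  assumes "open S" "bounded_linear F" "Ck_on k S f"
  shows "Ck_on k S (\<lambda>x. F (f x))"
  using assms(3)
proof (induction k arbitrary: f)
  case 0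
  then show ?case
    by (simp add: bounded_linear.continuous_on[OF assms(2)])
next
  case (Suc k)
  have d: "((\<lambda>x. F (f x)) has_derivative (\<lambda>v. F (frechet_derivative f (at y) v))) (at y)"
    if "y \<in> S" for y
    using Suc.prems that frechet_derivative_works
    by (intro bounded_linear.has_derivative[OF assms(2)]) auto
  have "Ck_on k S (\<lambda>x. frechet_derivative (\<lambda>x. F (f x)) (at x) v)" for v
  proof (subst Ck_on_cong[OF assms(1)])
    show "frechet_derivative (\<lambda>x. F (f x)) (at y) v = F (frechet_derivative f (at y) v)"
      if "y \<in> S" for y
      by (simp add: frechet_derivative_at[OF d[OF that], symmetric])
    show "Ck_on k S (\<lambda>y. F (frechet_derivative f (at y) v))"
      using Suc.prems by (intro Suc.IH) (simp only: Ck_on.simps)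
  qed
  with d show ?case by (auto simp: differentiable_def)
qed

lemma Ck_on_mult:
  fixes f g :: "'v::real_normed_vector \<Rightarrow> 'w::real_normed_algebra"
  assumes "open S" "Ck_on k S f" "Ck_on k S g"
  shows "Ck_on k S (\<lambda>x. f x * g x)"
  using assms(2,3)
proof (induction k arbitrary: f g)
  case 0
  then show ?case by (auto intro: continuous_on_mult)
next
  case (Suc k)
  have d: "((\<lambda>x. f x * g x) has_derivative
      (\<lambda>v. f y * frechet_derivative g (at y) v + frechet_derivative f (at y) v * g y)) (at y)"
    if "y \<in> S" for y
    using Suc.prems that frechet_derivative_works by (intro has_derivative_mult) auto
  have "Ck_on k S (\<lambda>x. frechet_derivative (\<lambda>x. f x * g x) (at x) v)" for v
  proof (subst Ck_on_cong[OF assms(1)])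
    show "frechet_derivative (\<lambda>x. f x * g x) (at y) v =
        f y * frechet_derivative g (at y) v + frechet_derivative f (at y) v * g y"
      if "y \<in> S" for y
      by (simp add: frechet_derivative_at[OF d[OF that], symmetric])
    show "Ck_on k S (\<lambda>y. f y * frechet_derivative g (at y) v + frechet_derivative f (at y) v * g y)"
      using Suc.prems Ck_on_SucD[OF Suc.prems(1)] Ck_on_SucD[OF Suc.prems(2)]
      by (intro Ck_on_add[OF assms(1)] Suc.IH) (simp_all only: Ck_on.simps)
  qed
  with d show ?case by (auto simp: differentiable_def)
qed

lemma smooth_on_const: "smooth_on S (\<lambda>x. c)"
  by (simp add: smooth_on_def Ck_on_const)

lemma smooth_on_add: "open S \<Longrightarrow> smooth_on S f \<Longrightarrow> smooth_on S g \<Longrightarrow> smooth_on S (\<lambda>x. f x + g x)"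
  by (simp add: smooth_on_def Ck_on_add)

lemma smooth_on_bounded_linear:
  "open S \<Longrightarrow> bounded_linear F \<Longrightarrow> smooth_on S f \<Longrightarrow> smooth_on S (\<lambda>x. F (f x))"
  by (simp add: smooth_on_def Ck_on_bounded_linear)

lemma smooth_on_mult:
  fixes f g :: "'v::real_normed_vector \<Rightarrow> 'w::real_normed_algebra"
  shows "open S \<Longrightarrow> smooth_on S f \<Longrightarrow> smooth_on S g \<Longrightarrow> smooth_on S (\<lambda>x. f x * g x)"
  by (simp add: smooth_on_def Ck_on_mult)

lemma smooth_on_minus: "open S \<Longrightarrow> smooth_on S f \<Longrightarrow> smooth_on S (\<lambda>x. - f x)"
  by (intro smooth_on_bounded_linear[where F = uminus] bounded_linear_minus bounded_linear_ident)

lemma smooth_on_diff: "open S \<Longrightarrow> smooth_on S f \<Longrightarrow> smooth_on S g \<Longrightarrow> smooth_on S (\<lambda>x. f x - g x)"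
  using smooth_on_add[of S f "\<lambda>x. - g x"] smooth_on_minus by auto

lemma smooth_on_cnj: "open S \<Longrightarrow> smooth_on S f \<Longrightarrow> smooth_on S (\<lambda>x. cnj (f x))"
  by (intro smooth_on_bounded_linear[where F = cnj] bounded_linear_cnj)

lemma smooth_on_of_real:
  "open S \<Longrightarrow> smooth_on S f \<Longrightarrow> smooth_on S (\<lambda>x. of_real (f x) :: 'w::real_normed_algebra_1)"
  by (intro smooth_on_bounded_linear[where F = of_real] bounded_linear_of_real)

lemma smooth_on_divide_const:
  fixes f :: "'v::real_normed_vector \<Rightarrow> 'w::real_normed_field"
  shows "open S \<Longrightarrow> smooth_on S f \<Longrightarrow> smooth_on S (\<lambda>x. f x / c)"
  by (intro smooth_on_bounded_linear[where F = "\<lambda>x. x / c"] bounded_linear_divide)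

lemma smooth_on_sum:
  "open S \<Longrightarrow> (\<And>i. i \<in> I \<Longrightarrow> smooth_on S (f i)) \<Longrightarrow> smooth_on S (\<lambda>x. \<Sum>i\<in>I. f i x)"
  by (induction I rule: infinite_finite_induct) (auto intro: smooth_on_const smooth_on_add)

lemma smooth_on_prod:
  fixes f :: "'i \<Rightarrow> 'v::real_normed_vector \<Rightarrow> 'w::{real_normed_algebra, comm_ring_1}"
  shows "open S \<Longrightarrow> (\<And>i. i \<in> I \<Longrightarrow> smooth_on S (f i)) \<Longrightarrow> smooth_on S (\<lambda>x. \<Prod>i\<in>I. f i x)"
  by (induction I rule: infinite_finite_induct) (auto intro: smooth_on_const smooth_on_mult)

lemma Ck_on_inverse:
  fixes f :: "'v::real_normed_vector \<Rightarrow> 'w::real_normed_field"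
  assumes "open S" "Ck_on k S f" "\<And>x. x \<in> S \<Longrightarrow> f x \<noteq> 0"
  shows "Ck_on k S (\<lambda>x. inverse (f x))"
  using assms(2)
proof (induction k)
  case 0
  then show ?case using assms by (auto intro!: continuous_on_inverse)
next
  case (Suc k)
  have d: "((\<lambda>x. inverse (f x)) has_derivative
      (\<lambda>v. - (inverse (f y) * frechet_derivative f (at y) v * inverse (f y)))) (at y)"
    if "y \<in> S" for y
    using assms(3) that Suc.prems frechet_derivative_works
    by (intro Deriv.has_derivative_inverse) auto
  have "Ck_on k S (\<lambda>x. frechet_derivative (\<lambda>x. inverse (f x)) (at x) v)" for v
  proof (subst Ck_on_cong[OF assms(1)])
    show "frechet_derivative (\<lambda>x. inverse (f x)) (at y) v =
        - (inverse (f y) * frechet_derivative f (at y) v * inverse (f y))"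
      if "y \<in> S" for y
      by (simp add: frechet_derivative_at[OF d[OF that], symmetric])
    show "Ck_on k S (\<lambda>y. - (inverse (f y) * frechet_derivative f (at y) v * inverse (f y)))"
      using Suc.prems Suc.IH[OF Ck_on_SucD[OF Suc.prems]]
      by (intro Ck_on_bounded_linear[OF assms(1), where F = uminus] bounded_linear_minus bounded_linear_ident
          Ck_on_mult[OF assms(1)]) simp_all
  qed
  with d show ?case by (auto simp: differentiable_def)
qed

lemma smooth_on_inverse:
  fixes f :: "'v::real_normed_vector \<Rightarrow> 'w::real_normed_field"
  shows "open S \<Longrightarrow> smooth_on S f \<Longrightarrow> (\<And>x. x \<in> S \<Longrightarrow> f x \<noteq> 0) \<Longrightarrow> smooth_on S (\<lambda>x. inverse (f x))"
  by (simp add: smooth_on_def Ck_on_inverse)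

lemma smooth_on_det:
  fixes g :: "'v::real_normed_vector \<Rightarrow> complex^'n^'n"
  assumes "open S" "\<And>i j. smooth_on S (\<lambda>x. g x $ i $ j)"
  shows "smooth_on S (\<lambda>x. det (g x))"
  unfolding det_def
  by (intro smooth_on_sum smooth_on_mult smooth_on_prod smooth_on_const assms)

section \<open>Smoothness of the inverse matrix\<close>

lemma matrix_inv_right:
  assumes "invertible A"
  shows "A ** matrix_inv A = mat 1" "matrix_inv A ** A = mat 1"
  using assms someI_ex[of "\<lambda>A'. A ** A' = mat 1 \<and> A' ** A = mat 1"]
  unfolding invertible_def matrix_inv_def by blast+

text \<open>Column \<open>k\<close> of the inverse solves a linear system whose right-hand side is a
  unit vector, so Cramer's rule makes each entry a quotient of two determinants, both smooth in the
  entries of \<open>A\<close>.\<close>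

lemma matrix_inv_cramer:
  fixes A :: "'a::field^'n^'n"
  assumes "det A \<noteq> 0"
  shows "matrix_inv A $ l $ k = det (\<chi> i j. if j = l then of_bool (i = k) else A $ i $ j) / det A"
proof -
  have "invertible A" using assms invertible_det_nz by blast
  then have "A ** matrix_inv A = mat 1" by (rule matrix_inv_right)
  have "A *v (\<chi> l. matrix_inv A $ l $ k) = (\<chi> i. of_bool (i = k))"
    using \<open>A ** matrix_inv A = mat 1\<close>
    by (simp add: vec_eq_iff matrix_vector_mult_def matrix_matrix_mult_def mat_def)
  then have "(\<chi> l. matrix_inv A $ l $ k) =
      (\<chi> l. det (\<chi> i j. if j = l then (\<chi> i. of_bool (i = k)) $ i else A $ i $ j) / det A)"
    using cramer[OF assms] by blast
  then have "matrix_inv A $ l $ k =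
      det (\<chi> i j. if j = l then (\<chi> i. of_bool (i = k)) $ i else A $ i $ j) / det A"
    by (simp only: vec_eq_iff vec_lambda_beta)
  then show ?thesis by (simp only: vec_lambda_beta)
qed

lemma smooth_on_matrix_inv:
  fixes g :: "'v::real_normed_vector \<Rightarrow> complex^'n^'n"
  assumes "open S" "\<And>i j. smooth_on S (\<lambda>x. g x $ i $ j)" "\<And>x. x \<in> S \<Longrightarrow> invertible (g x)"
  shows "smooth_on S (\<lambda>x. matrix_inv (g x) $ l $ k)"
proof -
  have nz: "det (g x) \<noteq> 0" if "x \<in> S" for x using assms(3) that invertible_det_nz by blast
  have "smooth_on S (\<lambda>x. det (\<chi> i j. if j = l then of_bool (i = k) else g x $ i $ j) * inverse (det (g x)))"
  proof (intro smooth_on_mult smooth_on_det smooth_on_inverse assms nz)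
    show "smooth_on S (\<lambda>x. (\<chi> i j. if j = l then of_bool (i = k) else g x $ i $ j) $ i $ j)" for i j
      using assms(2) smooth_on_const by (cases "j = l") auto
  qed
  then show ?thesis
    by (subst smooth_on_cong[OF assms(1)]) (auto simp: matrix_inv_cramer nz divide_inverse)
qed

text \<open>The second difference of \<open>f\<close> over a small parallelogram is symmetric in the
  two directions, and divided by the square of the side parameter it is a value of either mixed
  derivative at a nearby point. Continuity of both mixed derivatives then identifies them at
  \<open>z\<close>.\<close>

lemma frechet_derivative_symmetric_real:
  fixes f :: "'v::real_normed_vector \<Rightarrow> real"
  assumes "open S" "smooth_on S f" "z \<in> S"
  shows "frechet_derivative (\<lambda>x. frechet_derivative f (at x) u) (at z) v =
         frechet_derivative (\<lambda>x. frechet_derivative f (at x) v) (at z) u"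
proof -
  define D where "D u v x = frechet_derivative (\<lambda>x. frechet_derivative f (at x) u) (at x) v" for u v x
  \<comment> \<open>The mean value theorem is used twice: first along \<open>u\<close> for the
    difference of \<open>f\<close> on two opposite sides, then along \<open>v\<close> for the
    derivative of \<open>f\<close> in direction \<open>u\<close>.\<close>
  have mean: "\<exists>\<sigma>\<in>{0..s}. \<exists>\<tau>\<in>{0..s}.
      f (z + s *\<^sub>R u + s *\<^sub>R v) - f (z + s *\<^sub>R u) - f (z + s *\<^sub>R v) + f z
        = s * s * D u v (z + \<sigma> *\<^sub>R u + \<tau> *\<^sub>R v)"
    if s: "s > 0" and sub: "\<And>\<sigma> \<tau>. \<sigma> \<in> {0..s} \<Longrightarrow> \<tau> \<in> {0..s} \<Longrightarrow> z + \<sigma> *\<^sub>R u + \<tau> *\<^sub>R v \<in> S" for s u v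
  proof -
    have d1: "((\<lambda>\<sigma>. f (z + \<sigma> *\<^sub>R u + t *\<^sub>R v)) has_derivative
        (\<lambda>h. h * frechet_derivative f (at (z + \<sigma> *\<^sub>R u + t *\<^sub>R v)) u)) (at \<sigma>)"
      if "\<sigma> \<in> {0..s}" "t \<in> {0..s}" for \<sigma> t
    proof -
      have d: "(f has_derivative frechet_derivative f (at (z + \<sigma> *\<^sub>R u + t *\<^sub>R v))) (at (z + \<sigma> *\<^sub>R u + t *\<^sub>R v))"
        using smooth_onD(1)[OF assms(2) sub[OF that]] frechet_derivative_works by blast
      have "((\<lambda>\<sigma>. f (z + \<sigma> *\<^sub>R u + t *\<^sub>R v)) has_derivative
        (\<lambda>h. frechet_derivative f (at (z + \<sigma> *\<^sub>R u + t *\<^sub>R v)) (h *\<^sub>R u))) (at \<sigma>)"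
        by (rule has_derivative_compose[where f = "\<lambda>\<sigma>. z + \<sigma> *\<^sub>R u + t *\<^sub>R v", OF _ d]) (auto intro!: derivative_eq_intros)
      then show ?thesis
        by (simp add: linear_scale[OF has_derivative_linear[OF d]])
    qed
    have d2: "((\<lambda>\<tau>. frechet_derivative f (at (z + \<sigma> *\<^sub>R u + \<tau> *\<^sub>R v)) u) has_derivative
        (\<lambda>h. h * D u v (z + \<sigma> *\<^sub>R u + \<tau> *\<^sub>R v))) (at \<tau>)"
      if "\<sigma> \<in> {0..s}" "\<tau> \<in> {0..s}" for \<sigma> \<tau>
    proof -
      let ?g = "\<lambda>x. frechet_derivative f (at x) u"
      have d: "(?g has_derivative frechet_derivative ?g (at (z + \<sigma> *\<^sub>R u + \<tau> *\<^sub>R v))) (at (z + \<sigma> *\<^sub>R u + \<tau> *\<^sub>R v))"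
        using smooth_onD(1)[OF smooth_onD(2)[OF assms(2)] sub[OF that]] frechet_derivative_works by blast
      have "((\<lambda>\<tau>. ?g (z + \<sigma> *\<^sub>R u + \<tau> *\<^sub>R v)) has_derivative
        (\<lambda>h. frechet_derivative ?g (at (z + \<sigma> *\<^sub>R u + \<tau> *\<^sub>R v)) (h *\<^sub>R v))) (at \<tau>)"
        by (rule has_derivative_compose[where f = "\<lambda>\<tau>. z + \<sigma> *\<^sub>R u + \<tau> *\<^sub>R v", OF _ d]) (auto intro!: derivative_eq_intros)
      then show ?thesis
        by (simp add: linear_scale[OF has_derivative_linear[OF d]] D_def)
    qed
    have "\<exists>\<sigma>\<in>{0<..<s}. (f (z + s *\<^sub>R u + s *\<^sub>R v) - f (z + s *\<^sub>R u + 0 *\<^sub>R v))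
         - (f (z + 0 *\<^sub>R u + s *\<^sub>R v) - f (z + 0 *\<^sub>R u + 0 *\<^sub>R v)) =
        (s - 0) * frechet_derivative f (at (z + \<sigma> *\<^sub>R u + s *\<^sub>R v)) u
          - (s - 0) * frechet_derivative f (at (z + \<sigma> *\<^sub>R u + 0 *\<^sub>R v)) u"
      by (rule mvt_simple[OF s, where f = "\<lambda>\<sigma>. f (z + \<sigma> *\<^sub>R u + s *\<^sub>R v) - f (z + \<sigma> *\<^sub>R u + 0 *\<^sub>R v)"
            and f' = "\<lambda>\<sigma> h. h * frechet_derivative f (at (z + \<sigma> *\<^sub>R u + s *\<^sub>R v)) u
              - h * frechet_derivative f (at (z + \<sigma> *\<^sub>R u + 0 *\<^sub>R v)) u"])
         (rule has_derivative_at_withinI, rule has_derivative_diff; rule d1; use s in simp)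
    then obtain \<sigma> where \<sigma>: "\<sigma> \<in> {0<..<s}" and e1: "f (z + s *\<^sub>R u + s *\<^sub>R v) - f (z + s *\<^sub>R u)
         - (f (z + s *\<^sub>R v) - f z) =
        s * (frechet_derivative f (at (z + \<sigma> *\<^sub>R u + s *\<^sub>R v)) u
          - frechet_derivative f (at (z + \<sigma> *\<^sub>R u + 0 *\<^sub>R v)) u)"
      by (auto simp: right_diff_distrib)
    have "\<exists>\<tau>\<in>{0<..<s}. frechet_derivative f (at (z + \<sigma> *\<^sub>R u + s *\<^sub>R v)) u
          - frechet_derivative f (at (z + \<sigma> *\<^sub>R u + 0 *\<^sub>R v)) u =
        (s - 0) * D u v (z + \<sigma> *\<^sub>R u + \<tau> *\<^sub>R v)"
      by (rule mvt_simple[OF s, where f = "\<lambda>\<tau>. frechet_derivative f (at (z + \<sigma> *\<^sub>R u + \<tau> *\<^sub>R v)) u"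
            and f' = "\<lambda>\<tau> h. h * D u v (z + \<sigma> *\<^sub>R u + \<tau> *\<^sub>R v)"])
         (rule has_derivative_at_withinI, rule d2; use \<sigma> in simp)
    then obtain \<tau> where "\<tau> \<in> {0<..<s}" "frechet_derivative f (at (z + \<sigma> *\<^sub>R u + s *\<^sub>R v)) u
          - frechet_derivative f (at (z + \<sigma> *\<^sub>R u + 0 *\<^sub>R v)) u = s * D u v (z + \<sigma> *\<^sub>R u + \<tau> *\<^sub>R v)"
      by auto
    with e1 \<sigma> show ?thesis by (intro bexI[of _ \<sigma>] bexI[of _ \<tau>]) simp_all
  qed
  have sm: "smooth_on S (D u v)" for u v
    unfolding D_def using smooth_onD(2)[OF smooth_onD(2)[OF assms(2)]] .
  have "\<bar>D u v z - D v u z\<bar> < e" if e: "e > 0" for e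
  proof -
    have cont: "\<exists>d>0. \<forall>x. dist x z < d \<longrightarrow> dist (D u v x) (D u v z) < e / 2" for u v
    proof -
      have "continuous (at z) (D u v)"
        using sm[THEN smooth_onD(3), of u v] assms(1,3) by (simp add: continuous_on_eq_continuous_at)
      then show ?thesis using half_gt_zero[OF e] by (simp only: continuous_at_eps_delta) 
    qed
    obtain d1 where d1: "d1 > 0" "\<And>x. dist x z < d1 \<Longrightarrow> dist (D u v x) (D u v z) < e / 2"
      using cont[of u v] by auto
    obtain d2 where d2: "d2 > 0" "\<And>x. dist x z < d2 \<Longrightarrow> dist (D v u x) (D v u z) < e / 2"
      using cont[of v u] by auto
    note d = d1(1) d2(1) d1(2) d2(2)
    obtain d3 where d3: "d3 > 0" "ball z d3 \<subseteq> S" by (rule openE[OF assms(1,3)])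
    define d where "d = min d1 (min d2 d3)"
    have "d > 0" using d d3 by (simp add: d_def)
    \<comment> \<open>The factor 2 keeps the whole parallelogram strictly within distance
      \<open>d\<close> of \<open>z\<close>; the summand 1 keeps the denominator positive when both
      directions vanish.\<close>
    define s where "s = d / (2 * (norm u + norm v + 1))"
    have N: "norm u + norm v + 1 > 0" by (simp add: add_nonneg_pos)
    have s: "s > 0" unfolding s_def using \<open>d > 0\<close> N by simp
    have near: "dist (z + \<sigma> *\<^sub>R u + \<tau> *\<^sub>R v) z < d" if "\<sigma> \<in> {0..s}" "\<tau> \<in> {0..s}" for \<sigma> \<tau>
    proof -
      have "dist (z + \<sigma> *\<^sub>R u + \<tau> *\<^sub>R v) z = norm (\<sigma> *\<^sub>R u + \<tau> *\<^sub>R v)"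
        by (simp add: dist_norm)
      also have "\<dots> \<le> \<sigma> * norm u + \<tau> * norm v"
        using that by (intro norm_triangle_le) simp
      also have "\<dots> \<le> s * norm u + s * norm v"
        using that by (intro add_mono mult_right_mono) auto
      also have "\<dots> < s * (norm u + norm v + 1)" using s by (simp add: algebra_simps)
      also have "\<dots> = d / 2" unfolding s_def using N by (simp add: field_simps)
      finally show ?thesis using \<open>d > 0\<close> by simp
    qed
    have near': "dist (z + \<sigma> *\<^sub>R v + \<tau> *\<^sub>R u) z < d" if "\<sigma> \<in> {0..s}" "\<tau> \<in> {0..s}" for \<sigma> \<tau>
      using near[OF that(2,1)] by (simp add: algebra_simps)
    have inS: "x \<in> S" if "dist x z < d" for x
      using that d3 by (auto simp: d_def dist_commute subset_iff)
    obtain \<sigma> \<tau> where 1: "\<sigma> \<in> {0..s}" "\<tau> \<in> {0..s}"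
      "f (z + s *\<^sub>R u + s *\<^sub>R v) - f (z + s *\<^sub>R u) - f (z + s *\<^sub>R v) + f z
        = s * s * D u v (z + \<sigma> *\<^sub>R u + \<tau> *\<^sub>R v)"
      using mean[OF s, of u v, OF inS[OF near]] by blast
    obtain \<sigma>' \<tau>' where 2: "\<sigma>' \<in> {0..s}" "\<tau>' \<in> {0..s}"
      "f (z + s *\<^sub>R v + s *\<^sub>R u) - f (z + s *\<^sub>R v) - f (z + s *\<^sub>R u) + f z
        = s * s * D v u (z + \<sigma>' *\<^sub>R v + \<tau>' *\<^sub>R u)"
      using mean[OF s, of v u, OF inS[OF near']] by blast
    have "s * s * D u v (z + \<sigma> *\<^sub>R u + \<tau> *\<^sub>R v) = s * s * D v u (z + \<sigma>' *\<^sub>R v + \<tau>' *\<^sub>R u)"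
      using 1(3) 2(3) by (simp add: algebra_simps)
    then have "D u v (z + \<sigma> *\<^sub>R u + \<tau> *\<^sub>R v) = D v u (z + \<sigma>' *\<^sub>R v + \<tau>' *\<^sub>R u)"
      using s by simp
    moreover have "dist (D u v (z + \<sigma> *\<^sub>R u + \<tau> *\<^sub>R v)) (D u v z) < e / 2"
      using near[OF 1(1,2)] d(3) by (simp add: d_def)
    moreover have "dist (D v u (z + \<sigma>' *\<^sub>R v + \<tau>' *\<^sub>R u)) (D v u z) < e / 2"
      using near'[OF 2(1,2)] d(4) by (simp add: d_def)
    ultimately show ?thesis unfolding dist_real_def by linarith
  qed
  from this[of "\<bar>D u v z - D v u z\<bar>"] have "D u v z = D v u z" by auto
  then show ?thesis by (simp add: D_def)
qed

lemma frechet_derivative_symmetric: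
  fixes f :: "'v::real_normed_vector \<Rightarrow> complex"
  assumes S: "open S" "smooth_on S f" "z \<in> S"
  shows "frechet_derivative (\<lambda>x. frechet_derivative f (at x) u) (at z) v =
         frechet_derivative (\<lambda>x. frechet_derivative f (at x) v) (at z) u"
proof -
  have *: "F (frechet_derivative (\<lambda>x. frechet_derivative f (at x) u) (at z) v) =
         F (frechet_derivative (\<lambda>x. frechet_derivative f (at x) v) (at z) u)"
    if F: "bounded_linear F" for F :: "complex \<Rightarrow> real"
  proof -
    have "F (frechet_derivative (\<lambda>x. frechet_derivative f (at x) u) (at z) v) =
      frechet_derivative (\<lambda>x. frechet_derivative (\<lambda>x. F (f x)) (at x) u) (at z) v" for u v
    proof -
      have "F (frechet_derivative (\<lambda>x. frechet_derivative f (at x) u) (at z) v) =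
        frechet_derivative (\<lambda>x. F (frechet_derivative f (at x) u)) (at z) v"
        by (simp add: frechet_derivative_bounded_linear[OF F]
            smooth_onD(1)[OF smooth_onD(2)[OF S(2)] S(3)])
      also have "\<dots> = frechet_derivative (\<lambda>x. frechet_derivative (\<lambda>x. F (f x)) (at x) u) (at z) v"
        by (subst frechet_derivative_cong_open[OF S(1) S(3)])
           (auto simp: frechet_derivative_bounded_linear[OF F smooth_onD(1)[OF S(2)]])
      finally show ?thesis .
    qed
    then show ?thesis
      using frechet_derivative_symmetric_real[OF S(1) smooth_on_bounded_linear[OF S(1) F S(2)] S(3)]
      by simp
  qed
  show ?thesis using *[OF bounded_linear_Re] *[OF bounded_linear_Im] by (simp add: complex_eq_iff)
qed

section \<open>Wirtinger calculus\<close>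

lemma smooth_on_dz: "open S \<Longrightarrow> smooth_on S f \<Longrightarrow> smooth_on S (dz i f)"
  unfolding dz_def[abs_def]
  by (intro smooth_on_divide_const smooth_on_diff smooth_on_mult smooth_on_const smooth_onD(2))

lemma smooth_on_dzbar: "open S \<Longrightarrow> smooth_on S f \<Longrightarrow> smooth_on S (dzbar i f)"
  unfolding dzbar_def[abs_def]
  by (intro smooth_on_divide_const smooth_on_add smooth_on_mult smooth_on_const smooth_onD(2))

lemma dz_cong:
  assumes "open S" "z \<in> S" "\<And>y. y \<in> S \<Longrightarrow> f y = g y"
  shows "dz i f z = dz i g z" "dzbar i f z = dzbar i g z"
proof -
  have "frechet_derivative f (at z) = frechet_derivative g (at z)"
    by (rule frechet_derivative_cong_open[OF assms])
  then show "dz i f z = dz i g z" "dzbar i f z = dzbar i g z" by (simp_all add: dz_def dzbar_def)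
qed

lemma dz_const [simp]: "dz i (\<lambda>x. c) z = 0" "dzbar i (\<lambda>x. c) z = 0"
  by (simp_all add: dz_def dzbar_def frechet_derivative_const)

lemma dz_add:
  assumes "f differentiable (at z)" "g differentiable (at z)"
  shows "dz i (\<lambda>x. f x + g x) z = dz i f z + dz i g z"
    "dzbar i (\<lambda>x. f x + g x) z = dzbar i f z + dzbar i g z"
  unfolding dz_def dzbar_def frechet_derivative_plus[OF assms] by (simp_all add: algebra_simps add_divide_distrib diff_divide_distrib)

lemma dz_diff:
  assumes "f differentiable (at z)" "g differentiable (at z)"
  shows "dz i (\<lambda>x. f x - g x) z = dz i f z - dz i g z"
    "dzbar i (\<lambda>x. f x - g x) z = dzbar i f z - dzbar i g z"
  unfolding dz_def dzbar_def frechet_derivative_minus[OF assms] by (simp_all add: algebra_simps add_divide_distrib diff_divide_distrib)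

lemma dz_mult:
  assumes "f differentiable (at z)" "g differentiable (at z)"
  shows "dz i (\<lambda>x. f x * g x) z = f z * dz i g z + dz i f z * g z"
    "dzbar i (\<lambda>x. f x * g x) z = f z * dzbar i g z + dzbar i f z * g z"
proof -
  have "frechet_derivative (\<lambda>x. f x * g x) (at z) =
    (\<lambda>v. f z * frechet_derivative g (at z) v + frechet_derivative f (at z) v * g z)"
    by (rule frechet_derivative_at[symmetric])
       (intro has_derivative_mult assms[unfolded frechet_derivative_works])
  then show "dz i (\<lambda>x. f x * g x) z = f z * dz i g z + dz i f z * g z"
    "dzbar i (\<lambda>x. f x * g x) z = f z * dzbar i g z + dzbar i f z * g z"
    by (simp_all add: dz_def dzbar_def field_simps)
qed

lemma dz_cmult:
  assumes "f differentiable (at z)"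
  shows "dz i (\<lambda>x. c * f x) z = c * dz i f z" "dzbar i (\<lambda>x. c * f x) z = c * dzbar i f z"
  using dz_mult[of "\<lambda>x. c" z f i] assms by auto

lemma dz_sum:
  assumes "\<And>k. k \<in> I \<Longrightarrow> f k differentiable (at z)"
  shows "dz i (\<lambda>x. \<Sum>k\<in>I. f k x) z = (\<Sum>k\<in>I. dz i (f k) z)"
    "dzbar i (\<lambda>x. \<Sum>k\<in>I. f k x) z = (\<Sum>k\<in>I. dzbar i (f k) z)"
  using assms
  by (induction I rule: infinite_finite_induct) (auto simp: dz_add differentiable_sum)

lemma dz_cnj:
  assumes "f differentiable (at z)"
  shows "dz i (\<lambda>x. cnj (f x)) z = cnj (dzbar i f z)" "dzbar i (\<lambda>x. cnj (f x)) z = cnj (dz i f z)"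
  by (simp_all add: dz_def dzbar_def frechet_derivative_bounded_linear[OF bounded_linear_cnj assms])

lemma axis_complex_decomp:
  fixes v :: "complex^'n"
  shows "v = (\<Sum>i\<in>UNIV. Re (v $ i) *\<^sub>R axis i 1 + Im (v $ i) *\<^sub>R axis i \<i>)"
  by (simp add: vec_eq_iff axis_def if_distrib sum.distrib complex_eq_iff cong: if_cong)

lemma frechet_derivative_dz:
  assumes "f differentiable (at z)"
  shows "frechet_derivative f (at z) v = (\<Sum>i\<in>UNIV. v $ i * dz i f z + cnj (v $ i) * dzbar i f z)"
proof -
  have L: "linear (frechet_derivative f (at z))"
    using assms linear_frechet_derivative by blast
  have "frechet_derivative f (at z) v = (\<Sum>i\<in>UNIV. Re (v $ i) *\<^sub>R frechet_derivative f (at z) (axis i 1)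
       + Im (v $ i) *\<^sub>R frechet_derivative f (at z) (axis i \<i>))"
    by (subst axis_complex_decomp[of v])
       (simp add: linear_sum[OF L] linear_add[OF L] linear_scale[OF L])
  also have "\<dots> = (\<Sum>i\<in>UNIV. v $ i * dz i f z + cnj (v $ i) * dzbar i f z)"
    by (intro sum.cong refl) (simp add: dz_def dzbar_def complex_eq_iff field_simps)
  finally show ?thesis .
qed

lemma frechet_derivative_axis:
  fixes f :: "complex^'n \<Rightarrow> complex"
  assumes "f differentiable (at z)"
  shows "frechet_derivative f (at z) (axis i \<alpha>) = \<alpha> * dz i f z + cnj \<alpha> * dzbar i f z"
proof -
  have "(\<Sum>k\<in>UNIV. axis i \<alpha> $ k * dz k f z + cnj (axis i \<alpha> $ k) * dzbar k f z) =
     (\<Sum>k\<in>UNIV. if k = i then \<alpha> * dz k f z + cnj \<alpha> * dzbar k f z else 0)"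
    by (intro sum.cong refl) (auto simp: axis_def)
  then show ?thesis using frechet_derivative_dz[OF assms, of "axis i \<alpha>"] by simp
qed

lemma dz_commute:
  assumes "open S" "smooth_on S f" "z \<in> S"
  shows "dz i (dzbar j f) z = dzbar j (dz i f) z"
    and "dzbar i (dzbar j f) z = dzbar j (dzbar i f) z"
proof -
  define D where "D u x = frechet_derivative f (at x) u" for u x
  have d: "D u differentiable (at z)" for u
    unfolding D_def by (rule smooth_onD(1)[OF smooth_onD(2)[OF assms(2)] assms(3)])
  have D1: "frechet_derivative (\<lambda>x. (D u x + c * D v x) / 2) (at z) w =
     (frechet_derivative (D u) (at z) w + c * frechet_derivative (D v) (at z) w) / 2" for u v c w
  proof -
    have "((\<lambda>x. (D u x + c * D v x) / 2) has_derivative (\<lambda>w. (frechet_derivative (D u) (at z) w + c * frechet_derivative (D v) (at z) w) / 2)) (at z)"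
      using d frechet_derivative_works
      by (intro bounded_linear.has_derivative[OF bounded_linear_divide] has_derivative_add
          bounded_linear.has_derivative[OF bounded_linear_mult_right]) auto
    then show ?thesis by (simp add: frechet_derivative_at[symmetric])
  qed
  have D2: "frechet_derivative (\<lambda>x. (D u x - c * D v x) / 2) (at z) w =
     (frechet_derivative (D u) (at z) w - c * frechet_derivative (D v) (at z) w) / 2" for u v c w
    using D1[of u "-c" v w] by simp
  have sym: "frechet_derivative (D u) (at z) v = frechet_derivative (D v) (at z) u" for u v
    unfolding D_def[abs_def] by (rule frechet_derivative_symmetric[OF assms])
  note defs = dz_def[abs_def] dzbar_def[abs_def] D_def[symmetric] D1 D2
  show "dz i (dzbar j f) z = dzbar j (dz i f) z"
    unfolding defs sym[of "axis j 1"] sym[of "axis j \<i>"] by (simp add: field_simps)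
  show "dzbar i (dzbar j f) z = dzbar j (dzbar i f) z"
    unfolding defs sym[of "axis j 1"] sym[of "axis j \<i>"] by (simp add: field_simps)
qed

section \<open>Polarization\<close>

text \<open>Separates complex linear from conjugate linear parts. Inserting
  \<open>axis i \<alpha>\<close> into a real-linear identity and comparing coefficients of \<alpha>
  and \<open>cnj \<alpha>\<close> is how types of forms are told apart below.\<close>

lemma sesquilinear_coeffs_zero:
  fixes a b :: complex
  assumes "\<And>t. a * t + b * cnj t = 0"
  shows "a = 0" "b = 0"
proof -
  have "a + b = 0" using assms[of 1] by simp
  moreover have "\<i> * (a - b) = 0" using assms[of \<i>] by (simp add: algebra_simps)
  ultimately show "a = 0" "b = 0" by auto
qed

text \<open>Inserting \<open>x + t *s z\<close> gives a polynomial in \<open>t\<close> and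
  \<open>cnj t\<close> that vanishes identically, and its pure \<open>(cnj t)\<^sup>2\<close>
  coefficient is \<open>Q x z x z\<close>. Two ordinary polarizations, in the linear and in the
  conjugate linear slots, finish the argument.\<close>

lemma polarization_biquadratic:
  fixes Q :: "complex^'n \<Rightarrow> complex^'n \<Rightarrow> complex^'n \<Rightarrow> complex^'n \<Rightarrow> complex"
  assumes add: "\<And>x x' y z w. Q (x + x') y z w = Q x y z w + Q x' y z w"
    "\<And>x y y' z w. Q x (y + y') z w = Q x y z w + Q x y' z w"
    "\<And>x y z z' w. Q x y (z + z') w = Q x y z w + Q x y z' w"
    "\<And>x y z w w'. Q x y z (w + w') = Q x y z w + Q x y z w'"
  and scale: "\<And>t x y z w. Q (t *s x) y z w = t * Q x y z w"
    "\<And>t x y z w. Q x (t *s y) z w = cnj t * Q x y z w"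
    "\<And>t x y z w. Q x y (t *s z) w = t * Q x y z w"
    "\<And>t x y z w. Q x y z (t *s w) = cnj t * Q x y z w"
  and zero: "\<And>x. Q x x x x = 0"
  shows "Q x y z w + Q z y x w + Q x w z y + Q z w x y = 0"
proof -
  have A: "Q x z x z = 0" for x z
  proof -
    define c20 where "c20 = Q z x z x"
    define c02 where "c02 = Q x z x z"
    define c11 where "c11 = Q z z x x + Q z x x z + Q x z z x + Q x x z z"
    define c22 where "c22 = Q z z z z"
    define c00 where "c00 = Q x x x x"
    define d1 where "d1 = Q z x x x + Q x x z x"
    define d2 where "d2 = Q x z x x + Q x x x z"
    define d3 where "d3 = Q z z z x + Q z x z z"
    define d4 where "d4 = Q z z x z + Q x z z z"
    have P: "c00 + t * d1 + cnj t * d2 + t\<^sup>2 * c20 + t * cnj t * c11 + (cnj t)\<^sup>2 * c02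
        + t\<^sup>2 * cnj t * d3 + t * (cnj t)\<^sup>2 * d4 + t\<^sup>2 * (cnj t)\<^sup>2 * c22 = 0" for t
    proof -
      have "Q (x + t *s z) (x + t *s z) (x + t *s z) (x + t *s z) = 0" by (rule zero)
      then show ?thesis
        unfolding add scale c20_def c02_def c11_def c22_def c00_def d1_def d2_def d3_def d4_def
        by (simp add: algebra_simps power2_eq_square)
    qed
    \<comment> \<open>Adding the values at \<open>t\<close> and \<open>-t\<close> removes the terms
      of degree one and three.\<close>
    have E: "c00 + t\<^sup>2 * c20 + t * cnj t * c11 + (cnj t)\<^sup>2 * c02 + t\<^sup>2 * (cnj t)\<^sup>2 * c22 = 0" for t
    proof -
      have "2 * (c00 + t\<^sup>2 * c20 + t * cnj t * c11 + (cnj t)\<^sup>2 * c02 + t\<^sup>2 * (cnj t)\<^sup>2 * c22) = 0"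
        using arg_cong2[OF P[of t] P[of "-t"], of "(+)"] by (simp add: algebra_simps)
      then show ?thesis by (simp only: mult_eq_0_iff) simp
    qed
    \<comment> \<open>Passing from \<open>t\<close> to \<open>\<i> * t\<close> reverses the sign of
      \<open>t\<^sup>2\<close> and of its conjugate and fixes every power of
      \<open>t * cnj t\<close>, so the difference isolates the two wanted coefficients.\<close>
    have F: "t\<^sup>2 * c20 + (cnj t)\<^sup>2 * c02 = 0" for t
    proof -
      have "2 * (t\<^sup>2 * c20 + (cnj t)\<^sup>2 * c02) = 0"
        using arg_cong2[OF E[of t] E[of "\<i> * t"], of "(-)"]
        by (simp add: algebra_simps power_mult_distrib)
      then show ?thesis by (simp only: mult_eq_0_iff) simp
    qed
    \<comment> \<open>At \<open>t = 1\<close> the sum of the coefficients appears; at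
      \<open>t = 1 + \<i>\<close>, where \<open>t\<^sup>2 = 2 * \<i>\<close>, their
      difference.\<close>
    have "c20 + c02 = 0" using F[of 1] by simp
    moreover have "2 * \<i> * (c20 - c02) = 0"
      using F[of "1 + \<i>"] by (simp add: power2_eq_square algebra_simps)
    ultimately have "c02 = 0" by auto
    then show ?thesis by (simp add: c02_def)
  qed
  \<comment> \<open>Expansion of the vanishing diagonal at \<open>x + z\<close>; the same expansion
    in the second and fourth slots, at \<open>y + w\<close>, follows.\<close>
  have B: "Q x y z y + Q z y x y = 0" for x y z
    using A[of "x + z" y] A[of x y] A[of z y] unfolding add by (simp add: add.commute)
  show ?thesis
  proof -
    have "(Q x (y + w) z (y + w) + Q z (y + w) x (y + w)) - (Q x y z y + Q z y x y) - (Q x w z w + Q z w x w) = 0"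
      by (simp only: B) simp
    then show ?thesis unfolding add by (simp add: algebra_simps)
  qed
qed

lemma polarization_coeffs:
  fixes q :: "'n::finite \<Rightarrow> 'n \<Rightarrow> 'n \<Rightarrow> 'n \<Rightarrow> complex"
  assumes "\<And>X :: complex^'n.
    (\<Sum>i\<in>UNIV. \<Sum>j\<in>UNIV. \<Sum>k\<in>UNIV. \<Sum>l\<in>UNIV. q i j k l * X $ i * cnj (X $ j) * X $ k * cnj (X $ l)) = 0"
  shows "q i j k l + q k j i l + q i l k j + q k l i j = 0"
proof -
  define Q where "Q x y z w = (\<Sum>i\<in>UNIV. \<Sum>j\<in>UNIV. \<Sum>k\<in>UNIV. \<Sum>l\<in>UNIV.
    q i j k l * x $ i * cnj (y $ j) * z $ k * cnj (w $ l))" for x y z w :: "complex^'n"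
  have *: "Q (axis i 1) (axis j 1) (axis k 1) (axis l 1) = q i j k l" for i j k l
  proof -
    have "Q (axis i 1) (axis j 1) (axis k 1) (axis l 1) =
      (\<Sum>i'\<in>UNIV. \<Sum>j'\<in>UNIV. \<Sum>k'\<in>UNIV. \<Sum>l'\<in>UNIV.
        if l' = l then if k' = k then if j' = j then if i' = i then q i' j' k' l' else 0 else 0 else 0 else 0)"
      unfolding Q_def by (intro sum.cong refl) (simp add: axis_def)
    also have "\<dots> = q i j k l" by simp
    finally show ?thesis .
  qed
  have "Q x y z w + Q z y x w + Q x w z y + Q z w x y = 0" for x y z w
  proof (rule polarization_biquadratic)
    show "Q x x x x = 0" for x unfolding Q_def by (rule assms)
  qed (simp_all add: Q_def sum.distrib sum_distrib_left algebra_simps)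
  from this[of "axis i 1" "axis j 1" "axis k 1" "axis l 1"] show ?thesis unfolding * .
qed

section \<open>Locally conformal Kaehler metrics in a chart\<close>

lemma fundamental_form_axis:
  "fundamental_form g z (axis k \<alpha>) (axis i \<beta>) =
     \<i> * (g z $ k $ i * (\<alpha> * cnj \<beta>) - g z $ i $ k * (\<beta> * cnj \<alpha>))"
proof -
  have "(\<Sum>p\<in>UNIV. \<Sum>q\<in>UNIV. g z $ p $ q * (axis k \<alpha> $ p * cnj (axis i \<beta> $ q) - axis i \<beta> $ p * cnj (axis k \<alpha> $ q)))
    = (\<Sum>p\<in>UNIV. \<Sum>q\<in>UNIV. (if q = i then if p = k then g z $ p $ q * (\<alpha> * cnj \<beta>) else 0 else 0)
        - (if q = k then if p = i then g z $ p $ q * (\<beta> * cnj \<alpha>) else 0 else 0))"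
    by (intro sum.cong refl) (simp add: axis_def algebra_simps)
  then show ?thesis by (simp add: fundamental_form_def sum_subtractf)
qed

text \<open>The data of one chart, detached from the manifold: all tensor identities are proved on
  an open set of coordinates and transported to the manifold only later.\<close>

locale local_lck =
  fixes S :: "(complex^'n) set" and h :: "'n::finite local_metric" and \<theta> :: "('n, real) form1"
  assumes open_S: "open S"
    and smooth_h: "\<And>i j. smooth_on S (\<lambda>z. h z $ i $ j)"
    and hermitian: "\<And>z i j. z \<in> S \<Longrightarrow> h z $ j $ i = cnj (h z $ i $ j)"
    and positive: "\<And>z X. z \<in> S \<Longrightarrow> X \<noteq> 0 \<Longrightarrow> Re (herm (h z) X X) > 0"
    and linear_\<theta>: "\<And>z. z \<in> S \<Longrightarrow> linear (\<theta> z)"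
    and smooth_\<theta>: "\<And>v. smooth_on S (\<lambda>z. \<theta> z v)"
    and closed_\<theta>: "\<And>z u v. z \<in> S \<Longrightarrow> ext_d1 \<theta> z u v = 0"
    and lck: "\<And>z u v w. z \<in> S \<Longrightarrow>
      ext_d2 (fundamental_form h) z u v w = wedge12 \<theta> (fundamental_form h) z u v w"
begin

text \<open>Coefficient of \<open>dz\<^sup>i\<close> in \<theta>: as \<theta> is real, it is the sum
  of its \<open>(1,0)\<close>-part with these coefficients and the conjugate of that part.\<close>

definition lee :: "'n \<Rightarrow> complex^'n \<Rightarrow> complex" where
  "lee i z = (complex_of_real (\<theta> z (axis i 1)) - \<i> * complex_of_real (\<theta> z (axis i \<i>))) / 2"

text \<open>The Chern connection has no Christoffel symbols of mixed type, so this plain derivative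
  is already the covariant derivative of the \<open>(1,0)\<close>-part of \<theta> in a barred
  direction.\<close>

definition lee_hess :: "'n \<Rightarrow> 'n \<Rightarrow> complex^'n \<Rightarrow> complex" where
  "lee_hess i j z = dzbar j (lee i) z"

text \<open>With the arguments in this order \<open>inv_h z l k\<close> is the component of the
  inverse metric with upper indices \<open>k\<close> and barred \<open>l\<close>.\<close>

definition inv_h :: "complex^'n \<Rightarrow> 'n \<Rightarrow> 'n \<Rightarrow> complex" where
  "inv_h z l k = matrix_inv (h z) $ l $ k"

definition lee_trace :: "complex^'n \<Rightarrow> complex" where
  "lee_trace z = (\<Sum>k\<in>UNIV. \<Sum>l\<in>UNIV. lee_hess k l z * inv_h z l k)"

text \<open>Components of the \<open>(1,0)\<close>-field obtained by raising the index of the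
  \<open>(0,1)\<close>-part of \<theta>; its pairing with \<open>lee\<close> is the squared norm of
  this field.\<close>

definition lee_vec :: "'n \<Rightarrow> complex^'n \<Rightarrow> complex" where
  "lee_vec i z = (\<Sum>j\<in>UNIV. inv_h z j i * cnj (lee j z))"

abbreviation "Gam i j k z \<equiv> chern_Gamma h i j k z"

lemma smooth_lee: "smooth_on S (lee i)"
  unfolding lee_def[abs_def]
  by (intro smooth_on_divide_const smooth_on_diff smooth_on_mult smooth_on_const
      smooth_on_of_real smooth_\<theta> open_S)

lemma \<theta>_lee:
  assumes "z \<in> S"
  shows "complex_of_real (\<theta> z v) = (\<Sum>i\<in>UNIV. v $ i * lee i z + cnj (v $ i) * cnj (lee i z))"
proof -
  note L = linear_\<theta>[OF assms]
  have "\<theta> z v = (\<Sum>i\<in>UNIV. Re (v $ i) *\<^sub>R \<theta> z (axis i 1) + Im (v $ i) *\<^sub>R \<theta> z (axis i \<i>))"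
    by (subst axis_complex_decomp[of v])
       (simp add: linear_sum[OF L] linear_add[OF L] linear_scale[OF L])
  then have "complex_of_real (\<theta> z v) =
      (\<Sum>i\<in>UNIV. complex_of_real (Re (v $ i) *\<^sub>R \<theta> z (axis i 1) + Im (v $ i) *\<^sub>R \<theta> z (axis i \<i>)))"
    by simp
  also have "\<dots> = (\<Sum>i\<in>UNIV. v $ i * lee i z + cnj (v $ i) * cnj (lee i z))"
    by (intro sum.cong refl) (simp add: lee_def complex_eq_iff field_simps)
  finally show ?thesis .
qed

lemma \<theta>_axis:
  assumes "z \<in> S"
  shows "complex_of_real (\<theta> z (axis i \<alpha>)) = \<alpha> * lee i z + cnj \<alpha> * cnj (lee i z)"
proof -
  have "(\<Sum>k\<in>UNIV. axis i \<alpha> $ k * lee k z + cnj (axis i \<alpha> $ k) * cnj (lee k z)) =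
     (\<Sum>k\<in>UNIV. if k = i then \<alpha> * lee k z + cnj \<alpha> * cnj (lee k z) else 0)"
    by (intro sum.cong refl) (auto simp: axis_def)
  then show ?thesis using \<theta>_lee[OF assms, of "axis i \<alpha>"] by simp
qed

section \<open>Torsion of the Chern connection\<close>

lemma differentiable_h: "z \<in> S \<Longrightarrow> (\<lambda>z. h z $ i $ j) differentiable (at z)"
  using smooth_h smooth_onD(1) by blast

text \<open>This is the part of type \<open>(2,1)\<close> of the equation
  \<open>d\<omega> = \<theta> \<and> \<omega>\<close>, read off by evaluating on
  \<open>axis k \<alpha>\<close>, \<open>axis i \<beta>\<close>, \<open>axis j \<gamma>\<close> with
  arbitrary complex parameters.\<close>

lemma torsion:
  assumes z: "z \<in> S"
  shows "dz k (\<lambda>x. h x $ i $ j) z - dz i (\<lambda>x. h x $ k $ j) z =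
    lee k z * h z $ i $ j - lee i z * h z $ k $ j"
proof -
  define d where "d k i j = dz k (\<lambda>x. h x $ i $ j) z" for k i j
  define e where "e k i j = dzbar k (\<lambda>x. h x $ i $ j) z" for k i j
  have D: "frechet_derivative (\<lambda>x. fundamental_form h x (axis p \<beta>) (axis q \<gamma>)) (at z) (axis r \<alpha>) =
      \<i> * ((\<alpha> * d r p q + cnj \<alpha> * e r p q) * (\<beta> * cnj \<gamma>) - (\<alpha> * d r q p + cnj \<alpha> * e r q p) * (\<gamma> * cnj \<beta>))"
    for p q r \<alpha> \<beta> \<gamma>
  proof -
    have "((\<lambda>x. \<i> * (h x $ p $ q * (\<beta> * cnj \<gamma>) - h x $ q $ p * (\<gamma> * cnj \<beta>))) has_derivative
      (\<lambda>v. \<i> * (frechet_derivative (\<lambda>x. h x $ p $ q) (at z) v * (\<beta> * cnj \<gamma>)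
              - frechet_derivative (\<lambda>x. h x $ q $ p) (at z) v * (\<gamma> * cnj \<beta>)))) (at z)"
      by (intro has_derivative_mult_right has_derivative_diff has_derivative_mult_left
          differentiable_h[OF z, unfolded frechet_derivative_works])
    then show ?thesis
      by (simp add: fundamental_form_axis frechet_derivative_at[symmetric]
          frechet_derivative_axis[OF differentiable_h[OF z]] d_def e_def)
  qed
  define H where "H i j = h z $ i $ j" for i j
  define a where "a i = lee i z" for i
  \<comment> \<open>The evaluated equation is a sum of six monomials in \<alpha>, \<beta>, \<gamma>
    and their conjugates; \<open>X1\<close> to \<open>X6\<close> are their coefficients. Only
    \<open>X1\<close>, the coefficient of \<open>\<alpha> * \<beta> * cnj \<gamma>\<close>, is
    wanted; the others must be named so that the parameters can be eliminated one after the other.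
    The three indices may coincide, since the parameters stay independent.\<close>
  define X1 where "X1 = \<i> * (d k i j - d i k j - (a k * H i j - a i * H k j))"
  define X2 where "X2 = \<i> * (- d k j i + d j k i + a k * H j i - a j * H k i)"
  define X3 where "X3 = \<i> * (d i j k - d j i k - a i * H j k + a j * H i k)"
  define X4 where "X4 = \<i> * (- e k j i + e i j k + cnj (a k) * H j i - cnj (a i) * H j k)"
  define X5 where "X5 = \<i> * (e k i j - e j i k - cnj (a k) * H i j + cnj (a j) * H i k)"
  define X6 where "X6 = \<i> * (e j k i - e i k j - cnj (a j) * H k i + cnj (a i) * H k j)"
  have P: "(X1 * \<beta> * cnj \<gamma> + X2 * cnj \<beta> * \<gamma> + X6 * cnj \<beta> * cnj \<gamma>) * \<alpha> +
     (X3 * \<beta> * \<gamma> + X4 * cnj \<beta> * \<gamma> + X5 * \<beta> * cnj \<gamma>) * cnj \<alpha> = 0" for \<alpha> \<beta> \<gamma>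
  proof -
    have "ext_d2 (fundamental_form h) z (axis k \<alpha>) (axis i \<beta>) (axis j \<gamma>) =
      wedge12 \<theta> (fundamental_form h) z (axis k \<alpha>) (axis i \<beta>) (axis j \<gamma>)"
      by (rule lck[OF z])
    note this[unfolded ext_d2_def wedge12_def D scaleR_conv_of_real \<theta>_axis[OF z],
        unfolded fundamental_form_axis]
    then show ?thesis
      unfolding X1_def X2_def X3_def X4_def X5_def X6_def H_def a_def
      by (simp add: algebra_simps)
  qed
  have "(X1 * cnj \<gamma>) * \<beta> + (X2 * \<gamma> + X6 * cnj \<gamma>) * cnj \<beta> = 0" for \<beta> \<gamma>
  proof -
    have "(X1 * cnj \<gamma>) * \<beta> + (X2 * \<gamma> + X6 * cnj \<gamma>) * cnj \<beta> =
      X1 * \<beta> * cnj \<gamma> + X2 * cnj \<beta> * \<gamma> + X6 * cnj \<beta> * cnj \<gamma>"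
      by (simp add: algebra_simps)
    also have "\<dots> = 0" by (rule sesquilinear_coeffs_zero(1)[OF P])
    finally show ?thesis .
  qed
  then have "X1 * cnj \<gamma> = 0" for \<gamma> by (rule sesquilinear_coeffs_zero(1))
  from this[of 1] have "X1 = 0" by simp
  then show ?thesis by (simp add: X1_def d_def H_def a_def)
qed

lemma dzbar_h: "z \<in> S \<Longrightarrow> dzbar k (\<lambda>x. h x $ i $ j) z = cnj (dz k (\<lambda>x. h x $ j $ i) z)"
  using dz_cong(2)[OF open_S, of z "\<lambda>x. h x $ i $ j" "\<lambda>x. cnj (h x $ j $ i)" k] hermitian
    dz_cnj(2)[OF differentiable_h] by metis

lemma torsion_bar:
  assumes z: "z \<in> S"
  shows "dzbar l (\<lambda>x. h x $ i $ j) z - dzbar j (\<lambda>x. h x $ i $ l) z =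
    cnj (lee l z) * h z $ i $ j - cnj (lee j z) * h z $ i $ l"
proof -
  have "cnj (dz l (\<lambda>x. h x $ j $ i) z - dz j (\<lambda>x. h x $ l $ i) z) =
    cnj (lee l z * h z $ j $ i - lee j z * h z $ l $ i)"
    by (simp only: torsion[OF z])
  then show ?thesis by (simp add: hermitian[OF z, symmetric] dzbar_h[OF z])
qed

section \<open>The inverse metric, Christoffel symbols and curvature in a chart\<close>

lemma invertible_h:
  assumes z: "z \<in> S"
  shows "invertible (h z)"
proof -
  have "x = 0" if "h z *v x = 0" for x
  proof (rule ccontr)
    assume "x \<noteq> 0"
    \<comment> \<open>The matrix product contracts the barred index of \<open>h z\<close>, while
      \<open>herm\<close> conjugates its second argument; the test vector is therefore the conjugate
      of the kernel vector.\<close>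
    define X where "X = (\<chi> i. cnj (x $ i))"
    have "X \<noteq> 0" using \<open>x \<noteq> 0\<close> by (simp add: X_def vec_eq_iff)
    have "herm (h z) X X = (\<Sum>i\<in>UNIV. cnj (x $ i) * (h z *v x) $ i)"
      by (simp add: herm_def X_def matrix_vector_mult_def sum_distrib_left algebra_simps)
    also have "\<dots> = 0" using that by simp
    finally show False using positive[OF z \<open>X \<noteq> 0\<close>] by simp
  qed
  then show ?thesis
    using matrix_left_invertible_ker invertible_left_inverse by blast
qed

lemma h_inv_h:
  assumes z: "z \<in> S"
  shows "(\<Sum>l\<in>UNIV. h z $ j $ l * inv_h z l k) = of_bool (j = k)"
    "(\<Sum>l\<in>UNIV. inv_h z j l * h z $ l $ k) = of_bool (j = k)"
  using matrix_inv_right[OF invertible_h[OF z]]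
  by (simp_all add: inv_h_def vec_eq_iff matrix_matrix_mult_def mat_def)

lemma sum_of_bool [simp]:
  fixes f :: "'n \<Rightarrow> complex"
  shows "(\<Sum>k\<in>UNIV. f k * of_bool (k = i)) = f i" "(\<Sum>k\<in>UNIV. f k * of_bool (i = k)) = f i"
    "(\<Sum>k\<in>UNIV. of_bool (k = i) * f k) = f i" "(\<Sum>k\<in>UNIV. of_bool (i = k) * f k) = f i"
  by (simp_all add: of_bool_def if_distrib if_distribR cong: if_cong)

lemma contract_right:
  assumes z: "z \<in> S"
  shows "(\<Sum>k\<in>UNIV. (\<Sum>l\<in>UNIV. x k * h z $ p $ l * inv_h z l k)) = x p"
proof -
  have "(\<Sum>k\<in>UNIV. (\<Sum>l\<in>UNIV. x k * h z $ p $ l * inv_h z l k)) =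
    (\<Sum>k\<in>UNIV. x k * (\<Sum>l\<in>UNIV. h z $ p $ l * inv_h z l k))"
    by (simp add: sum_distrib_left algebra_simps)
  then show ?thesis by (simp add: h_inv_h[OF z])
qed

lemma contract_left:
  assumes z: "z \<in> S"
  shows "(\<Sum>k\<in>UNIV. (\<Sum>l\<in>UNIV. x l * h z $ k $ q * inv_h z l k)) = x q"
proof -
  have "(\<Sum>k\<in>UNIV. (\<Sum>l\<in>UNIV. x l * h z $ k $ q * inv_h z l k)) =
    (\<Sum>l\<in>UNIV. x l * (\<Sum>k\<in>UNIV. inv_h z l k * h z $ k $ q))"
    by (subst sum.swap) (simp add: sum_distrib_left algebra_simps)
  then show ?thesis by (simp add: h_inv_h[OF z])
qed

lemma inv_h_hermitian:
  assumes z: "z \<in> S"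
  shows "cnj (inv_h z l k) = inv_h z k l"
proof -
  have "(\<Sum>q\<in>UNIV. cnj (inv_h z q k) * h z $ q $ m) = of_bool (m = k)" for m
  proof -
    have "cnj (\<Sum>q\<in>UNIV. h z $ m $ q * inv_h z q k) = of_bool (m = k)"
      unfolding h_inv_h[OF z] by simp
    then show ?thesis by (simp add: hermitian[OF z, symmetric] mult.commute)
  qed
  then have "(\<Sum>m\<in>UNIV. (\<Sum>q\<in>UNIV. cnj (inv_h z q k) * h z $ q $ m) * inv_h z m l) = inv_h z k l"
    by simp
  moreover have "(\<Sum>m\<in>UNIV. (\<Sum>q\<in>UNIV. cnj (inv_h z q k) * h z $ q $ m) * inv_h z m l) =
    (\<Sum>q\<in>UNIV. cnj (inv_h z q k) * (\<Sum>m\<in>UNIV. h z $ q $ m * inv_h z m l))"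
    unfolding sum_distrib_left sum_distrib_right by (subst sum.swap) (simp add: algebra_simps)
  moreover have "\<dots> = cnj (inv_h z l k)" by (simp add: h_inv_h[OF z])
  ultimately show ?thesis by simp
qed

lemma smooth_inv_h: "smooth_on S (\<lambda>z. inv_h z l k)"
  unfolding inv_h_def by (intro smooth_on_matrix_inv open_S smooth_h invertible_h)

lemma smooth_Gam: "smooth_on S (chern_Gamma h i j k)"
  unfolding chern_Gamma_def[abs_def] inv_h_def[symmetric]
  by (intro smooth_on_sum smooth_on_mult smooth_inv_h smooth_on_dz smooth_h open_S)

lemma Gam_h:
  assumes z: "z \<in> S"
  shows "(\<Sum>p\<in>UNIV. Gam i k p z * h z $ p $ l) = dz i (\<lambda>x. h x $ k $ l) z"
proof -
  have "(\<Sum>p\<in>UNIV. Gam i k p z * h z $ p $ l) =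
    (\<Sum>p\<in>UNIV. \<Sum>q\<in>UNIV. dz i (\<lambda>x. h x $ k $ q) z * h z $ p $ l * inv_h z q p)"
    by (simp add: chern_Gamma_def inv_h_def sum_distrib_left sum_distrib_right algebra_simps)
  then show ?thesis by (simp add: contract_left[OF z])
qed

lemma Gam_torsion:
  assumes z: "z \<in> S"
  shows "Gam i k p z - Gam k i p z = lee i z * of_bool (k = p) - lee k z * of_bool (i = p)"
proof -
  have "Gam i k p z - Gam k i p z =
    (\<Sum>l\<in>UNIV. inv_h z l p * (dz i (\<lambda>x. h x $ k $ l) z - dz k (\<lambda>x. h x $ i $ l) z))"
    by (simp add: chern_Gamma_def inv_h_def sum_subtractf algebra_simps)
  also have "\<dots> = lee i z * (\<Sum>l\<in>UNIV. h z $ k $ l * inv_h z l p) - lee k z * (\<Sum>l\<in>UNIV. h z $ i $ l * inv_h z l p)"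
    unfolding torsion[OF z] by (simp add: sum_subtractf sum_distrib_left algebra_simps)
  finally show ?thesis by (simp add: h_inv_h[OF z])
qed

text \<open>Product rule applied to \<open>Gam_h\<close>. In this form the Hermitian symmetry of the
  curvature is visible: the first term is a mixed second derivative of the metric and the second one
  a Hermitian expression in the Christoffel symbols.\<close>

lemma chern_R_eq:
  assumes z: "z \<in> S"
  shows "chern_R h i j k l z = - dzbar j (dz i (\<lambda>x. h x $ k $ l)) z
     + (\<Sum>p\<in>UNIV. \<Sum>q\<in>UNIV. Gam i k p z * h z $ p $ q * cnj (Gam j l q z))"
proof -
  have dG: "Gam i k p differentiable (at z)" for i k p
    using smooth_onD(1)[OF smooth_Gam z] .
  have "dzbar j (dz i (\<lambda>x. h x $ k $ l)) z = dzbar j (\<lambda>x. \<Sum>p\<in>UNIV. Gam i k p x * h x $ p $ l) z"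
    by (rule dz_cong(2)[OF open_S z]) (simp add: Gam_h)
  also have "\<dots> = (\<Sum>p\<in>UNIV. Gam i k p z * dzbar j (\<lambda>x. h x $ p $ l) z + dzbar j (Gam i k p) z * h z $ p $ l)"
    using dG differentiable_h[OF z] by (simp add: dz_sum dz_mult differentiable_mult)
  also have "\<dots> = (\<Sum>p\<in>UNIV. Gam i k p z * dzbar j (\<lambda>x. h x $ p $ l) z) - chern_R h i j k l z"
    by (simp add: sum.distrib chern_R_def algebra_simps)
  also have "(\<Sum>p\<in>UNIV. Gam i k p z * dzbar j (\<lambda>x. h x $ p $ l) z) =
     (\<Sum>p\<in>UNIV. \<Sum>q\<in>UNIV. Gam i k p z * h z $ p $ q * cnj (Gam j l q z))"
  proof (intro sum.cong refl)
    fix p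
    have "dzbar j (\<lambda>x. h x $ p $ l) z = (\<Sum>q\<in>UNIV. h z $ p $ q * cnj (Gam j l q z))"
      unfolding dzbar_h[OF z] Gam_h[OF z, symmetric] by (simp add: hermitian[OF z, symmetric] mult.commute)
    then show "Gam i k p z * dzbar j (\<lambda>x. h x $ p $ l) z =
       (\<Sum>q\<in>UNIV. Gam i k p z * h z $ p $ q * cnj (Gam j l q z))"
      by (simp add: sum_distrib_left mult.assoc)
  qed
  finally show ?thesis by simp
qed

lemma chern_R_cnj:
  assumes z: "z \<in> S"
  shows "cnj (chern_R h i j k l z) = chern_R h j i l k z"
proof -
  have "cnj (dzbar j (dz i (\<lambda>x. h x $ k $ l)) z) = dz j (\<lambda>x. cnj (dz i (\<lambda>x. h x $ k $ l) x)) z"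
    by (rule dz_cnj(1)[symmetric])
       (rule smooth_onD(1)[OF smooth_on_dz[OF open_S smooth_h] z])
  also have "\<dots> = dz j (dzbar i (\<lambda>x. h x $ l $ k)) z"
    by (rule dz_cong(1)[OF open_S z]) (simp add: dzbar_h)
  also have "\<dots> = dzbar i (dz j (\<lambda>x. h x $ l $ k)) z"
    by (rule dz_commute(1)[OF open_S smooth_h z])
  finally have 1: "cnj (dzbar j (dz i (\<lambda>x. h x $ k $ l)) z) = dzbar i (dz j (\<lambda>x. h x $ l $ k)) z" .
  have "cnj (\<Sum>p\<in>UNIV. \<Sum>q\<in>UNIV. Gam i k p z * h z $ p $ q * cnj (Gam j l q z)) =
     (\<Sum>p\<in>UNIV. \<Sum>q\<in>UNIV. Gam j l q z * h z $ q $ p * cnj (Gam i k p z))" by (simp add: hermitian[OF z, symmetric] algebra_simps)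
  also have "\<dots> = (\<Sum>p\<in>UNIV. \<Sum>q\<in>UNIV. Gam j l p z * h z $ p $ q * cnj (Gam i k q z))"
    by (rule sum.swap)
  finally show ?thesis unfolding chern_R_eq[OF z] using 1 by simp
qed

text \<open>The part of type \<open>(1,1)\<close> of \<open>d\<theta> = 0\<close>: closedness makes
  the real derivatives \<open>s u v\<close> symmetric, and reality of \<theta> turns this into
  Hermitian symmetry.\<close>

lemma lee_hess_hermitian:
  assumes z: "z \<in> S"
  shows "cnj (lee_hess i j z) = lee_hess j i z"
proof -
  define t where "t v x = complex_of_real (\<theta> x v)" for v x
  have dt: "(\<lambda>x. \<theta> x v) differentiable (at z)" for v using smooth_onD(1)[OF smooth_\<theta> z] .
  have ddt: "t v differentiable (at z)" for v
    unfolding t_def[abs_def]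
    using smooth_onD(1)[OF smooth_on_of_real[OF open_S smooth_\<theta>] z] .
  define s where "s u v = frechet_derivative (\<lambda>x. \<theta> x v) (at z) u" for u v
  have s: "frechet_derivative (t v) (at z) u = complex_of_real (s u v)" for u v
    unfolding t_def[abs_def] s_def
    by (simp add: frechet_derivative_bounded_linear[OF bounded_linear_of_real dt])
  have sym: "s u v = s v u" for u v
    using closed_\<theta>[OF z, of u v] by (simp add: ext_d1_def s_def)
  have L: "dzbar j (lee i) z = (dzbar j (t (axis i 1)) z - \<i> * dzbar j (t (axis i \<i>)) z) / 2" for i j
  proof -
    have "lee i = (\<lambda>x. (1/2) * (t (axis i 1) x - \<i> * t (axis i \<i>) x))"
      by (simp add: lee_def t_def fun_eq_iff)
    then show ?thesis
      using ddt by (simp only: dz_cmult dz_diff differentiable_diff differentiable_mult differentiable_const)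
        simp
  qed
  show ?thesis
    unfolding lee_hess_def L
    unfolding dzbar_def s sym[of "axis j 1" "axis i 1"] sym[of "axis j 1" "axis i \<i>"]
      sym[of "axis j \<i>" "axis i 1"] sym[of "axis j \<i>" "axis i \<i>"]
    by (simp add: complex_eq_iff field_simps)
qed

text \<open>First Bianchi identity with torsion: exchanging the unbarred indices costs the barred
  derivative of the torsion, and by \<open>Gam_torsion\<close> that is a derivative of the Lee form
  times a Kronecker symbol. Lowering the index turns the Kronecker symbol into the metric.\<close>

lemma chern_R_swap1:
  assumes z: "z \<in> S"
  shows "chern_R h k j i l z = chern_R h i j k l z + lee_hess i j z * h z $ k $ l - lee_hess k j z * h z $ i $ l"
proof -
  have dG: "Gam i k p differentiable (at z)" for i k p
    using smooth_onD(1)[OF smooth_Gam z] .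
  have dl: "lee i differentiable (at z)" for i using smooth_onD(1)[OF smooth_lee z] .
  have "dzbar j (Gam i k p) z - dzbar j (Gam k i p) z =
      lee_hess i j z * of_bool (k = p) - lee_hess k j z * of_bool (i = p)" for p
  proof -
    have "dzbar j (Gam i k p) z - dzbar j (Gam k i p) z = dzbar j (\<lambda>x. Gam i k p x - Gam k i p x) z"
      by (simp add: dz_diff dG)
    also have "\<dots> = dzbar j (\<lambda>x. of_bool (k = p) * lee i x - of_bool (i = p) * lee k x) z"
      by (rule dz_cong(2)[OF open_S z]) (simp add: Gam_torsion)
    also have "\<dots> = of_bool (k = p) * lee_hess i j z - of_bool (i = p) * lee_hess k j z"
      unfolding lee_hess_def using dl by (simp add: dz_diff dz_cmult differentiable_mult)
    finally show ?thesis by (simp add: mult.commute)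
  qed
  then have "(\<Sum>p\<in>UNIV. h z $ p $ l * (dzbar j (Gam i k p) z - dzbar j (Gam k i p) z)) =
     (\<Sum>p\<in>UNIV. h z $ p $ l * (lee_hess i j z * of_bool (k = p) - lee_hess k j z * of_bool (i = p)))"
    by simp
  also have "\<dots> = (\<Sum>p\<in>UNIV. (h z $ p $ l * lee_hess i j z) * of_bool (k = p)) -
     (\<Sum>p\<in>UNIV. (h z $ p $ l * lee_hess k j z) * of_bool (i = p))"
    by (simp only: right_diff_distrib sum_subtractf mult.assoc)
  also have "\<dots> = h z $ k $ l * lee_hess i j z - h z $ i $ l * lee_hess k j z"
    by (simp only: sum_of_bool)
  finally show ?thesis
    by (simp add: chern_R_def right_diff_distrib sum_subtractf algebra_simps)
qed

text \<open>Conjugation exchanges barred and unbarred indices, so the barred case follows from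
  \<open>chern_R_swap1\<close>.\<close>

lemma chern_R_swap2:
  assumes z: "z \<in> S"
  shows "chern_R h i l k j z = chern_R h i j k l z + lee_hess i j z * h z $ k $ l - lee_hess i l z * h z $ k $ j"
proof -
  have "chern_R h i l k j z = cnj (chern_R h l i j k z)"
    by (simp only: chern_R_cnj[OF z])
  also have "\<dots> = cnj (chern_R h j i l k z + lee_hess j i z * h z $ l $ k - lee_hess l i z * h z $ j $ k)"
    by (subst chern_R_swap1[OF z, of l i j k]) (rule refl)
  also have "\<dots> = chern_R h i j k l z + lee_hess i j z * h z $ k $ l - lee_hess i l z * h z $ k $ j"
    by (simp only: complex_cnj_add complex_cnj_diff complex_cnj_mult chern_R_cnj[OF z]
        lee_hess_hermitian[OF z] hermitian[OF z, symmetric])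
  finally show ?thesis .
qed

end

section \<open>The Lee vector field and its divergence\<close>

context local_lck
begin

lemma herm_zero [simp]: "herm H 0 Y = 0"
  by (simp add: herm_def)

lemma herm_eq_0_iff:
  assumes z: "z \<in> S"
  shows "herm (h z) X X = 0 \<longleftrightarrow> X = 0"
proof (cases "X = 0")
  case False
  then have "Re (herm (h z) X X) \<noteq> 0" using positive[OF z] by force
  with False show ?thesis by (metis zero_complex.simps(1))
qed simp

lemma lee_trace_real:
  assumes z: "z \<in> S"
  shows "lee_trace z = complex_of_real (Re (lee_trace z))"
proof -
  have "cnj (lee_trace z) = (\<Sum>k\<in>UNIV. \<Sum>l\<in>UNIV. lee_hess l k z * inv_h z k l)"
    by (simp add: lee_trace_def lee_hess_hermitian[OF z] inv_h_hermitian[OF z])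
  also have "\<dots> = lee_trace z" unfolding lee_trace_def by (rule sum.swap)
  finally show ?thesis by (simp add: complex_eq_iff)
qed

lemma lee_vec_h:
  assumes z: "z \<in> S"
  shows "(\<Sum>i\<in>UNIV. lee_vec i z * h z $ i $ l) = cnj (lee l z)"
proof -
  have "(\<Sum>i\<in>UNIV. lee_vec i z * h z $ i $ l) =
    (\<Sum>i\<in>UNIV. \<Sum>j\<in>UNIV. cnj (lee j z) * h z $ i $ l * inv_h z j i)"
    unfolding lee_vec_def sum_distrib_right by (simp add: mult_ac)
  then show ?thesis by (simp add: contract_left[OF z])
qed

text \<open>Lowering the index of \<open>lee_vec\<close> returns the conjugate of
  \<open>lee\<close>, so the pairing is a squared norm: it is real, nonnegative, and zero only where
  \<theta> vanishes.\<close>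

lemma lee_lee_vec:
  assumes z: "z \<in> S"
  shows "(\<Sum>i\<in>UNIV. lee i z * lee_vec i z) = herm (h z) (vec_lambda (\<lambda>i. lee_vec i z)) (vec_lambda (\<lambda>i. lee_vec i z))"
proof -
  have "lee i z = (\<Sum>k\<in>UNIV. cnj (lee_vec k z) * h z $ i $ k)" for i
  proof -
    have "cnj (\<Sum>k\<in>UNIV. lee_vec k z * h z $ k $ i) = lee i z"
      by (simp only: lee_vec_h[OF z] complex_cnj_cnj)
    then show ?thesis by (simp add: hermitian[OF z, symmetric])
  qed
  then show ?thesis by (simp add: herm_def sum_distrib_left sum_distrib_right mult_ac)
qed

lemma lee_eq_0_if_lee_vec:
  assumes z: "z \<in> S" and "Re (\<Sum>i\<in>UNIV. lee i z * lee_vec i z) \<le> 0"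
  shows "\<theta> z v = 0"
proof -
  let ?W = "vec_lambda (\<lambda>i. lee_vec i z)"
  have "?W = 0"
    using assms(2) positive[OF z, of ?W] unfolding lee_lee_vec[OF z] by (cases "?W = 0") auto
  then have "lee_vec i z = 0" for i by (simp add: vec_eq_iff)
  then have "lee l z = 0" for l using lee_vec_h[OF z, of l] by simp
  then show ?thesis using \<theta>_lee[OF z, of v] by simp
qed

lemma lee_lee_vec_nonneg:
  assumes z: "z \<in> S"
  shows "Re (\<Sum>i\<in>UNIV. lee i z * lee_vec i z) \<ge> 0"
  unfolding lee_lee_vec[OF z]
  using positive[OF z, of "vec_lambda (\<lambda>i. lee_vec i z)"]
  by (cases "vec_lambda (\<lambda>i. lee_vec i z) = (0 :: complex^'n)") simp_all

lemma smooth_lee_vec: "smooth_on S (lee_vec i)"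
  unfolding lee_vec_def[abs_def]
  by (intro smooth_on_sum smooth_on_mult smooth_on_cnj smooth_inv_h smooth_lee open_S)

text \<open>This trace is the logarithmic derivative of \<open>det h\<close>, the one that
  differentiating a volume density produces. The other trace, over the first lower index and the
  upper one, differs from it by the trace of the torsion.\<close>

definition Gam_trace :: "'n \<Rightarrow> complex^'n \<Rightarrow> complex" where
  "Gam_trace i z = (\<Sum>k\<in>UNIV. Gam i k k z)"

lemma smooth_Gam_trace: "smooth_on S (Gam_trace i)"
  unfolding Gam_trace_def[abs_def] by (intro smooth_on_sum smooth_Gam open_S)

text \<open>Differentiating \<open>W \<cdot> h = cnj lee\<close> avoids differentiating the inverse metric.  The trace of the
  torsion turns the trace of the connection into the one that the volume density produces.\<close>

lemma divergence_lee_vec: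
  assumes z: "z \<in> S" and \<rho>: "\<rho> differentiable (at z)" "\<And>i. dz i \<rho> z = \<rho> z * Gam_trace i z"
  shows "(\<Sum>i\<in>UNIV. dz i (\<lambda>x. \<rho> x * lee_vec i x) z) =
    \<rho> z * (lee_trace z + (of_nat CARD('n) - 1) * (\<Sum>i\<in>UNIV. lee i z * lee_vec i z))"
proof -
  have dW: "lee_vec i differentiable (at z)" for i using smooth_onD(1)[OF smooth_lee_vec z] .
  have dl: "lee i differentiable (at z)" for i using smooth_onD(1)[OF smooth_lee z] .
  have E: "(\<Sum>i\<in>UNIV. lee_vec i z * dz k (\<lambda>x. h x $ i $ l) z + dz k (lee_vec i) z * h z $ i $ l) = lee_hess k l z"
    for k l
  proof -
    have "dz k (\<lambda>x. \<Sum>i\<in>UNIV. lee_vec i x * h x $ i $ l) z = dz k (\<lambda>x. cnj (lee l x)) z"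
      by (rule dz_cong(1)[OF open_S z]) (simp add: lee_vec_h)
    also have "\<dots> = cnj (lee_hess l k z)" by (simp add: dz_cnj dl lee_hess_def)
    also have "\<dots> = lee_hess k l z" by (rule lee_hess_hermitian[OF z])
    finally show ?thesis
      using dW differentiable_h[OF z] by (simp add: dz_sum dz_mult differentiable_mult)
  qed
  have "lee_trace z = (\<Sum>k\<in>UNIV. \<Sum>l\<in>UNIV. \<Sum>i\<in>UNIV. lee_vec i z * (inv_h z l k * dz k (\<lambda>x. h x $ i $ l) z)) +
     (\<Sum>k\<in>UNIV. \<Sum>l\<in>UNIV. \<Sum>i\<in>UNIV. dz k (lee_vec i) z * h z $ i $ l * inv_h z l k)"
    unfolding lee_trace_def E[symmetric] sum.distrib distrib_right sum_distrib_right by (simp add: mult_ac)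
  also have "(\<Sum>k\<in>UNIV. \<Sum>l\<in>UNIV. \<Sum>i\<in>UNIV. dz k (lee_vec i) z * h z $ i $ l * inv_h z l k) =
    (\<Sum>i\<in>UNIV. \<Sum>k\<in>UNIV. \<Sum>l\<in>UNIV. dz k (lee_vec i) z * h z $ i $ l * inv_h z l k)"
    by (rule trans[OF sum.cong[OF refl sum.swap] sum.swap])
  also have "\<dots> = (\<Sum>i\<in>UNIV. dz i (lee_vec i) z)"
    by (simp add: contract_right[OF z])
  also have "(\<Sum>k\<in>UNIV. \<Sum>l\<in>UNIV. \<Sum>i\<in>UNIV. lee_vec i z * (inv_h z l k * dz k (\<lambda>x. h x $ i $ l) z)) =
     (\<Sum>k\<in>UNIV. \<Sum>i\<in>UNIV. lee_vec i z * Gam k i k z)"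
    unfolding chern_Gamma_def inv_h_def sum_distrib_left by (rule sum.cong[OF refl sum.swap])
  also have "\<dots> = (\<Sum>i\<in>UNIV. lee_vec i z * (\<Sum>k\<in>UNIV. Gam k i k z))"
    by (subst sum.swap) (simp add: sum_distrib_left)
  finally have divW: "(\<Sum>i\<in>UNIV. dz i (lee_vec i) z) =
      lee_trace z - (\<Sum>i\<in>UNIV. lee_vec i z * (\<Sum>k\<in>UNIV. Gam k i k z))" by simp
  \<comment> \<open>Origin of the factor \<open>n - 1\<close>: the first torsion term contributes
    \<open>lee i\<close> once for each value of \<open>k\<close>, the second removes it
    once.\<close>
  have T: "Gam_trace i z - (\<Sum>k\<in>UNIV. Gam k i k z) = (of_nat CARD('n) - 1) * lee i z" for i
  proof -
    have "Gam_trace i z - (\<Sum>k\<in>UNIV. Gam k i k z) = (\<Sum>k\<in>UNIV. lee i z - lee k z * of_bool (i = k))"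
      unfolding Gam_trace_def by (simp add: sum_subtractf[symmetric] Gam_torsion[OF z])
    then show ?thesis by (simp add: sum_subtractf algebra_simps)
  qed
  have "(\<Sum>i\<in>UNIV. dz i (\<lambda>x. \<rho> x * lee_vec i x) z) =
    \<rho> z * ((\<Sum>i\<in>UNIV. dz i (lee_vec i) z) + (\<Sum>i\<in>UNIV. lee_vec i z * Gam_trace i z))"
    by (simp add: dz_mult \<rho> dW sum.distrib sum_distrib_left algebra_simps)
  also have "\<dots> = \<rho> z * (lee_trace z + (\<Sum>i\<in>UNIV. lee_vec i z * (Gam_trace i z - (\<Sum>k\<in>UNIV. Gam k i k z))))"
    unfolding divW by (simp add: right_diff_distrib sum_subtractf)
  finally show ?thesis unfolding T by (simp add: sum_distrib_left algebra_simps)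
qed

end

section \<open>Consequences of pointwise constant holomorphic sectional curvature\<close>

locale local_lck_hsc = local_lck S h \<theta> for S and h :: "'n::finite local_metric" and \<theta> +
  fixes c :: "complex^'n \<Rightarrow> real"
  assumes hsc: "\<And>z X. z \<in> S \<Longrightarrow> X \<noteq> 0 \<Longrightarrow> hol_sect_curv h z X = complex_of_real (c z)"
    and card_ge_2: "CARD('n) \<ge> 2"
begin

text \<open>The factor \<open>2 (n + 1)\<close> is the trace over \<open>k\<close> and
  \<open>l\<close> of \<open>2 (h\<^sub>i\<^sub>j h\<^sub>k\<^sub>l + h\<^sub>i\<^sub>l
  h\<^sub>k\<^sub>j)\<close> relative to \<open>h\<^sub>i\<^sub>j\<close>; the 4 counts the
  curvature terms that symmetrization adds up.\<close>

definition mu :: "complex^'n \<Rightarrow> real" where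
  "mu z = (Re (lee_trace z) + 2 * (real CARD('n) + 1) * c z) / 4"

text \<open>Constancy of the sectional curvature says that the biquadratic form with coefficients
  \<open>q\<close> vanishes on the diagonal. Polarization controls only the symmetrization of
  \<open>q\<close>, because the Chern curvature with torsion is not symmetric itself.\<close>

lemma chern_R_symmetrized:
  assumes z: "z \<in> S"
  shows "chern_R h i j k l z + chern_R h k j i l z + chern_R h i l k j z + chern_R h k l i j z =
    2 * complex_of_real (c z) * (h z $ i $ j * h z $ k $ l + h z $ i $ l * h z $ k $ j)"
proof -
  define q where "q i j k l = chern_R h i j k l z - complex_of_real (c z) * (h z $ i $ j * h z $ k $ l)" for i j k l
  have "q i j k l + q k j i l + q i l k j + q k l i j = 0"
  proof (rule polarization_coeffs)
    fix X :: "complex^'n"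
    have hh: "(\<Sum>i\<in>UNIV. \<Sum>j\<in>UNIV. \<Sum>k\<in>UNIV. \<Sum>l\<in>UNIV.
        h z $ i $ j * h z $ k $ l * X $ i * cnj (X $ j) * X $ k * cnj (X $ l)) = (herm (h z) X X)\<^sup>2"
      unfolding herm_def power2_eq_square sum_distrib_left sum_distrib_right
      by (intro sum.cong refl) (simp add: mult_ac)
    have "(\<Sum>i\<in>UNIV. \<Sum>j\<in>UNIV. \<Sum>k\<in>UNIV. \<Sum>l\<in>UNIV.
        chern_R h i j k l z * X $ i * cnj (X $ j) * X $ k * cnj (X $ l)) = complex_of_real (c z) * (herm (h z) X X)\<^sup>2"
    proof (cases "X = 0")
      case True
      then show ?thesis by (simp add: herm_def)
    next
      case False
      then show ?thesis using hsc[OF z False] herm_eq_0_iff[OF z, of X]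
        by (simp add: hol_sect_curv_def field_simps)
    qed
    then show "(\<Sum>i\<in>UNIV. \<Sum>j\<in>UNIV. \<Sum>k\<in>UNIV. \<Sum>l\<in>UNIV.
        q i j k l * X $ i * cnj (X $ j) * X $ k * cnj (X $ l)) = 0"
      unfolding q_def left_diff_distrib sum_subtractf hh[symmetric] sum_distrib_left
      by (simp add: mult.assoc)
  qed
  then show ?thesis by (simp add: q_def algebra_simps)
qed

text \<open>The swap rules bring the three permuted curvature terms back to
  \<open>chern_R h i j k l z\<close>. Each of them yields one copy of
  \<open>lee_hess i j z * h z $ k $ l\<close>, hence the 3.\<close>

lemma curvature_identity:
  assumes z: "z \<in> S"
  shows "4 * chern_R h i j k l z + 3 * lee_hess i j z * h z $ k $ l - lee_hess k j z * h z $ i $ l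
     - lee_hess i l z * h z $ k $ j - lee_hess k l z * h z $ i $ j =
    2 * complex_of_real (c z) * (h z $ i $ j * h z $ k $ l + h z $ i $ l * h z $ k $ j)"
  using chern_R_symmetrized[OF z, of i j k l]
  unfolding chern_R_swap1[OF z, of k j i l] chern_R_swap1[OF z, of k l i j] chern_R_swap2[OF z, of i l k j]
  by (simp add: algebra_simps)

text \<open>Traced with the inverse metric, the curvature identity computes the \<open>dzbar\<close>-derivative of this
  \<open>(1,0)\<close>-form as \<open>4 \<mu> h\<close>; the commutation of two \<open>dzbar\<close>-derivatives then yields \<open>d\<mu> = - \<mu> \<theta>\<close>.\<close>

definition pot :: "'n \<Rightarrow> complex^'n \<Rightarrow> complex" where
  "pot i z = (3 * of_nat CARD('n) - 2) * lee i z - 4 * Gam_trace i z"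

lemma smooth_pot: "smooth_on S (pot i)"
  unfolding pot_def[abs_def]
  by (intro smooth_on_diff smooth_on_mult smooth_on_const smooth_lee smooth_Gam_trace open_S)

lemma dzbar_pot:
  assumes z: "z \<in> S"
  shows "dzbar j (pot i) z = 4 * complex_of_real (mu z) * h z $ i $ j"
proof -
  have dG: "Gam i k p differentiable (at z)" for i k p
    using smooth_onD(1)[OF smooth_Gam z] .
  have dT: "Gam_trace i differentiable (at z)" using smooth_onD(1)[OF smooth_Gam_trace z] .
  have dl: "lee i differentiable (at z)" for i using smooth_onD(1)[OF smooth_lee z] .
  have GT: "dzbar j (Gam_trace i) z = (\<Sum>k\<in>UNIV. dzbar j (Gam i k k) z)"
    unfolding Gam_trace_def[abs_def] by (rule dz_sum(2)) (rule dG)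
  let ?N = "of_nat CARD('n) :: complex"
  have 1: "(\<Sum>k\<in>UNIV. \<Sum>l\<in>UNIV. chern_R h i j k l z * inv_h z l k) = - dzbar j (Gam_trace i) z"
  proof -
    have "(\<Sum>k\<in>UNIV. \<Sum>l\<in>UNIV. chern_R h i j k l z * inv_h z l k) =
      - (\<Sum>k\<in>UNIV. \<Sum>l\<in>UNIV. \<Sum>p\<in>UNIV. dzbar j (Gam i k p) z * h z $ p $ l * inv_h z l k)"
      unfolding chern_R_def mult_minus_left sum_negf sum_distrib_right by (simp add: mult_ac)
    also have "(\<Sum>k\<in>UNIV. \<Sum>l\<in>UNIV. \<Sum>p\<in>UNIV. dzbar j (Gam i k p) z * h z $ p $ l * inv_h z l k) =
       (\<Sum>k\<in>UNIV. \<Sum>p\<in>UNIV. dzbar j (Gam i k p) z * (\<Sum>l\<in>UNIV. h z $ p $ l * inv_h z l k))"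
      unfolding sum_distrib_left mult.assoc by (rule sum.cong[OF refl sum.swap])
    finally show ?thesis by (simp add: h_inv_h[OF z] GT)
  qed
  have 2: "(\<Sum>k\<in>UNIV. \<Sum>l\<in>UNIV. x * h z $ k $ l * inv_h z l k) = ?N * x" for x
  proof -
    have "(\<Sum>k\<in>UNIV. \<Sum>l\<in>UNIV. x * h z $ k $ l * inv_h z l k) =
      (\<Sum>k\<in>UNIV. x * (\<Sum>l\<in>UNIV. h z $ k $ l * inv_h z l k))"
      by (simp add: sum_distrib_left mult.assoc)
    then show ?thesis by (simp add: h_inv_h[OF z])
  qed
  have "(\<Sum>k\<in>UNIV. \<Sum>l\<in>UNIV. (4 * chern_R h i j k l z + 3 * lee_hess i j z * h z $ k $ l - lee_hess k j z * h z $ i $ l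
     - lee_hess i l z * h z $ k $ j - lee_hess k l z * h z $ i $ j) * inv_h z l k) =
    (\<Sum>k\<in>UNIV. \<Sum>l\<in>UNIV. 2 * complex_of_real (c z) * (h z $ i $ j * h z $ k $ l + h z $ i $ l * h z $ k $ j) * inv_h z l k)"
    by (simp only: curvature_identity[OF z])
  moreover have "(\<Sum>k\<in>UNIV. \<Sum>l\<in>UNIV. (4 * chern_R h i j k l z + 3 * lee_hess i j z * h z $ k $ l - lee_hess k j z * h z $ i $ l
     - lee_hess i l z * h z $ k $ j - lee_hess k l z * h z $ i $ j) * inv_h z l k) =
     4 * (\<Sum>k\<in>UNIV. \<Sum>l\<in>UNIV. chern_R h i j k l z * inv_h z l k)
     + (\<Sum>k\<in>UNIV. \<Sum>l\<in>UNIV. (3 * lee_hess i j z) * h z $ k $ l * inv_h z l k)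
     - (\<Sum>k\<in>UNIV. \<Sum>l\<in>UNIV. lee_hess k j z * h z $ i $ l * inv_h z l k)
     - (\<Sum>k\<in>UNIV. \<Sum>l\<in>UNIV. lee_hess i l z * h z $ k $ j * inv_h z l k)
     - h z $ i $ j * lee_trace z"
    unfolding lee_trace_def sum_distrib_left sum.distrib[symmetric] sum_subtractf[symmetric]
    by (intro sum.cong refl) (simp add: algebra_simps)
  moreover have "(\<Sum>k\<in>UNIV. \<Sum>l\<in>UNIV. 2 * complex_of_real (c z) * (h z $ i $ j * h z $ k $ l + h z $ i $ l * h z $ k $ j) * inv_h z l k) =
     (\<Sum>k\<in>UNIV. \<Sum>l\<in>UNIV. (2 * complex_of_real (c z) * h z $ i $ j) * h z $ k $ l * inv_h z l k)
     + (\<Sum>k\<in>UNIV. \<Sum>l\<in>UNIV. (2 * complex_of_real (c z) * h z $ k $ j) * h z $ i $ l * inv_h z l k)"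
    unfolding sum.distrib[symmetric]
    by (intro sum.cong refl) (simp add: algebra_simps)
  \<comment> \<open>The trace of \<open>h\<^sub>k\<^sub>l\<close> is \<open>n\<close>, which turns
    the coefficient 3 into \<open>3 n\<close>; the two mixed terms each contract to
    \<open>lee_hess i j z\<close>. This is the coefficient \<open>3 n - 2\<close> in
    \<open>pot\<close>.\<close>
  ultimately have "- 4 * dzbar j (Gam_trace i) z + ?N * (3 * lee_hess i j z) - lee_hess i j z - lee_hess i j z
      - h z $ i $ j * lee_trace z =
     ?N * (2 * complex_of_real (c z) * h z $ i $ j) + 2 * complex_of_real (c z) * h z $ i $ j"
    unfolding 1 2 contract_right[OF z] contract_left[OF z] by simp
  moreover have "dzbar j (pot i) z = (3 * ?N - 2) * lee_hess i j z - 4 * dzbar j (Gam_trace i) z"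
    unfolding pot_def[abs_def] lee_hess_def using dl dT
    by (simp add: dz_diff dz_cmult differentiable_mult)
  moreover have "4 * complex_of_real (mu z) = lee_trace z + 2 * (?N + 1) * complex_of_real (c z)"
    by (subst lee_trace_real[OF z]) (simp add: mu_def)
  ultimately show ?thesis by (simp add: algebra_simps)
qed

text \<open>By \<open>dzbar_pot\<close> the tensor \<open>\<mu> h\<close> is a barred derivative, so
  its own barred derivative is symmetric in the barred indices. The failure of that symmetry for
  \<open>h\<close> alone is given by the Lee form, which forces \<mu> to compensate for it.\<close>

lemma mu_has_derivative:
  assumes z: "z \<in> S"
  shows "(mu has_derivative (\<lambda>v. - mu z * \<theta> z v)) (at z)"
proof -
  define m where "m z = complex_of_real (mu z)" for z
  have hii: "h z $ i $ i \<noteq> 0" if z: "z \<in> S" for z i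
  proof -
    have "herm (h z) (axis i 1) (axis i 1) = (\<Sum>p\<in>UNIV. \<Sum>q\<in>UNIV. if q = i then if p = i then h z $ p $ q else 0 else 0)"
      unfolding herm_def by (intro sum.cong refl) (simp add: axis_def)
    then have "herm (h z) (axis i 1) (axis i 1) = h z $ i $ i" by simp
    then show ?thesis using herm_eq_0_iff[OF z, of "axis i 1"] by (simp add: axis_eq_0_iff)
  qed
  obtain i0 :: 'n where True by blast
  \<comment> \<open>The definition of \<open>mu\<close> contains \<open>c\<close>, about which no
    smoothness is known. One diagonal component of \<open>dzbar_pot\<close>, solved for \<mu>,
    expresses it by smooth functions.\<close>
  have sm: "smooth_on S m"
  proof -
    have "smooth_on S (\<lambda>z. dzbar i0 (pot i0) z * inverse (4 * h z $ i0 $ i0))"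
      using hii by (intro smooth_on_mult smooth_on_dzbar smooth_pot smooth_on_inverse smooth_on_const smooth_h open_S) auto
    then show ?thesis
      by (subst smooth_on_cong[OF open_S]) (auto simp: dzbar_pot hii m_def)
  qed
  have dm: "m differentiable (at z)" using smooth_onD(1)[OF sm z] .
  define x where "x l = dzbar l m z + m z * cnj (lee l z)" for l
  \<comment> \<open>Two barred derivatives of \<open>pot i\<close> commute. The antisymmetrized
    derivative of the metric is replaced by \<open>torsion_bar\<close>, and its Lee terms combine
    with the derivative of \<open>m\<close> into \<open>x\<close>.\<close>
  have X: "x l * h z $ i $ j = x j * h z $ i $ l" for i j l
  proof -
    have D: "dzbar l (dzbar j (pot i)) z = 4 * (m z * dzbar l (\<lambda>z. h z $ i $ j) z + dzbar l m z * h z $ i $ j)" for l j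
    proof -
      have "dzbar l (dzbar j (pot i)) z = dzbar l (\<lambda>z. 4 * (m z * h z $ i $ j)) z"
        by (rule dz_cong(2)[OF open_S z]) (simp add: dzbar_pot m_def)
      then show ?thesis using dm differentiable_h[OF z] by (simp add: dz_cmult dz_mult differentiable_mult)
    qed
    have "dzbar l (dzbar j (pot i)) z = dzbar j (dzbar l (pot i)) z"
      by (rule dz_commute(2)[OF open_S smooth_pot z])
    then have "m z * dzbar l (\<lambda>z. h z $ i $ j) z + dzbar l m z * h z $ i $ j =
        m z * dzbar j (\<lambda>z. h z $ i $ l) z + dzbar j m z * h z $ i $ l"
      unfolding D mult_cancel_left by simp
    then have "m z * (dzbar l (\<lambda>z. h z $ i $ j) z - dzbar j (\<lambda>z. h z $ i $ l) z) + dzbar l m z * h z $ i $ j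
       - dzbar j m z * h z $ i $ l = 0"
      by (simp add: algebra_simps)
    then show ?thesis unfolding torsion_bar[OF z] x_def by (simp add: algebra_simps)
  qed
  \<comment> \<open>Contracting \<open>X\<close> with the inverse metric over \<open>i\<close> and
    \<open>j\<close> gives \<open>n * x l = x l\<close>; here the dimension must be at least
    2.\<close>
  have x0: "x l = 0" for l
  proof -
    have "(\<Sum>i\<in>UNIV. \<Sum>j\<in>UNIV. x l * h z $ i $ j * inv_h z j i) = (\<Sum>i\<in>UNIV. \<Sum>j\<in>UNIV. x j * h z $ i $ l * inv_h z j i)"
      by (simp only: X)
    also have "\<dots> = x l" by (rule contract_left[OF z])
    also have "(\<Sum>i\<in>UNIV. \<Sum>j\<in>UNIV. x l * h z $ i $ j * inv_h z j i) = (\<Sum>i\<in>UNIV. x l * (\<Sum>j\<in>UNIV. h z $ i $ j * inv_h z j i))"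
      by (simp add: sum_distrib_left mult.assoc)
    also have "\<dots> = of_nat CARD('n) * x l" by (simp add: h_inv_h[OF z])
    finally have "of_nat CARD('n) * x l = 1 * x l" by simp
    then have "x l = 0 \<or> of_nat CARD('n) = (1::complex)" by (simp only: mult_cancel_right)
    moreover have "of_nat CARD('n) \<noteq> (1::complex)"
      using card_ge_2 of_nat_eq_iff[of "CARD('n)" 1, where 'a = complex] by simp
    ultimately show ?thesis by blast
  qed
  have bar: "dzbar l m z = - m z * cnj (lee l z)" for l using x0[of l] by (simp add: x_def add_eq_0_iff)
  have "dz l m z = cnj (dzbar l m z)" for l
  proof -
    have "(\<lambda>x. cnj (m x)) = m" by (simp add: m_def fun_eq_iff)
    then show ?thesis using dz_cnj(1)[OF dm, of l] by simp
  qed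
  then have hol: "dz l m z = - m z * lee l z" for l by (simp add: bar) (simp add: m_def)
  have der: "frechet_derivative m (at z) v = complex_of_real (- mu z * \<theta> z v)" for v
    unfolding frechet_derivative_dz[OF dm] hol bar of_real_mult \<theta>_lee[OF z]
    by (simp add: sum_distrib_left m_def algebra_simps)
  have "((\<lambda>z. Re (m z)) has_derivative (\<lambda>v. Re (frechet_derivative m (at z) v))) (at z)"
    by (intro bounded_linear.has_derivative[OF bounded_linear_Re] dm[unfolded frechet_derivative_works])
  then have "((\<lambda>z. Re (m z)) has_derivative (\<lambda>v. - mu z * \<theta> z v)) (at z)"
    unfolding der by simp
  then show ?thesis by (simp add: m_def)
qed

end

section \<open>Integration on complex coordinate space\<close>

lemma integrable_compact_support:
  fixes f :: "'a::euclidean_space \<Rightarrow> real"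
  assumes "continuous_on UNIV f" "compact K" "\<And>x. x \<notin> K \<Longrightarrow> f x = 0"
  shows "integrable lborel f"
proof -
  have "integrable lborel (\<lambda>x. indicator K x *\<^sub>R f x)"
    by (intro borel_integrable_compact assms(2) continuous_on_subset[OF assms(1)]) simp
  moreover have "(\<lambda>x. indicator K x *\<^sub>R f x) = f"
    using assms(3) by (auto simp: fun_eq_iff indicator_def)
  ultimately show ?thesis by simp
qed

lemma frechet_derivative_eq_0_off_support:
  fixes F :: "'a::real_normed_vector \<Rightarrow> 'b::real_normed_vector"
  assumes "closed K" "\<And>x. x \<notin> K \<Longrightarrow> F x = 0" "x \<notin> K"
  shows "frechet_derivative F (at x) v = 0"
proof -
  have "frechet_derivative F (at x) = frechet_derivative (\<lambda>x. 0) (at x)"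
    by (rule frechet_derivative_cong_open[of "- K"]) (use assms in auto)
  then show ?thesis by simp
qed

lemma integral_translate_compact_support:
  fixes F :: "'a::euclidean_space \<Rightarrow> real"
  assumes "continuous_on UNIV F"
  shows "integral\<^sup>L lborel (\<lambda>x. F (c + x)) = integral\<^sup>L lborel F"
proof -
  have "integral\<^sup>L lborel F = integral\<^sup>L (distr lborel borel ((+) c)) F"
    by (simp add: lborel_distr_plus)
  also have "\<dots> = integral\<^sup>L lborel (\<lambda>x. F (c + x))"
    by (rule integral_distr) (auto intro: borel_measurable_continuous_onI assms)
  finally show ?thesis by simp
qed

text \<open>By translation invariance every difference quotient of \<open>F\<close> in the direction
  \<open>w\<close> has integral zero. The quotients converge pointwise to the derivative and are
  dominated by a constant on one compact set.\<close>

lemma integral_derivative_eq_0: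
  fixes F :: "'a::euclidean_space \<Rightarrow> real"
  assumes dF: "\<And>x. F differentiable (at x)"
    and cont: "continuous_on UNIV (\<lambda>x. frechet_derivative F (at x) w)"
    and K: "compact K" "\<And>x. x \<notin> K \<Longrightarrow> F x = 0"
  shows "integral\<^sup>L lborel (\<lambda>x. frechet_derivative F (at x) w) = 0"
proof -
  define G where "G x = frechet_derivative F (at x) w" for x
  have contF: "continuous_on UNIV F"
    using dF by (simp add: continuous_at_imp_continuous_on differentiable_imp_continuous_within)
  have G0: "G x = 0" if "x \<notin> K" for x
    unfolding G_def using frechet_derivative_eq_0_off_support[OF compact_imp_closed[OF K(1)] K(2) that] .
  have "compact (G ` K)"
    using compact_continuous_image K(1) cont continuous_on_subset unfolding G_def by blast
  then obtain B where B: "B > 0" "\<And>x. x \<in> K \<Longrightarrow> \<bar>G x\<bar> \<le> B"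
    using compact_imp_bounded bounded_pos by (metis imageI real_norm_def)
  have B': "\<bar>G x\<bar> \<le> B" for x using B G0 by (cases "x \<in> K") auto
  have der: "((\<lambda>t. F (x + t *\<^sub>R w)) has_derivative (\<lambda>h. h * G (x + t *\<^sub>R w))) (at t)" for x t
  proof -
    have d: "(F has_derivative frechet_derivative F (at (x + t *\<^sub>R w))) (at (x + t *\<^sub>R w))"
      using dF frechet_derivative_works by blast
    have "((\<lambda>t. F (x + t *\<^sub>R w)) has_derivative
        (\<lambda>h. frechet_derivative F (at (x + t *\<^sub>R w)) (h *\<^sub>R w))) (at t)"
      by (rule has_derivative_compose[where f = "\<lambda>t. x + t *\<^sub>R w", OF _ d]) (auto intro!: derivative_eq_intros)
    then show ?thesis by (simp add: linear_scale[OF has_derivative_linear[OF d]] G_def)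
  qed
  define \<epsilon> where "\<epsilon> k = 1 / (real k + 1)" for k
  have \<epsilon>: "0 < \<epsilon> k" "\<epsilon> k \<le> 1" for k by (auto simp: \<epsilon>_def)
  have \<epsilon>lim: "\<epsilon> \<longlonglongrightarrow> 0"
    unfolding \<epsilon>_def using LIMSEQ_inverse_real_of_nat by (simp add: inverse_eq_divide add.commute)
  define q where "q k x = (F (\<epsilon> k *\<^sub>R w + x) - F x) / \<epsilon> k" for k x
  \<comment> \<open>The steps \<open>\<epsilon> k\<close> are at most 1, so all quotients vanish
    outside \<open>K\<close> swept back along \<open>w\<close> for parameters between 0 and 1; the
    parameter 0 keeps \<open>K\<close> itself inside.\<close>
  define K' where "K' = (\<lambda>(x, t). x - t *\<^sub>R w) ` (K \<times> {0..1})"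
  have "compact K'" unfolding K'_def case_prod_unfold
    by (intro compact_continuous_image compact_Times K compact_Icc continuous_intros)
  have q_supp: "q k x = 0" if "x \<notin> K'" for k x
  proof -
    have "x \<notin> K" using that unfolding K'_def by (auto intro!: image_eqI[of _ _ "(x, 0)"])
    moreover have "\<epsilon> k *\<^sub>R w + x \<notin> K"
      using that \<epsilon>[of k] unfolding K'_def by (auto intro!: image_eqI[of _ _ "(\<epsilon> k *\<^sub>R w + x, \<epsilon> k)"])
    ultimately show ?thesis by (simp add: q_def K)
  qed
  have q_cont: "continuous_on UNIV (q k)" for k
    unfolding q_def using \<epsilon>[of k]
    by (intro continuous_intros continuous_on_compose2[OF contF]) auto
  have q_bound: "\<bar>q k x\<bar> \<le> B" for k x
  proof -
    obtain s where "F (x + \<epsilon> k *\<^sub>R w) - F (x + 0 *\<^sub>R w) = (\<epsilon> k - 0) * G (x + s *\<^sub>R w)"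
      using mvt_simple[OF \<epsilon>(1)[of k], of "\<lambda>t. F (x + t *\<^sub>R w)" "\<lambda>t h. h * G (x + t *\<^sub>R w)"] 
        has_derivative_at_withinI[OF der] by blast
    then have "q k x = G (x + s *\<^sub>R w)" using \<epsilon>[of k] by (simp add: q_def add.commute)
    then show ?thesis using B' by simp
  qed
  have lim: "(\<lambda>k. q k x) \<longlonglongrightarrow> G x" for x
  proof -
    have "((\<lambda>t. F (x + t *\<^sub>R w)) has_field_derivative G x) (at 0)"
      using der[of x 0] by (simp add: has_field_derivative_def mult_commute_abs)
    then have "((\<lambda>t. (F (x + t *\<^sub>R w) - F x) / t) \<longlongrightarrow> G x) (at 0)"
      by (simp add: has_field_derivative_iff)
    then have "(\<lambda>k. (F (x + \<epsilon> k *\<^sub>R w) - F x) / \<epsilon> k) \<longlonglongrightarrow> G x"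
      using \<epsilon>lim \<epsilon>(1) by (auto simp: tendsto_at_iff_sequentially o_def less_imp_neq[symmetric] )
    then show ?thesis by (simp add: q_def add.commute)
  qed
  have "(\<lambda>k. integral\<^sup>L lborel (q k)) \<longlonglongrightarrow> integral\<^sup>L lborel G"
  proof (rule integral_dominated_convergence)
    show "integrable lborel (\<lambda>x. B * indicator K' x)"
      using borel_integrable_compact[OF \<open>compact K'\<close>, of "\<lambda>x. B"] by (simp add: mult.commute)
    show "G \<in> borel_measurable lborel"
      using borel_measurable_continuous_onI[OF cont] by (simp add: G_def[abs_def])
    show "q k \<in> borel_measurable lborel" for k
      using borel_measurable_continuous_onI[OF q_cont] by simp
    show "AE x in lborel. (\<lambda>k. q k x) \<longlonglongrightarrow> G x" using lim by simp
    show "AE x in lborel. norm (q k x) \<le> B * indicator K' x" for k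
      using q_bound q_supp by (intro always_eventually) (auto simp: indicator_def)
  qed
  moreover have "integral\<^sup>L lborel (q k) = 0" for k
  proof -
    have i1: "integrable lborel F" by (rule integrable_compact_support[OF contF K])
    have "continuous_on UNIV (\<lambda>x. F (\<epsilon> k *\<^sub>R w + x))"
      by (intro continuous_on_compose2[OF contF] continuous_intros) auto
    then have i2: "integrable lborel (\<lambda>x. F (\<epsilon> k *\<^sub>R w + x))"
    proof (rule integrable_compact_support)
      show "compact ((\<lambda>x. x - \<epsilon> k *\<^sub>R w) ` K)"
        by (intro compact_continuous_image continuous_intros K)
      show "F (\<epsilon> k *\<^sub>R w + x) = 0" if "x \<notin> (\<lambda>x. x - \<epsilon> k *\<^sub>R w) ` K" for x
        using that by (intro K(2)) (auto intro!: image_eqI[of _ _ "\<epsilon> k *\<^sub>R w + x"])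
    qed
    show ?thesis unfolding q_def
      using i1 i2 integral_translate_compact_support[OF contF, of "\<epsilon> k *\<^sub>R w"] by simp
  qed
  ultimately have "(\<lambda>k. 0 :: real) \<longlonglongrightarrow> integral\<^sup>L lborel G" by simp
  then have "integral\<^sup>L lborel G = 0" by (rule LIMSEQ_unique[OF _ tendsto_const])
  then show ?thesis by (simp add: G_def[abs_def])
qed

lemma integral_eq_0_imp_eq_0:
  fixes f :: "'a::euclidean_space \<Rightarrow> real"
  assumes "continuous_on UNIV f" "compact K" "\<And>x. x \<notin> K \<Longrightarrow> f x = 0"
    and "\<And>x. f x \<ge> 0" "integral\<^sup>L lborel f = 0"
  shows "f x = 0"
proof (rule ccontr)
  assume "f x \<noteq> 0"
  have "AE x in lborel. f x = 0"
    using integral_nonneg_eq_0_iff_AE[OF integrable_compact_support[OF assms(1-3)]] assms(4,5) by simp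
  moreover have "open {x. f x \<noteq> 0}" by (intro open_Collect_neq assms(1) continuous_on_const)
  ultimately have "{x. f x \<noteq> 0} \<in> null_sets lborel"
    using AE_iff_null[of lborel "\<lambda>x. f x = 0"] by simp
  then have "negligible {x. f x \<noteq> 0}"
    by (simp add: negligible_iff_null_sets null_sets_completionI)
  moreover have "open {x. f x \<noteq> 0}" by (intro open_Collect_neq assms(1) continuous_on_const)
  ultimately show False using open_not_negligible \<open>f x \<noteq> 0\<close> by blast
qed

text \<open>Complex coordinate space is identified with \<open>real ^ 'n bit0\<close> because the change of variables
  theorem of the library needs a well-ordered index type.\<close>

definition cidx :: "'n::finite bit0 \<Rightarrow> 'n \<times> bool" where
  "cidx = (SOME f. bij f)"

lemma bij_cidx: "bij (cidx :: 'n::finite bit0 \<Rightarrow> 'n \<times> bool)"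
proof -
  have "\<exists>f :: 'n bit0 \<Rightarrow> 'n \<times> bool. bij f"
    using finite_same_card_bij[of "UNIV :: 'n bit0 set" "UNIV :: ('n \<times> bool) set"] by (simp add: card_prod)
  then show ?thesis unfolding cidx_def by (rule someI_ex)
qed

definition cbasis :: "'n::finite bit0 \<Rightarrow> complex^'n" where
  "cbasis a = (if snd (cidx a) then axis (fst (cidx a)) 1 else axis (fst (cidx a)) \<i>)"

definition to_rvec :: "complex^'n::finite \<Rightarrow> real^'n bit0" where
  "to_rvec z = (\<chi> a. if snd (cidx a) then Re (z $ fst (cidx a)) else Im (z $ fst (cidx a)))"

definition of_rvec :: "real^'n bit0 \<Rightarrow> complex^'n::finite" where
  "of_rvec x = (\<Sum>a\<in>UNIV. x $ a *\<^sub>R cbasis a)"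

lemma linear_to_rvec: "linear to_rvec"
  by (rule linearI) (simp_all add: to_rvec_def vec_eq_iff)

lemma linear_of_rvec: "linear of_rvec"
  by (rule linearI) (simp_all add: of_rvec_def scaleR_left_distrib sum.distrib scaleR_sum_right)

lemma sum_cidx:
  fixes g :: "'n::finite \<times> bool \<Rightarrow> 'b::comm_monoid_add"
  shows "(\<Sum>a\<in>UNIV. g (cidx a)) = (\<Sum>i\<in>UNIV. g (i, True) + g (i, False))"
proof -
  have "(\<Sum>a\<in>UNIV. g (cidx a)) = sum g UNIV"
    by (rule sum.reindex_bij_betw) (simp add: bij_cidx)
  also have "\<dots> = (\<Sum>i\<in>UNIV. \<Sum>b\<in>UNIV. g (i, b))"
    by (simp add: sum.cartesian_product UNIV_Times_UNIV[symmetric] del: UNIV_Times_UNIV)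
  finally show ?thesis by (simp add: UNIV_bool add.commute)
qed

lemma of_to_rvec [simp]: "of_rvec (to_rvec z) = z"
proof -
  have "of_rvec (to_rvec z) = (\<Sum>a\<in>UNIV. (\<lambda>(i, b). if b then Re (z $ i) *\<^sub>R axis i 1 else Im (z $ i) *\<^sub>R axis i \<i>) (cidx a))"
    unfolding of_rvec_def to_rvec_def cbasis_def by (intro sum.cong refl) (simp add: case_prod_unfold)
  also have "\<dots> = z" unfolding sum_cidx by (simp add: axis_complex_decomp[symmetric])
  finally show ?thesis .
qed

lemma to_rvec_cbasis: "to_rvec (cbasis a) = axis a 1"
proof -
  have "cidx a = cidx b \<longleftrightarrow> a = b" for b using bij_cidx bij_is_inj inj_eq by metis
  then have *: "fst (cidx a) = fst (cidx b) \<and> snd (cidx a) = snd (cidx b) \<longleftrightarrow> a = b" for b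
    using prod_eq_iff[of "cidx a" "cidx b"] by simp
  have "to_rvec (cbasis a) $ b = axis a 1 $ b" for b
    using *[of b] by (auto simp: to_rvec_def cbasis_def axis_def)
  then show ?thesis by (simp add: vec_eq_iff)
qed

lemma to_of_rvec [simp]: "to_rvec (of_rvec x) = x"
  unfolding of_rvec_def
  by (simp add: linear_sum[OF linear_to_rvec] linear_scale[OF linear_to_rvec] to_rvec_cbasis
      vec_eq_iff axis_def if_distrib cong: if_cong)

lemma of_rvec_axis: "of_rvec (axis a 1) = cbasis a"
  by (simp flip: to_rvec_cbasis)

lemma bounded_linear_rvec: "bounded_linear to_rvec" "bounded_linear of_rvec"
  using linear_to_rvec linear_of_rvec by (simp_all add: linear_conv_bounded_linear)

lemma continuous_on_rvec: "continuous_on S to_rvec" "continuous_on S' of_rvec"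
  by (rule linear_continuous_on, rule bounded_linear_rvec)+

lemma open_image_to_rvec: "open S \<Longrightarrow> open (to_rvec ` S)"
proof -
  assume "open S"
  have "to_rvec ` S = of_rvec -` S" by (auto intro!: image_eqI[of _ to_rvec "of_rvec _"])
  then show ?thesis using open_vimage[OF \<open>open S\<close> continuous_on_rvec(2)] by simp
qed

section \<open>Integrals of compactly supported functions of complex coordinates\<close>

definition cint :: "(complex^'n::finite \<Rightarrow> real) \<Rightarrow> real" where
  "cint f = integral UNIV (\<lambda>x. f (of_rvec x))"

definition test_fun :: "(complex^'n::finite \<Rightarrow> real) \<Rightarrow> bool" where
  "test_fun f \<longleftrightarrow> continuous_on UNIV f \<and> (\<exists>K. compact K \<and> (\<forall>x. x \<notin> K \<longrightarrow> f x = 0))"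

lemma test_fun_rvec:
  assumes "test_fun f"
  obtains K where "continuous_on UNIV (\<lambda>x. f (of_rvec x))" "compact K"
    "\<And>x. x \<notin> K \<Longrightarrow> f (of_rvec x) = 0"
proof -
  obtain K where K: "continuous_on UNIV f" "compact K" "\<And>x. x \<notin> K \<Longrightarrow> f x = 0"
    using assms unfolding test_fun_def by blast
  show thesis
  proof (rule that)
    show "continuous_on UNIV (\<lambda>x. f (of_rvec x))"
      by (rule continuous_on_compose2[OF K(1) continuous_on_rvec(2)]) auto
    show "compact (to_rvec ` K)" by (rule compact_continuous_image[OF continuous_on_rvec(1) K(2)])
    show "f (of_rvec x) = 0" if "x \<notin> to_rvec ` K" for x
      using that by (intro K(3)) (auto intro!: image_eqI[of _ to_rvec "of_rvec x"])
  qed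
qed

lemma test_fun_integrable:
  assumes "test_fun f"
  shows "integrable lborel (\<lambda>x. f (of_rvec x))"
  using test_fun_rvec[OF assms] integrable_compact_support by metis

lemma cint_lborel: "test_fun f \<Longrightarrow> cint f = integral\<^sup>L lborel (\<lambda>x. f (of_rvec x))"
  unfolding cint_def by (rule integral_lborel[OF test_fun_integrable])

lemma test_fun_zero: "test_fun (\<lambda>z. 0)"
  unfolding test_fun_def by (auto intro: exI[of _ "{}"])

lemma test_fun_add: "test_fun f \<Longrightarrow> test_fun g \<Longrightarrow> test_fun (\<lambda>z. f z + g z)"
  unfolding test_fun_def
proof (elim conjE exE, intro conjI)
  fix K L assume "compact K" "compact L" "\<forall>x. x \<notin> K \<longrightarrow> f x = 0" "\<forall>x. x \<notin> L \<longrightarrow> g x = 0"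
  then show "\<exists>K. compact K \<and> (\<forall>x. x \<notin> K \<longrightarrow> f x + g x = 0)"
    by (intro exI[of _ "K \<union> L"]) auto
qed (intro continuous_intros)

lemma test_fun_mult: "continuous_on UNIV f \<Longrightarrow> test_fun g \<Longrightarrow> test_fun (\<lambda>z. f z * g z)"
  unfolding test_fun_def by (auto intro: continuous_on_mult)

lemma cint_add:
  assumes "test_fun f" "test_fun g"
  shows "cint (\<lambda>z. f z + g z) = cint f + cint g"
  using test_fun_integrable[OF assms(1)] test_fun_integrable[OF assms(2)]
  by (simp add: cint_lborel assms test_fun_add)

lemma cint_cmult: "cint (\<lambda>z. c * f z) = c * cint f"
  by (simp add: cint_def)

lemma cint_zero [simp]: "cint (\<lambda>z. 0) = 0"
  by (simp add: cint_def)

lemma test_fun_sum: "(\<And>i. i \<in> I \<Longrightarrow> test_fun (f i)) \<Longrightarrow> test_fun (\<lambda>z. \<Sum>i\<in>I. f i z)"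
  by (induction I rule: infinite_finite_induct) (auto intro: test_fun_zero test_fun_add)

lemma cint_sum: "(\<And>i. i \<in> I \<Longrightarrow> test_fun (f i)) \<Longrightarrow> cint (\<lambda>z. \<Sum>i\<in>I. f i z) = (\<Sum>i\<in>I. cint (f i))"
  by (induction I rule: infinite_finite_induct) (simp_all add: cint_add test_fun_sum)

lemma cint_nonneg:
  assumes "test_fun f" "\<And>z. f z \<ge> 0"
  shows "cint f \<ge> 0"
  using assms by (simp add: cint_lborel)

lemma cint_eq_0_imp:
  assumes "test_fun f" "\<And>z. f z \<ge> 0" "cint f = 0"
  shows "f z = 0"
proof -
  obtain K where "continuous_on UNIV (\<lambda>x. f (of_rvec x))" "compact K"
    "\<And>x. x \<notin> K \<Longrightarrow> f (of_rvec x) = 0"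
    by (rule test_fun_rvec[OF assms(1)]) (rule that)
  then have "f (of_rvec (to_rvec z)) = 0"
    by (rule integral_eq_0_imp_eq_0) (use assms cint_lborel[OF assms(1)] in auto)
  then show ?thesis by simp
qed

lemma cint_derivative_eq_0:
  assumes "test_fun F" and F: "Ck_on 1 UNIV F"
  shows "cint (\<lambda>z. frechet_derivative F (at z) w) = 0" "test_fun (\<lambda>z. frechet_derivative F (at z) w)"
proof -
  have dF: "F differentiable (at z)" for z using F by simp
  have cont: "continuous_on UNIV (\<lambda>z. frechet_derivative F (at z) w)" using F by simp
  obtain K where "compact K" "\<And>z. z \<notin> K \<Longrightarrow> F z = 0"
    using assms(1) unfolding test_fun_def by blast
  then have "\<And>z. z \<notin> K \<Longrightarrow> frechet_derivative F (at z) w = 0"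
    using frechet_derivative_eq_0_off_support compact_imp_closed by metis
  then show T: "test_fun (\<lambda>z. frechet_derivative F (at z) w)"
    unfolding test_fun_def using cont \<open>compact K\<close> by auto
  have D: "((\<lambda>x. F (of_rvec x)) has_derivative (\<lambda>v. frechet_derivative F (at (of_rvec x)) (of_rvec v))) (at x)" for x
    by (rule has_derivative_compose[OF bounded_linear_imp_has_derivative[OF bounded_linear_rvec(2)]])
       (use dF frechet_derivative_works in blast)
  have E: "frechet_derivative (\<lambda>x. F (of_rvec x)) (at x) (to_rvec w) = frechet_derivative F (at (of_rvec x)) w" for x
    by (simp add: frechet_derivative_at[OF D, symmetric])
  obtain K' where "continuous_on UNIV (\<lambda>x. F (of_rvec x))" "compact K'"
    "\<And>x. x \<notin> K' \<Longrightarrow> F (of_rvec x) = 0"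
    by (rule test_fun_rvec[OF assms(1)]) (rule that)
  then have "integral\<^sup>L lborel (\<lambda>x. frechet_derivative (\<lambda>x. F (of_rvec x)) (at x) (to_rvec w)) = 0"
  proof (intro integral_derivative_eq_0)
    show "(\<lambda>x. F (of_rvec x)) differentiable at x" for x using D differentiable_def by blast
    show "continuous_on UNIV (\<lambda>x. frechet_derivative (\<lambda>x. F (of_rvec x)) (at x) (to_rvec w))"
      unfolding E by (rule continuous_on_compose2[OF cont continuous_on_rvec(2)]) auto
  qed
  then show "cint (\<lambda>z. frechet_derivative F (at z) w) = 0"
    unfolding E cint_lborel[OF T] .
qed

definition rmat :: "(complex^'n::finite \<Rightarrow> complex^'n) \<Rightarrow> real^'n bit0^'n bit0" where
  "rmat F = matrix (\<lambda>x. to_rvec (F (of_rvec x)))"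

lemma cint_change_of_variables:
  fixes T :: "complex^'n::finite \<Rightarrow> complex^'n"
  assumes S: "open S" "open (T ` S)" "inj_on T S"
    and T: "\<And>z. z \<in> S \<Longrightarrow> (T has_derivative T' z) (at z)"
    and f: "test_fun f" "\<And>z. z \<notin> T ` S \<Longrightarrow> f z = 0"
  shows "cint (\<lambda>z. if z \<in> S then \<bar>det (rmat (T' z))\<bar> * f (T z) else 0) = cint f"
proof -
  define g where "g x = to_rvec (T (of_rvec x))" for x
  define g' where "g' x v = to_rvec (T' (of_rvec x) (of_rvec v))" for x v
  \<comment> \<open>The scalar function is regarded as a vector with one component, the form in
    which the change of variables theorem is applied.\<close>
  define f1 where "f1 x = (vec (f (of_rvec x)) :: real^1)" for x
  let ?S = "to_rvec ` S"
  have Smem: "x \<in> ?S \<longleftrightarrow> of_rvec x \<in> S" for x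
    by (auto intro!: image_eqI[of _ to_rvec "of_rvec x"])
  have gS: "g ` ?S = to_rvec ` T ` S" by (auto simp: g_def image_image)
  have lin1: "bounded_linear (vec :: real \<Rightarrow> real^1)"
    by (simp add: linear_conv_bounded_linear[symmetric] linear_iff vec_eq_iff)
  have int1: "integrable lborel f1" unfolding f1_def
    by (rule integrable_bounded_linear[OF lin1 test_fun_integrable[OF f(1)]])
  have abs1: "f1 absolutely_integrable_on UNIV"
    using int1 by (simp add: set_integrable_def absolutely_integrable_on_def integrable_completion)
  have f1_off: "f1 x = 0" if "x \<notin> g ` ?S" for x
  proof -
    have "of_rvec x \<notin> T ` S" using that imageI[of "of_rvec x" "T ` S" to_rvec] unfolding gS by auto
    then show ?thesis using f(2) by (simp add: f1_def vec_eq_iff)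
  qed
  have ind: "(\<lambda>x. if x \<in> g ` ?S then f1 x else 0) = f1" using f1_off by auto
  have "f1 absolutely_integrable_on (g ` ?S)"
    using abs1 ind absolutely_integrable_restrict_UNIV[of "g ` ?S" f1] by simp
  moreover have "integral (g ` ?S) f1 = integral UNIV f1"
    using ind integral_restrict_UNIV[of "g ` ?S" f1] by simp
  ultimately have "(\<lambda>x. \<bar>det (matrix (g' x))\<bar> *\<^sub>R f1 (g x)) absolutely_integrable_on ?S \<and>
      integral ?S (\<lambda>x. \<bar>det (matrix (g' x))\<bar> *\<^sub>R f1 (g x)) = integral UNIV f1"
  proof (subst has_absolute_integral_change_of_variables)
    show "?S \<in> sets lebesgue" using open_image_to_rvec[OF S(1)] by auto
    show "(g has_derivative g' x) (at x within ?S)" if "x \<in> ?S" for x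
      unfolding g_def g'_def
      by (rule has_derivative_at_withinI)
         (intro bounded_linear.has_derivative[OF bounded_linear_rvec(1)]
            has_derivative_compose[OF bounded_linear_imp_has_derivative[OF bounded_linear_rvec(2)] T],
          use that Smem in auto)
    show "inj_on g ?S"
    proof (rule inj_onI)
      fix x y assume xy: "x \<in> ?S" "y \<in> ?S" "g x = g y"
      then have "of_rvec (g x) = of_rvec (g y)" by simp
      then have "T (of_rvec x) = T (of_rvec y)" by (simp add: g_def)
      then have "of_rvec x = of_rvec y" using inj_onD[OF S(3)] xy Smem by blast
      then have "to_rvec (of_rvec x) = to_rvec (of_rvec y)" by simp
      then show "x = y" by simp
    qed
  qed auto
  then have I: "integral ?S (\<lambda>x. \<bar>det (matrix (g' x))\<bar> *\<^sub>R f1 (g x)) = integral UNIV f1"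
    and abs2: "(\<lambda>x. \<bar>det (matrix (g' x))\<bar> *\<^sub>R f1 (g x)) absolutely_integrable_on ?S" by auto
  have eq: "\<bar>det (matrix (g' x))\<bar> *\<^sub>R f1 (g x) $ 1 = \<bar>det (rmat (T' (of_rvec x)))\<bar> * f (T (of_rvec x))" for x
    by (simp add: rmat_def g'_def[abs_def] f1_def g_def)
  have "cint (\<lambda>z. if z \<in> S then \<bar>det (rmat (T' z))\<bar> * f (T z) else 0) =
      integral ?S (\<lambda>x. \<bar>det (rmat (T' (of_rvec x)))\<bar> * f (T (of_rvec x)))"
    unfolding cint_def Smem[symmetric] by (rule integral_restrict_UNIV)
  also have "\<dots> = integral ?S (\<lambda>x. (\<bar>det (matrix (g' x))\<bar> *\<^sub>R f1 (g x)) $ 1)"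
    by (simp add: eq[symmetric])
  also have "\<dots> = integral ?S (\<lambda>x. \<bar>det (matrix (g' x))\<bar> *\<^sub>R f1 (g x)) $ 1"
    using integral_linear[OF set_lebesgue_integral_eq_integral(1)[OF abs2] bounded_linear_vec_nth[of 1]]
    by (simp only: o_def)
  also have "\<dots> = integral UNIV f1 $ 1" unfolding I ..
  also have "\<dots> = integral UNIV (\<lambda>x. f1 x $ 1)"
    using integral_linear[OF set_lebesgue_integral_eq_integral(1)[OF abs1] bounded_linear_vec_nth[of 1]]
    by (simp only: o_def)
  also have "\<dots> = cint f" by (simp add: cint_def f1_def)
  finally show ?thesis .
qed

section \<open>The volume density\<close>

text \<open>Jacobi's formula, with the derivative of the matrix given as \<open>N v ** M z\<close>;
  no inverse of \<open>M z\<close> is involved.\<close>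

lemma has_derivative_det:
  fixes M :: "'v::real_normed_vector \<Rightarrow> real^'k^'k"
  assumes "\<And>i j. ((\<lambda>x. M x $ i $ j) has_derivative (\<lambda>v. (N v ** M z) $ i $ j)) (at z)"
  shows "((\<lambda>x. det (M x)) has_derivative (\<lambda>v. trace (N v) * det (M z))) (at z)"
proof -
  let ?P = "{p. p permutes (UNIV :: 'k set)}"
  have "((\<lambda>x. det (M x)) has_derivative (\<lambda>v. \<Sum>p\<in>?P. of_int (sign p) *
     (\<Sum>i\<in>UNIV. (N v ** M z) $ i $ p i * (\<Prod>j\<in>UNIV - {i}. M z $ j $ p j)))) (at z)"
    unfolding det_def by (intro has_derivative_sum has_derivative_mult_right has_derivative_prod assms)
  moreover have "(\<Sum>p\<in>?P. of_int (sign p) *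
     (\<Sum>i\<in>UNIV. (N v ** M z) $ i $ p i * (\<Prod>j\<in>UNIV - {i}. M z $ j $ p j))) = trace (N v) * det (M z)" for v
  proof -
    have "(\<Sum>p\<in>?P. of_int (sign p) *
     (\<Sum>i\<in>UNIV. (N v ** M z) $ i $ p i * (\<Prod>j\<in>UNIV - {i}. M z $ j $ p j))) =
     (\<Sum>i\<in>UNIV. \<Sum>p\<in>?P. of_int (sign p) * ((N v ** M z) $ i $ p i * (\<Prod>j\<in>UNIV - {i}. M z $ j $ p j)))"
      unfolding sum_distrib_left by (rule sum.swap)
    \<comment> \<open>Differentiating row \<open>i\<close> alone replaces it by row \<open>i\<close>
      of \<open>N v ** M z\<close>, a combination of the rows of \<open>M z\<close>; only the
      multiple of row \<open>i\<close> itself survives in the determinant.\<close>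
    also have "\<dots> = (\<Sum>i\<in>UNIV. det (\<chi> k. if k = i then \<Sum>m\<in>UNIV. N v $ i $ m *s row m (M z) else row k (M z)))"
    proof (intro sum.cong refl)
      fix i
      have "(N v ** M z) $ i $ p i * (\<Prod>j\<in>UNIV - {i}. M z $ j $ p j) =
        (\<Prod>j\<in>UNIV. (\<chi> k. if k = i then \<Sum>m\<in>UNIV. N v $ i $ m *s row m (M z) else row k (M z)) $ j $ p j)" for p
        by (subst prod.remove[of UNIV i])
           (auto simp: matrix_matrix_mult_def row_def intro!: prod.cong)
      then show "(\<Sum>p\<in>?P. of_int (sign p) * ((N v ** M z) $ i $ p i * (\<Prod>j\<in>UNIV - {i}. M z $ j $ p j))) =
         det (\<chi> k. if k = i then \<Sum>m\<in>UNIV. N v $ i $ m *s row m (M z) else row k (M z))"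
        unfolding det_def by simp
    qed
    also have "\<dots> = trace (N v) * det (M z)"
      unfolding cramer_lemma_transpose by (simp add: trace_def sum_distrib_right)
    finally show ?thesis .
  qed
  ultimately show ?thesis by simp
qed

definition gram :: "(complex^'n::finite \<Rightarrow> complex^'n \<Rightarrow> real) \<Rightarrow> real^'n bit0^'n bit0" where
  "gram b = (\<chi> i j. b (cbasis i) (cbasis j))"

lemma rmat_cbasis:
  assumes "linear F"
  shows "F (cbasis b) = (\<Sum>a\<in>UNIV. rmat F $ a $ b *\<^sub>R cbasis a)"
proof -
  have "rmat F $ a $ b = to_rvec (F (cbasis b)) $ a" for a
    by (simp add: rmat_def matrix_def of_rvec_axis)
  then have "(\<Sum>a\<in>UNIV. rmat F $ a $ b *\<^sub>R cbasis a) = of_rvec (to_rvec (F (cbasis b)))"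
    unfolding of_rvec_def by simp
  then show ?thesis by simp
qed

lemma bilinear_sums:
  assumes "bilinear b"
  shows "b (\<Sum>i\<in>I. x i *\<^sub>R u i) (\<Sum>j\<in>J. y j *\<^sub>R w j) = (\<Sum>i\<in>I. \<Sum>j\<in>J. x i * y j * b (u i) (w j))"
proof -
  have "linear (b u)" "linear (\<lambda>u. b u w)" for u w using assms by (auto simp: bilinear_def)
  note lin = this
  have A: "b (\<Sum>i\<in>I. x i *\<^sub>R u i) W = (\<Sum>i\<in>I. x i * b (u i) W)" for W
    by (simp add: linear_sum[OF lin(2)] linear_scale[OF lin(2)])
  have B: "b U (\<Sum>j\<in>J. y j *\<^sub>R w j) = (\<Sum>j\<in>J. y j * b U (w j))" for U
    by (simp add: linear_sum[OF lin(1)] linear_scale[OF lin(1)])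
  show ?thesis unfolding A unfolding B by (simp add: sum_distrib_left mult.assoc)
qed

lemma gram_pullback:
  assumes "linear F" "bilinear b"
  shows "gram (\<lambda>u v. b (F u) (F v)) = transpose (rmat F) ** gram b ** rmat F"
proof -
  have "b (F (cbasis i)) (F (cbasis j)) =
    (\<Sum>l\<in>UNIV. (\<Sum>k\<in>UNIV. rmat F $ k $ i * gram b $ k $ l) * rmat F $ l $ j)" for i j
    unfolding rmat_cbasis[OF assms(1)] bilinear_sums[OF assms(2)] sum_distrib_right
    by (subst sum.swap) (simp add: gram_def mult_ac)
  then show ?thesis
    by (simp add: gram_def vec_eq_iff matrix_matrix_mult_def transpose_def)
qed

lemma gram_nondegenerate:
  assumes "bilinear b" "\<And>u. u \<noteq> 0 \<Longrightarrow> b u u > 0"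
  shows "det (gram b) \<noteq> 0"
proof -
  have "x = 0" if "gram b *v x = 0" for x
  proof (rule ccontr)
    assume "x \<noteq> 0"
    then have "of_rvec x \<noteq> 0" using to_of_rvec[of x] linear_0[OF linear_to_rvec] by metis
    then have "b (of_rvec x) (of_rvec x) > 0" by (rule assms(2))
    moreover have "b (of_rvec x) (of_rvec x) = (\<Sum>i\<in>UNIV. x $ i * (gram b *v x) $ i)"
      unfolding of_rvec_def bilinear_sums[OF assms(1)]
      by (simp add: gram_def matrix_vector_mult_def sum_distrib_left mult_ac)
    ultimately show False using that by simp
  qed
  then have "invertible (gram b)" using matrix_left_invertible_ker invertible_left_inverse by blast
  then show ?thesis using invertible_det_nz by blast
qed

lemma bilinear_herm: "bilinear (\<lambda>u v. Re (herm H u v))"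
proof -
  have "herm H (u + u') v = herm H u v + herm H u' v" "herm H v (u + u') = herm H v u + herm H v u'"
    for u u' v by (simp_all add: herm_def ring_distribs sum.distrib)
  moreover have "herm H (r *\<^sub>R u) v = r *\<^sub>R herm H u v" "herm H u (r *\<^sub>R v) = r *\<^sub>R herm H u v"
    for r u v by (simp_all add: herm_def scaleR_sum_right)
  ultimately show ?thesis unfolding bilinear_def by (auto intro!: linearI)
qed

text \<open>Each complex diagonal entry contributes its real part twice, once for the real and once
  for the imaginary coordinate direction.\<close>

lemma trace_rmat: "trace (rmat ((*v) N)) = 2 * Re (trace N)"
proof -
  have "trace (rmat ((*v) N)) = (\<Sum>a\<in>UNIV. (\<lambda>(i, b). Re (N $ i $ i)) (cidx a))"
    unfolding trace_def
  proof (intro sum.cong refl)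
    fix a
    have "N *v axis i x = (\<chi> k. N $ k $ i * x)" for i x
      by (simp add: matrix_vector_mult_def axis_def vec_eq_iff if_distrib cong: if_cong)
    then show "rmat ((*v) N) $ a $ a = (\<lambda>(i, b). Re (N $ i $ i)) (cidx a)"
      by (simp add: rmat_def matrix_def of_rvec_axis) (simp add: to_rvec_def cbasis_def case_prod_unfold)
  qed
  also have "\<dots> = 2 * Re (trace N)" unfolding sum_cidx by (simp add: trace_def sum_distrib_left)
  finally show ?thesis .
qed

text \<open>Volume density of the Riemannian metric \<open>Re (herm (h z) u v)\<close> in the real
  basis \<open>cbasis\<close>. With the real Gram matrix, a coordinate change multiplies it by the
  absolute value of the real Jacobian determinant, exactly the factor in the change of variables
  formula.\<close>

definition vol_density :: "'n::finite local_metric \<Rightarrow> complex^'n \<Rightarrow> real" where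
  "vol_density h z = sqrt \<bar>det (gram (\<lambda>u v. Re (herm (h z) u v)))\<bar>"

lemma vol_density_pullback:
  assumes "linear F" "\<And>u v. herm H u v = herm (g w) (F u) (F v)" "h z = H"
  shows "vol_density h z = \<bar>det (rmat F)\<bar> * vol_density g w"
proof -
  have "gram (\<lambda>u v. Re (herm H u v)) =
      transpose (rmat F) ** gram (\<lambda>u v. Re (herm (g w) u v)) ** rmat F"
    unfolding assms(2) by (rule gram_pullback[OF assms(1) bilinear_herm])
  then show ?thesis
    by (simp add: vol_density_def assms(3) det_mul det_transpose abs_mult real_sqrt_mult)
qed

section \<open>Logarithmic derivative of the volume density\<close>

context local_lck
begin

lemma Re_herm_commute:
  assumes z: "z \<in> S"
  shows "Re (herm (h z) u w) = Re (herm (h z) w u)"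
proof -
  have "cnj (herm (h z) u w) = (\<Sum>i\<in>UNIV. \<Sum>j\<in>UNIV. h z $ j $ i * w $ j * cnj (u $ i))"
    unfolding herm_def by (simp add: hermitian[OF z, symmetric] mult_ac)
  also have "\<dots> = herm (h z) w u" unfolding herm_def by (rule sum.swap)
  finally have "Re (cnj (herm (h z) u w)) = Re (herm (h z) w u)" by simp
  then show ?thesis by simp
qed

lemma gram_h_nz: "z \<in> S \<Longrightarrow> det (gram (\<lambda>u v. Re (herm (h z) u v))) \<noteq> 0"
  by (rule gram_nondegenerate[OF bilinear_herm]) (rule positive)

lemma vol_density_pos: "z \<in> S \<Longrightarrow> vol_density h z > 0"
  using gram_h_nz by (simp add: vol_density_def)

text \<open>The metric varies by \<open>D\<^sub>v h = h \<cdot> (N v)\<close> with the complex endomorphism \<open>N v\<close>, whose real trace is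
  twice the real part of its complex trace.\<close>

lemma vol_density_has_derivative:
  assumes z: "z \<in> S"
  shows "(vol_density h has_derivative (\<lambda>v. vol_density h z *
     Re (\<Sum>k\<in>UNIV. \<Sum>l\<in>UNIV. inv_h z l k * frechet_derivative (\<lambda>x. h x $ k $ l) (at z) v))) (at z)"
proof -
  define dh where "dh v k l = frechet_derivative (\<lambda>x. h x $ k $ l) (at z) v" for v k l
  define G where "G x = gram (\<lambda>u v. Re (herm (h x) u v))" for x
  define X where "X v p q = (\<Sum>l\<in>UNIV. inv_h z p l * dh v l q)" for v p q
  \<comment> \<open>The endomorphism acts in the second slot of \<open>herm\<close>, which is
    conjugate linear; hence the conjugate of the inverse metric times the derivative of the
    metric.\<close>
  define N :: "complex^'n \<Rightarrow> complex^'n^'n" where "N v = (\<chi> p q. cnj (X v p q))" for v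
  define t where "t v = (\<Sum>k\<in>UNIV. \<Sum>l\<in>UNIV. inv_h z l k * dh v k l)" for v
  have trN: "Re (trace (N v)) = Re (t v)" for v
  proof -
    have "trace (N v) = cnj (\<Sum>p\<in>UNIV. \<Sum>l\<in>UNIV. inv_h z p l * dh v l p)"
      by (simp add: trace_def N_def X_def)
    also have "(\<Sum>p\<in>UNIV. \<Sum>l\<in>UNIV. inv_h z p l * dh v l p) = t v"
      unfolding t_def by (rule sum.swap)
    finally show ?thesis by simp
  qed
  have hN: "herm (h z) u (N v *v w) = (\<Sum>i\<in>UNIV. \<Sum>q\<in>UNIV. dh v i q * u $ i * cnj (w $ q))" for u v w
  proof -
    have "herm (h z) u (N v *v w) = (\<Sum>i\<in>UNIV. \<Sum>j\<in>UNIV. \<Sum>q\<in>UNIV.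
        h z $ i $ j * u $ i * X v j q * cnj (w $ q))"
      unfolding herm_def N_def by (simp add: matrix_vector_mult_def sum_distrib_left mult.assoc)
    also have "\<dots> = (\<Sum>i\<in>UNIV. \<Sum>q\<in>UNIV. \<Sum>j\<in>UNIV.
        h z $ i $ j * u $ i * X v j q * cnj (w $ q))"
      by (rule sum.cong[OF refl sum.swap])
    also have "\<dots> = (\<Sum>i\<in>UNIV. \<Sum>q\<in>UNIV. dh v i q * u $ i * cnj (w $ q))"
    proof (intro sum.cong refl)
      fix i q
      have "(\<Sum>j\<in>UNIV. h z $ i $ j * X v j q) = (\<Sum>j\<in>UNIV. \<Sum>l\<in>UNIV. h z $ i $ j * inv_h z j l * dh v l q)"
        by (simp add: X_def sum_distrib_left mult.assoc)
      also have "\<dots> = (\<Sum>l\<in>UNIV. \<Sum>j\<in>UNIV. h z $ i $ j * inv_h z j l * dh v l q)" by (rule sum.swap)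
      also have "\<dots> = dh v i q" unfolding sum_distrib_right[symmetric] h_inv_h[OF z] by simp
      finally have "(\<Sum>j\<in>UNIV. h z $ i $ j * X v j q) * (u $ i * cnj (w $ q)) = dh v i q * (u $ i * cnj (w $ q))"
        by simp
      then show "(\<Sum>j\<in>UNIV. h z $ i $ j * u $ i * X v j q * cnj (w $ q)) = dh v i q * u $ i * cnj (w $ q)"
        unfolding sum_distrib_right by (simp add: mult_ac)
    qed
    finally show ?thesis .
  qed
  have Gd: "((\<lambda>x. G x $ a $ b) has_derivative (\<lambda>v. (transpose (rmat ((*v) (N v))) ** G z) $ a $ b)) (at z)" for a b
  proof -
    \<comment> \<open>Entry \<open>a\<close>, \<open>b\<close> of the Gram matrix is differentiated
      with its arguments exchanged, so that \<open>N v\<close> hits \<open>cbasis a\<close> and the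
      derivative takes the form of a matrix times \<open>G z\<close> on the right, as
      \<open>has_derivative_det\<close> requires.\<close>
    have 0: "((\<lambda>x. Re (herm (h x) (cbasis b) (cbasis a))) has_derivative
      (\<lambda>v. Re (\<Sum>i\<in>UNIV. \<Sum>q\<in>UNIV. dh v i q * cbasis b $ i * cnj (cbasis a $ q)))) (at z)"
      unfolding herm_def dh_def
      by (intro bounded_linear.has_derivative[OF bounded_linear_Re] has_derivative_sum
          has_derivative_mult_left differentiable_h[OF z, unfolded frechet_derivative_works])
    have eq: "Re (herm (h x) (cbasis b) (cbasis a)) = G x $ a $ b" if "x \<in> S" for x
      unfolding G_def gram_def vec_lambda_beta by (rule Re_herm_commute[OF that])
    have 1: "((\<lambda>x. G x $ a $ b) has_derivative
      (\<lambda>v. Re (\<Sum>i\<in>UNIV. \<Sum>q\<in>UNIV. dh v i q * cbasis b $ i * cnj (cbasis a $ q)))) (at z)"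
      by (rule has_derivative_transform_within_open[OF 0 open_S z]) (rule eq)
    have "Re (\<Sum>i\<in>UNIV. \<Sum>q\<in>UNIV. dh v i q * cbasis b $ i * cnj (cbasis a $ q)) =
      (transpose (rmat ((*v) (N v))) ** G z) $ a $ b" for v
    proof -
      let ?b = "\<lambda>u v. Re (herm (h z) u v)"
      note sym = Re_herm_commute[OF z]
      have lN: "linear ((*v) (N v))" by simp
      have "Re (\<Sum>i\<in>UNIV. \<Sum>q\<in>UNIV. dh v i q * cbasis b $ i * cnj (cbasis a $ q)) = ?b (cbasis b) (N v *v cbasis a)"
        by (simp only: hN)
      also have "\<dots> = (\<Sum>c\<in>UNIV. rmat ((*v) (N v)) $ c $ a * ?b (cbasis b) (cbasis c))"
        using bilinear_sums[OF bilinear_herm[of "h z"], of "\<lambda>_. 1" "\<lambda>_. cbasis b" "{b}"]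
        by (subst rmat_cbasis[OF lN]) simp
      also have "\<dots> = (transpose (rmat ((*v) (N v))) ** G z) $ a $ b"
        by (simp add: matrix_matrix_mult_def transpose_def G_def gram_def sym[of "cbasis b"])
      finally show ?thesis .
    qed
    with 1 show ?thesis by simp
  qed
  have trT: "trace (transpose (rmat ((*v) (N v)))) = 2 * Re (t v)" for v
    using trace_rmat[of "N v"] trN by (simp add: trace_def transpose_def)
  have dd: "((\<lambda>x. det (G x)) has_derivative (\<lambda>v. 2 * Re (t v) * det (G z))) (at z)"
    using has_derivative_det[of G "\<lambda>v. transpose (rmat ((*v) (N v)))" z] Gd unfolding trT by blast
  have nz: "det (G z) \<noteq> 0" using gram_h_nz[OF z] by (simp add: G_def)
  then have pos: "0 < det (G z) * det (G z)" "0 < sqrt (det (G z) * det (G z))" by (auto simp: zero_less_mult_iff linorder_neq_iff)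
  have 1: "((\<lambda>x. det (G x) * det (G x)) has_derivative
      (\<lambda>v. det (G z) * (2 * Re (t v) * det (G z)) + 2 * Re (t v) * det (G z) * det (G z))) (at z)"
    by (rule has_derivative_mult[OF dd dd])
  \<comment> \<open>The root of the absolute value is written as \<open>sqrt (sqrt (d * d))\<close>,
    which is differentiable wherever \<open>d\<close> is nonzero; the sign of the Gram determinant
    does not have to be determined. The root halves the factor 2 from the real trace.\<close>
  have 2: "((\<lambda>x. sqrt (sqrt (det (G x) * det (G x)))) has_derivative
    (\<lambda>v. (det (G z) * (2 * Re (t v) * det (G z)) + 2 * Re (t v) * det (G z) * det (G z))
      * (inverse (sqrt (det (G z) * det (G z))) / 2) * (inverse (sqrt (sqrt (det (G z) * det (G z)))) / 2))) (at z)"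
    by (rule has_derivative_real_sqrt[OF pos(2) has_derivative_real_sqrt[OF pos(1) 1]])
  have 3: "(det (G z) * (2 * Re (t v) * det (G z)) + 2 * Re (t v) * det (G z) * det (G z))
      * (inverse (sqrt (det (G z) * det (G z))) / 2) * (inverse (sqrt (sqrt (det (G z) * det (G z)))) / 2) =
      sqrt \<bar>det (G z)\<bar> * Re (t v)" for v
  proof -
    define d where "d = \<bar>det (G z)\<bar>"
    have "d > 0" using nz by (simp add: d_def)
    then have "d * d * inverse d * inverse (sqrt d) = sqrt d"
      by (simp add: field_simps)
    moreover have "det (G z) * det (G z) = d * d" by (simp add: d_def)
    moreover have "sqrt (d * d) = d" using \<open>d > 0\<close> by simp
    ultimately have e: "det (G z) * det (G z) * inverse (sqrt (det (G z) * det (G z))) * inverse (sqrt (sqrt (det (G z) * det (G z)))) = sqrt \<bar>det (G z)\<bar>"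
      by (simp only: d_def[symmetric])
    have "(det (G z) * (2 * Re (t v) * det (G z)) + 2 * Re (t v) * det (G z) * det (G z))
      * (inverse (sqrt (det (G z) * det (G z))) / 2) * (inverse (sqrt (sqrt (det (G z) * det (G z)))) / 2) =
      (det (G z) * det (G z) * inverse (sqrt (det (G z) * det (G z))) * inverse (sqrt (sqrt (det (G z) * det (G z))))) * Re (t v)"
      by (simp only: mult_ac distrib_left distrib_right)
    then show ?thesis unfolding e .
  qed
  show ?thesis using 2[unfolded 3] by (simp add: vol_density_def[abs_def] G_def t_def dh_def)
qed

end

section \<open>Regularity of holomorphic maps\<close>

lemma norm_vector_smult: "norm (c *s (v :: complex^'n)) = cmod c * norm v"
  by (simp add: norm_vec_def norm_mult L2_set_right_distrib)

text \<open>Taylor's formula to first order, with the second derivative bounded on the disc of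
  radius \<open>R / 4\<close> by Cauchy's inequality on circles of the same radius: the constant 32
  is \<open>2!\<close> times \<open>4\<^sup>2\<close>. The bound depends on the function only
  through \<open>B\<close>, which is what makes the convergence uniform.\<close>

lemma cauchy_difference_quotient:
  fixes \<phi> :: "complex \<Rightarrow> complex"
  assumes hol: "\<phi> holomorphic_on ball 0 R" and R: "R > 0"
    and B: "\<And>x. x \<in> ball 0 R \<Longrightarrow> cmod (\<phi> x) \<le> B" and \<eta>: "cmod \<eta> \<le> R / 4" "\<eta> \<noteq> 0"
  shows "cmod ((\<phi> \<eta> - \<phi> 0) / \<eta> - deriv \<phi> 0) \<le> 32 * B / R\<^sup>2 * cmod \<eta>"
proof -
  have bound: "cmod ((deriv ^^ 2) \<phi> x) \<le> 32 * B / R\<^sup>2" if "x \<in> cball 0 (R / 4)" for x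
  proof -
    have sub: "cball x (R / 4) \<subseteq> ball 0 R"
    proof
      fix y assume "y \<in> cball x (R / 4)"
      then have "cmod (y - x) \<le> R / 4" by (simp add: dist_norm norm_minus_commute)
      moreover have "cmod y \<le> cmod x + cmod (y - x)" by (rule norm_triangle_sub)
      ultimately show "y \<in> ball 0 R" using that R by simp
    qed
    have "cmod ((deriv ^^ 2) \<phi> x) \<le> fact 2 * B / (R / 4)^2"
    proof (rule Cauchy_inequality)
      show "\<phi> holomorphic_on ball x (R / 4)"
        using hol sub ball_subset_cball holomorphic_on_subset by (metis order.trans)
      show "continuous_on (cball x (R / 4)) \<phi>"
        using hol sub holomorphic_on_imp_continuous_on holomorphic_on_subset by blast
      show "cmod (\<phi> y) \<le> B" if "cmod (x - y) = R / 4" for y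
        using sub that by (intro B) (auto simp: dist_norm subset_iff)
    qed (use R in auto)
    then show ?thesis by (simp add: power2_eq_square field_simps)
  qed
  have "cmod ((deriv ^^ 0) \<phi> \<eta> - (\<Sum>i\<le>1. (deriv ^^ i) \<phi> 0 * (\<eta> - 0) ^ i / fact i)) \<le>
      32 * B / R\<^sup>2 * cmod (\<eta> - 0) ^ Suc 1 / fact 1"
  proof (rule complex_Taylor[where f = "\<lambda>i. (deriv ^^ i) \<phi>" and S = "cball 0 (R / 4)" and n = 1])
    show "((deriv ^^ i) \<phi> has_field_derivative (deriv ^^ Suc i) \<phi> x) (at x within cball 0 (R / 4))"
      if "x \<in> cball 0 (R / 4)" for i x
    proof -
      have "x \<in> ball 0 R" using that R by simp
      moreover have "(deriv ^^ i) \<phi> holomorphic_on ball 0 R" by (intro holomorphic_higher_deriv hol open_ball)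
      ultimately show ?thesis
        using holomorphic_derivI[OF _ open_ball] by (simp add: has_field_derivative_at_within)
    qed
    show "cmod ((deriv ^^ Suc 1) \<phi> x) \<le> 32 * B / R\<^sup>2" if "x \<in> cball 0 (R / 4)" for x
      using bound[OF that] by (simp add: numeral_2_eq_2)
  qed (use R \<eta> in auto)
  then have *: "cmod (\<phi> \<eta> - \<phi> 0 - deriv \<phi> 0 * \<eta>) \<le> 32 * B / R\<^sup>2 * (cmod \<eta> * cmod \<eta>)"
    by (simp add: algebra_simps)
  have "(\<phi> \<eta> - \<phi> 0) / \<eta> - deriv \<phi> 0 = (\<phi> \<eta> - \<phi> 0 - deriv \<phi> 0 * \<eta>) / \<eta>"
    using \<eta> by (simp add: field_simps)
  then have "cmod ((\<phi> \<eta> - \<phi> 0) / \<eta> - deriv \<phi> 0) = cmod (\<phi> \<eta> - \<phi> 0 - deriv \<phi> 0 * \<eta>) / cmod \<eta>"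
    by (simp add: norm_divide)
  also have "\<dots> \<le> 32 * B / R\<^sup>2 * (cmod \<eta> * cmod \<eta>) / cmod \<eta>"
    using * by (rule divide_right_mono) simp
  also have "\<dots> = 32 * B / R\<^sup>2 * cmod \<eta>" using \<eta> by simp
  finally show ?thesis .
qed

lemma vec_holomorphic_frechet:
  assumes "vec_holomorphic_on T S" "z \<in> S"
  shows "(T has_derivative frechet_derivative T (at z)) (at z)"
    "frechet_derivative T (at z) (a *s v) = a *s frechet_derivative T (at z) v"
proof -
  obtain L where L: "(T has_derivative L) (at z)" "\<And>a v. L (a *s v) = a *s L v"
    using assms unfolding vec_holomorphic_on_def by blast
  moreover have "L = frechet_derivative T (at z)" by (rule frechet_derivative_at[OF L(1)])
  ultimately show "(T has_derivative frechet_derivative T (at z)) (at z)"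
    "frechet_derivative T (at z) (a *s v) = a *s frechet_derivative T (at z) v" by auto
qed

lemma vec_holomorphic_line:
  assumes T: "vec_holomorphic_on T S" "z + \<zeta> *s v \<in> S"
  shows "((\<lambda>\<zeta>. T (z + \<zeta> *s v) $ k) has_field_derivative frechet_derivative T (at (z + \<zeta> *s v)) v $ k) (at \<zeta>)"
proof -
  have lin: "bounded_linear (\<lambda>\<zeta>. \<zeta> *s v)"
    by (intro linear_conv_bounded_linear[THEN iffD1] linearI) (simp_all add: vec_eq_iff algebra_simps)
  have "((\<lambda>\<zeta>. T (z + \<zeta> *s v)) has_derivative (\<lambda>t. frechet_derivative T (at (z + \<zeta> *s v)) (t *s v))) (at \<zeta>)"
    by (rule has_derivative_compose[where f = "\<lambda>\<zeta>. z + \<zeta> *s v", OF _ vec_holomorphic_frechet(1)[OF T]])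
       (use has_derivative_add[OF has_derivative_const[of z] bounded_linear_imp_has_derivative[OF lin]] in simp)
  then have "((\<lambda>\<zeta>. T (z + \<zeta> *s v) $ k) has_derivative
      (\<lambda>t. frechet_derivative T (at (z + \<zeta> *s v)) (t *s v) $ k)) (at \<zeta>)"
    by (rule bounded_linear.has_derivative[OF bounded_linear_vec_nth])
  then show ?thesis
    by (simp add: has_field_derivative_def vec_holomorphic_frechet(2)[OF T] mult_commute_abs)
qed

text \<open>By Cauchy's estimates the difference quotients in a fixed direction converge locally uniformly
  to the directional derivative, which therefore inherits continuity and holomorphy.\<close>

lemma vec_holomorphic_uniform_quotients:
  assumes S: "open S" and T: "vec_holomorphic_on T S" and z0: "z0 \<in> S"
  obtains r \<epsilon> where "r > 0" "cball z0 r \<subseteq> S" "\<And>n. \<epsilon> n \<noteq> (0::complex)"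
    "\<And>n z. z \<in> cball z0 r \<Longrightarrow> z + \<epsilon> n *s v \<in> S"
    "uniform_limit (cball z0 r) (\<lambda>n z. (T (z + \<epsilon> n *s v) $ k - T z $ k) / \<epsilon> n)
       (\<lambda>z. frechet_derivative T (at z) v $ k) sequentially"
proof -
  obtain r where r: "r > 0" "cball z0 (2 * r) \<subseteq> S"
  proof -
    obtain e where "e > 0" "cball z0 e \<subseteq> S" using S z0 open_contains_cball by blast
    then show thesis using that[of "e / 2"] by simp
  qed
  have contT: "continuous_on (cball z0 (2 * r)) (\<lambda>z. T z $ k)"
  proof (intro continuous_at_imp_continuous_on ballI)
    fix z assume "z \<in> cball z0 (2 * r)"
    then have "(T has_derivative frechet_derivative T (at z)) (at z)"
      by (intro vec_holomorphic_frechet(1)[OF T] subsetD[OF r(2)])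
    then have "isCont T z" by (rule has_derivative_continuous)
    then show "isCont (\<lambda>z. T z $ k) z" by (intro continuous_intros)
  qed
  then have "bounded ((\<lambda>z. T z $ k) ` cball z0 (2 * r))"
    by (intro compact_imp_bounded compact_continuous_image compact_cball)
  then obtain B where B: "B > 0" "\<And>z. z \<in> cball z0 (2 * r) \<Longrightarrow> cmod (T z $ k) \<le> B"
    unfolding bounded_pos by auto
  \<comment> \<open>A displacement \<eta> times \<open>v\<close> with \<open>cmod \<eta>\<close> at
    most \<open>R\<close> has length at most \<open>r\<close>, so from every point of
    \<open>cball z0 r\<close> the whole disc stays in \<open>cball z0 (2 * r)\<close>, where a
    single bound \<open>B\<close> applies. The steps \<epsilon> begin at \<open>R / 4\<close>, the
    range of \<open>cauchy_difference_quotient\<close>.\<close>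
  define R where "R = r / (norm v + 1)"
  have R: "R > 0" unfolding R_def using r by (simp add: add_nonneg_pos)
  have near: "z + \<eta> *s v \<in> cball z0 (2 * r)" if "z \<in> cball z0 r" "\<eta> \<in> cball 0 R" for z \<eta>
  proof -
    have "norm (\<eta> *s v) \<le> R * norm v"
      using that(2) by (simp add: norm_vector_smult mult_right_mono)
    also have "\<dots> \<le> R * (norm v + 1)" using R by simp
    also have "\<dots> = r" unfolding R_def using norm_ge_zero[of v] by (simp add: add_nonneg_eq_0_iff)
    finally have "norm (\<eta> *s v) \<le> r" .
    moreover have "norm (z + \<eta> *s v - z0) \<le> norm (z - z0) + norm (\<eta> *s v)"
      using norm_triangle_ineq[of "z - z0" "\<eta> *s v"] by (simp add: algebra_simps)
    ultimately show ?thesis using that(1) by (simp add: dist_norm norm_minus_commute)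
  qed
  define \<epsilon> where "\<epsilon> n = complex_of_real (R / 4 / (real n + 1))" for n
  have \<epsilon>: "\<epsilon> n \<noteq> 0" "cmod (\<epsilon> n) = R / 4 / (real n + 1)" "cmod (\<epsilon> n) \<le> R / 4" for n
    using R by (simp_all add: \<epsilon>_def norm_divide field_simps del: of_real_divide)
  have est: "cmod ((T (z + \<epsilon> n *s v) $ k - T z $ k) / \<epsilon> n - frechet_derivative T (at z) v $ k) \<le>
      32 * B / R\<^sup>2 * cmod (\<epsilon> n)" if z: "z \<in> cball z0 r" for z n
  proof -
    let ?\<phi> = "\<lambda>\<eta>. T (z + \<eta> *s v) $ k"
    have der: "(?\<phi> has_field_derivative frechet_derivative T (at (z + \<eta> *s v)) v $ k) (at \<eta>)"
      if "\<eta> \<in> ball 0 R" for \<eta>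
      using that by (intro vec_holomorphic_line[OF T] subsetD[OF r(2) near[OF z]]) simp
    have "cmod ((?\<phi> (\<epsilon> n) - ?\<phi> 0) / \<epsilon> n - deriv ?\<phi> 0) \<le> 32 * B / R\<^sup>2 * cmod (\<epsilon> n)"
    proof (rule cauchy_difference_quotient[OF _ R])
      show "?\<phi> holomorphic_on ball 0 R"
        unfolding holomorphic_on_open[OF open_ball] using der by blast
      show "cmod (?\<phi> x) \<le> B" if "x \<in> ball 0 R" for x
        using that by (intro B(2) near[OF z]) simp
    qed (use \<epsilon> in auto)
    moreover have "deriv ?\<phi> 0 = frechet_derivative T (at z) v $ k"
      using DERIV_imp_deriv[OF der[of 0]] R by simp
    ultimately show ?thesis by simp
  qed
  have sub: "cball z0 r \<subseteq> S" by (rule order.trans[OF subset_cball r(2)]) (use r(1) in simp)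
  have inS: "z + \<epsilon> n *s v \<in> S" if "z \<in> cball z0 r" for n z
  proof -
    have "cmod (\<epsilon> n) \<le> R" using \<epsilon>(3)[of n] R by linarith
    then have "\<epsilon> n \<in> cball 0 R" by (simp only: mem_cball_0)
    then show ?thesis by (rule subsetD[OF r(2) near[OF that]])
  qed
  have ul: "uniform_limit (cball z0 r) (\<lambda>n z. (T (z + \<epsilon> n *s v) $ k - T z $ k) / \<epsilon> n)
       (\<lambda>z. frechet_derivative T (at z) v $ k) sequentially"
  proof (rule uniform_limitI)
    fix e :: real assume "e > 0"
    have "(\<lambda>n. 32 * B / R\<^sup>2 * (R / 4) * inverse (real (Suc n))) \<longlonglongrightarrow> 32 * B / R\<^sup>2 * (R / 4) * 0"
      by (rule tendsto_mult_left[OF LIMSEQ_inverse_real_of_nat])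
    then have "\<forall>\<^sub>F n in sequentially. 32 * B / R\<^sup>2 * (R / 4) * inverse (real (Suc n)) < e"
      by (rule order_tendstoD(2)) (use \<open>e > 0\<close> in simp)
    moreover have "\<forall>z\<in>cball z0 r.
        dist ((T (z + \<epsilon> n *s v) $ k - T z $ k) / \<epsilon> n) (frechet_derivative T (at z) v $ k) < e"
      if "32 * B / R\<^sup>2 * (R / 4) * inverse (real (Suc n)) < e" for n
    proof
      fix z assume "z \<in> cball z0 r"
      have "32 * B / R\<^sup>2 * cmod (\<epsilon> n) = 32 * B / R\<^sup>2 * (R / 4) * inverse (real (Suc n))"
        by (simp only: \<epsilon>(2) divide_inverse of_nat_Suc add.commute mult.assoc)
      then have "32 * B / R\<^sup>2 * cmod (\<epsilon> n) < e" using that by (simp only:)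
      then show "dist ((T (z + \<epsilon> n *s v) $ k - T z $ k) / \<epsilon> n) (frechet_derivative T (at z) v $ k) < e"
        unfolding dist_norm by (rule le_less_trans[OF est[OF \<open>z \<in> cball z0 r\<close>]])
    qed
    ultimately show "\<forall>\<^sub>F n in sequentially. \<forall>z\<in>cball z0 r.
        dist ((T (z + \<epsilon> n *s v) $ k - T z $ k) / \<epsilon> n) (frechet_derivative T (at z) v $ k) < e"
      by (rule eventually_mono)
  qed
  show thesis by (rule that[OF r(1) sub \<epsilon>(1) inS ul])
qed

text \<open>A uniform limit of continuous difference quotients. It is what makes a cut-off function
  defined in one chart continuously differentiable in every other chart.\<close>

lemma vec_holomorphic_derivative_continuous:
  assumes S: "open S" and T: "vec_holomorphic_on T S"
  shows "continuous_on S (\<lambda>z. frechet_derivative T (at z) v $ k)"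
proof (intro continuous_at_imp_continuous_on ballI)
  fix z0 assume z0: "z0 \<in> S"
  obtain r \<epsilon> where r: "r > 0" "cball z0 r \<subseteq> S" and \<epsilon>: "\<And>n. \<epsilon> n \<noteq> (0::complex)"
    and inS: "\<And>n z. z \<in> cball z0 r \<Longrightarrow> z + \<epsilon> n *s v \<in> S"
    and lim: "uniform_limit (cball z0 r) (\<lambda>n z. (T (z + \<epsilon> n *s v) $ k - T z $ k) / \<epsilon> n)
       (\<lambda>z. frechet_derivative T (at z) v $ k) sequentially"
    by (rule vec_holomorphic_uniform_quotients[OF S T z0, of v k]) (rule that)
  have contT: "continuous_on S T"
    using vec_holomorphic_frechet(1)[OF T]
    by (intro continuous_at_imp_continuous_on ballI) (rule has_derivative_continuous)
  have "continuous_on (cball z0 r) (\<lambda>z. (T (z + \<epsilon> n *s v) $ k - T z $ k) / \<epsilon> n)" for n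
  proof -
    have "continuous_on (cball z0 r) (\<lambda>z. T (z + \<epsilon> n *s v))"
      by (rule continuous_on_compose2[OF contT, where f = "\<lambda>z. z + \<epsilon> n *s v"])
         (use inS in \<open>auto intro!: continuous_on_add continuous_on_id continuous_on_const\<close>)
    moreover have "continuous_on (cball z0 r) T" by (rule continuous_on_subset[OF contT r(2)])
    ultimately show ?thesis using \<epsilon>[of n] by (intro continuous_intros) simp_all
  qed
  then have "continuous_on (cball z0 r) (\<lambda>z. frechet_derivative T (at z) v $ k)"
    by (intro uniform_limit_theorem[OF _ lim]) auto
  then have "continuous_on (ball z0 r) (\<lambda>z. frechet_derivative T (at z) v $ k)"
    by (rule continuous_on_subset) auto
  then show "isCont (\<lambda>z. frechet_derivative T (at z) v $ k) z0"
    using r by (simp add: continuous_on_eq_continuous_at)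
qed

text \<open>On a complex line through \<open>z0\<close> the difference quotients are holomorphic
  functions of one variable, and so is their uniform limit. Holomorphy of the Jacobian along lines
  is all that the transformation of \<open>lee_hess\<close> needs; joint second differentiability is
  not established.\<close>

lemma vec_holomorphic_derivative_line:
  assumes S: "open S" and T: "vec_holomorphic_on T S" and z0: "z0 \<in> S"
  obtains d where "((\<lambda>\<zeta>. frechet_derivative T (at (z0 + \<zeta> *s w)) v $ k) has_field_derivative d) (at 0)"
proof -
  obtain r \<epsilon> where r: "r > 0" "cball z0 r \<subseteq> S" and \<epsilon>: "\<And>n. \<epsilon> n \<noteq> (0::complex)"
    and inS: "\<And>n z. z \<in> cball z0 r \<Longrightarrow> z + \<epsilon> n *s v \<in> S"
    and lim: "uniform_limit (cball z0 r) (\<lambda>n z. (T (z + \<epsilon> n *s v) $ k - T z $ k) / \<epsilon> n)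
       (\<lambda>z. frechet_derivative T (at z) v $ k) sequentially"
    by (rule vec_holomorphic_uniform_quotients[OF S T z0, of v k]) (rule that)
  define s where "s = r / (norm w + 1)"
  have s: "s > 0" unfolding s_def using r by (simp add: add_nonneg_pos)
  have near: "z0 + \<zeta> *s w \<in> cball z0 r" if "\<zeta> \<in> cball 0 s" for \<zeta>
  proof -
    have "norm (\<zeta> *s w) \<le> s * norm w"
      using that by (simp add: norm_vector_smult mult_right_mono)
    also have "\<dots> \<le> s * (norm w + 1)" using s by simp
    also have "\<dots> = r" unfolding s_def using norm_ge_zero[of w] by (simp add: add_nonneg_eq_0_iff)
    finally show ?thesis by (simp add: dist_norm)
  qed
  define q where "q n \<zeta> = (T ((z0 + \<epsilon> n *s v) + \<zeta> *s w) $ k - T (z0 + \<zeta> *s w) $ k) / \<epsilon> n" for n \<zeta>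
  have q: "q n field_differentiable at \<zeta>" if "\<zeta> \<in> cball 0 s" for n \<zeta>
  proof -
    have "z0 + \<epsilon> n *s v + \<zeta> *s w = z0 + \<zeta> *s w + \<epsilon> n *s v" by (simp only: add_ac)
    then have "z0 + \<epsilon> n *s v + \<zeta> *s w \<in> S" using inS[OF near[OF that], of n] by (simp only:)
    note 1 = vec_holomorphic_line[OF T this, of k]
    have "z0 + \<zeta> *s w \<in> S" by (rule subsetD[OF r(2) near[OF that]])
    note 2 = vec_holomorphic_line[OF T this, of k]
    show ?thesis
      unfolding q_def field_differentiable_def by (rule exI, rule DERIV_cdivide[OF DERIV_diff[OF 1 2]])
  qed
  have ul: "uniform_limit (cball 0 s) q (\<lambda>\<zeta>. frechet_derivative T (at (z0 + \<zeta> *s w)) v $ k) sequentially"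
  proof (rule uniform_limitI)
    fix e :: real assume "e > 0"
    from uniform_limitD[OF lim this]
    show "\<forall>\<^sub>F n in sequentially. \<forall>\<zeta>\<in>cball (0::complex) s. dist (q n \<zeta>) (frechet_derivative T (at (z0 + \<zeta> *s w)) v $ k) < e"
    proof eventually_elim
      case (elim n)
      show ?case
      proof
        fix \<zeta> :: complex assume "\<zeta> \<in> cball 0 s"
        have "z0 + \<zeta> *s w + \<epsilon> n *s v = z0 + \<epsilon> n *s v + \<zeta> *s w" by (simp only: add_ac)
        then show "dist (q n \<zeta>) (frechet_derivative T (at (z0 + \<zeta> *s w)) v $ k) < e"
          using bspec[OF elim near[OF \<open>\<zeta> \<in> cball 0 s\<close>]] by (simp only: q_def)
      qed
    qed
  qed
  have "continuous_on (cball 0 s) (q n)" for n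
    using field_differentiable_imp_continuous_at[OF q] by (intro continuous_at_imp_continuous_on ballI)
  moreover have "q n holomorphic_on ball 0 s" for n
    unfolding holomorphic_on_def
    by (rule ballI, rule field_differentiable_at_within, rule q) simp
  ultimately have ev: "\<forall>\<^sub>F n in sequentially. continuous_on (cball 0 s) (q n) \<and> q n holomorphic_on ball 0 s"
    by (intro always_eventually allI conjI)
  have "(\<lambda>\<zeta>. frechet_derivative T (at (z0 + \<zeta> *s w)) v $ k) holomorphic_on ball 0 s"
    by (rule holomorphic_uniform_limit[OF ev ul sequentially_bot])
  then have "\<exists>d. ((\<lambda>\<zeta>. frechet_derivative T (at (z0 + \<zeta> *s w)) v $ k) has_field_derivative d) (at 0)"
    using s unfolding holomorphic_on_open[OF open_ball] by (elim ballE[of _ _ 0]) simp_all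
  then show thesis by (elim exE) (rule that)
qed

section \<open>Transformation under coordinate changes\<close>

locale lck_transition = A: local_lck S1 h1 \<theta>1 + B: local_lck S2 h2 \<theta>2
  for S1 S2 :: "(complex^'n::finite) set" and h1 h2 \<theta>1 \<theta>2 +
  fixes T :: "complex^'n \<Rightarrow> complex^'n" and U
  assumes open_U: "open U" and U: "U \<subseteq> S1" "T ` U \<subseteq> S2"
    and holo: "vec_holomorphic_on T U"
    and \<theta>_T: "\<And>z v. z \<in> U \<Longrightarrow> \<theta>1 z v = \<theta>2 (T z) (frechet_derivative T (at z) v)"
    and h_T: "\<And>z u v. z \<in> U \<Longrightarrow> herm (h1 z) u v =
      herm (h2 (T z)) (frechet_derivative T (at z) u) (frechet_derivative T (at z) v)"
begin

definition jac :: "complex^'n \<Rightarrow> 'n \<Rightarrow> 'n \<Rightarrow> complex" where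
  "jac z k i = frechet_derivative T (at z) (axis i 1) $ k"

lemma in_S: "z \<in> U \<Longrightarrow> z \<in> S1" "z \<in> U \<Longrightarrow> T z \<in> S2"
  using U by auto

lemma dT_axis: "z \<in> U \<Longrightarrow> frechet_derivative T (at z) (axis i \<alpha>) $ k = \<alpha> * jac z k i"
proof -
  assume z: "z \<in> U"
  have "axis i \<alpha> = \<alpha> *s axis i 1" by (simp add: vec_eq_iff axis_def)
  then show ?thesis using vec_holomorphic_frechet(2)[OF holo z, of \<alpha> "axis i 1"] by (simp add: jac_def)
qed

lemma linear_dT: "z \<in> U \<Longrightarrow> linear (frechet_derivative T (at z))"
  using vec_holomorphic_frechet(1)[OF holo] has_derivative_linear by blast

lemma lee_T:
  assumes z: "z \<in> U"
  shows "A.lee i z = (\<Sum>k\<in>UNIV. jac z k i * B.lee k (T z))"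
proof -
  have "\<alpha> * A.lee i z + cnj \<alpha> * cnj (A.lee i z) =
     \<alpha> * (\<Sum>k\<in>UNIV. jac z k i * B.lee k (T z)) + cnj \<alpha> * cnj (\<Sum>k\<in>UNIV. jac z k i * B.lee k (T z))" for \<alpha>
  proof -
    have "\<alpha> * A.lee i z + cnj \<alpha> * cnj (A.lee i z) = complex_of_real (\<theta>2 (T z) (frechet_derivative T (at z) (axis i \<alpha>)))"
      by (simp only: A.\<theta>_axis[OF in_S(1)[OF z], symmetric] \<theta>_T[OF z])
    also have "\<dots> = \<alpha> * (\<Sum>k\<in>UNIV. jac z k i * B.lee k (T z)) + cnj \<alpha> * cnj (\<Sum>k\<in>UNIV. jac z k i * B.lee k (T z))"
      unfolding B.\<theta>_lee[OF in_S(2)[OF z]] dT_axis[OF z]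
      by (simp add: sum.distrib sum_distrib_left mult.assoc)
    finally show ?thesis .
  qed
  then have "(A.lee i z - (\<Sum>k\<in>UNIV. jac z k i * B.lee k (T z))) * \<alpha> +
     cnj (A.lee i z - (\<Sum>k\<in>UNIV. jac z k i * B.lee k (T z))) * cnj \<alpha> = 0" for \<alpha>
    by (simp add: algebra_simps)
  then have "A.lee i z - (\<Sum>k\<in>UNIV. jac z k i * B.lee k (T z)) = 0"
    by (rule sesquilinear_coeffs_zero(1))
  then show ?thesis by simp
qed

lemma h_T_components:
  assumes z: "z \<in> U"
  shows "h1 z $ i $ j = (\<Sum>k\<in>UNIV. \<Sum>l\<in>UNIV. jac z k i * h2 (T z) $ k $ l * cnj (jac z l j))"
proof -
  have "herm H (axis i 1) (axis j 1) = (\<Sum>p\<in>UNIV. \<Sum>q\<in>UNIV. if q = j then if p = i then H $ p $ q else 0 else 0)"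
    for H :: "complex^'n^'n"
    unfolding herm_def by (intro sum.cong refl) (simp add: axis_def)
  then have "h1 z $ i $ j = herm (h1 z) (axis i 1) (axis j 1)" by simp
  also have "\<dots> = herm (h2 (T z)) (frechet_derivative T (at z) (axis i 1)) (frechet_derivative T (at z) (axis j 1))"
    by (rule h_T[OF z])
  finally show ?thesis by (simp add: herm_def dT_axis[OF z] mult_ac)
qed

text \<open>The Jacobian entries in \<open>lee_T\<close> are holomorphic, so their derivatives
  contribute nothing in the barred direction and \<open>lee_hess\<close> transforms as a tensor.
  Both sides of \<open>lee_T\<close> are differentiated along the complex line in direction
  \<open>j\<close>, and the conjugate linear parts of the derivatives are compared.\<close>

lemma lee_hess_T:
  assumes z: "z \<in> U"
  shows "A.lee_hess i j z = (\<Sum>k\<in>UNIV. \<Sum>l\<in>UNIV. jac z k i * B.lee_hess k l (T z) * cnj (jac z l j))"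
proof -
  define line where "line \<zeta> = z + \<zeta> *s axis j 1" for \<zeta>
  have line_der: "(line has_derivative (\<lambda>\<zeta>. \<zeta> *s axis j 1)) (at \<zeta>)" for \<zeta>
  proof -
    have "bounded_linear (\<lambda>\<zeta>. \<zeta> *s axis j (1::complex))"
      by (intro linear_conv_bounded_linear[THEN iffD1] linearI) (simp_all add: vec_eq_iff algebra_simps)
    then show ?thesis unfolding line_def
      using has_derivative_add[OF has_derivative_const[of z], OF bounded_linear_imp_has_derivative] by simp
  qed
  have line0: "line 0 = z" by (simp add: line_def)
  have smul: "\<zeta> *s axis j (1::complex) = axis j \<zeta>" for \<zeta> by (simp add: vec_eq_iff axis_def)
  have dA: "(A.lee i has_derivative frechet_derivative (A.lee i) (at z)) (at z)"
    using smooth_onD(1)[OF A.smooth_lee in_S(1)[OF z]] frechet_derivative_works by blast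
  have "((\<lambda>\<zeta>. A.lee i (line \<zeta>)) has_derivative (\<lambda>\<zeta>. frechet_derivative (A.lee i) (at z) (\<zeta> *s axis j 1))) (at 0)"
    using dA by (intro has_derivative_compose[OF line_der]) (simp add: line0)
  then have L: "((\<lambda>\<zeta>. A.lee i (line \<zeta>)) has_derivative
      (\<lambda>\<zeta>. \<zeta> * dz j (A.lee i) z + cnj \<zeta> * A.lee_hess i j z)) (at 0)"
    unfolding smul A.lee_hess_def
    by (simp add: frechet_derivative_axis smooth_onD(1)[OF A.smooth_lee in_S(1)[OF z]])
  have "\<exists>d. ((\<lambda>\<zeta>. jac (line \<zeta>) k i) has_field_derivative d) (at 0)" for k
    unfolding jac_def line_def using vec_holomorphic_derivative_line[OF open_U holo z] by metis
  then obtain d where d: "\<And>k. ((\<lambda>\<zeta>. jac (line \<zeta>) k i) has_field_derivative d k) (at 0)" by metis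
  have dB: "((\<lambda>\<zeta>. B.lee k (T (line \<zeta>))) has_derivative
      (\<lambda>\<zeta>. \<Sum>l\<in>UNIV. \<zeta> * jac z l j * dz l (B.lee k) (T z) + cnj (\<zeta> * jac z l j) * B.lee_hess k l (T z))) (at 0)" for k
  proof -
    have diff: "B.lee k differentiable (at (T z))"
      using smooth_onD(1)[OF B.smooth_lee in_S(2)[OF z]] .
    have "((\<lambda>\<zeta>. T (line \<zeta>)) has_derivative (\<lambda>\<zeta>. frechet_derivative T (at z) (\<zeta> *s axis j 1))) (at 0)"
      using vec_holomorphic_frechet(1)[OF holo z]
      by (intro has_derivative_compose[OF line_der]) (simp add: line0)
    note TL = this[unfolded smul]
    have "((\<lambda>\<zeta>. B.lee k (T (line \<zeta>))) has_derivative
       (\<lambda>\<zeta>. frechet_derivative (B.lee k) (at (T z)) (frechet_derivative T (at z) (axis j \<zeta>)))) (at 0)"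
      by (rule has_derivative_compose[OF TL]) (simp only: line0, rule diff[unfolded frechet_derivative_works])
    then show ?thesis
      unfolding frechet_derivative_dz[OF diff] dT_axis[OF z] B.lee_hess_def .
  qed
  have "((\<lambda>\<zeta>. \<Sum>k\<in>UNIV. jac (line \<zeta>) k i * B.lee k (T (line \<zeta>))) has_derivative
     (\<lambda>\<zeta>. \<Sum>k\<in>UNIV. jac (line 0) k i * (\<Sum>l\<in>UNIV. \<zeta> * jac z l j * dz l (B.lee k) (T z) + cnj (\<zeta> * jac z l j) * B.lee_hess k l (T z))
        + d k * \<zeta> * B.lee k (T (line 0)))) (at 0)"
    by (intro has_derivative_sum has_derivative_mult dB d[unfolded has_field_derivative_def])
  moreover have "\<exists>W. open W \<and> 0 \<in> W \<and> (\<forall>\<zeta>\<in>W. line \<zeta> \<in> U)"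
  proof (intro exI conjI)
    have "continuous_on UNIV line"
      by (intro continuous_at_imp_continuous_on ballI) (rule has_derivative_continuous[OF line_der])
    then show "open (line -` U)" using open_vimage[OF open_U] by blast
  qed (use z line0 in auto)
  then obtain W where W: "open W" "0 \<in> W" "\<And>\<zeta>. \<zeta> \<in> W \<Longrightarrow> line \<zeta> \<in> U" by blast
  ultimately have R: "((\<lambda>\<zeta>. A.lee i (line \<zeta>)) has_derivative
     (\<lambda>\<zeta>. \<Sum>k\<in>UNIV. jac z k i * (\<Sum>l\<in>UNIV. \<zeta> * jac z l j * dz l (B.lee k) (T z) + cnj (\<zeta> * jac z l j) * B.lee_hess k l (T z))
        + d k * \<zeta> * B.lee k (T z))) (at 0)"
    unfolding line0
    by (elim has_derivative_transform_within_open[OF _ W(1,2)]) (simp add: lee_T W(3))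
  \<comment> \<open>\<open>P\<close> is the coefficient of \<open>cnj \<zeta>\<close>. Everything
    complex linear in \<zeta> goes into \<open>Q\<close>, including the derivative \<open>d\<close>
    of the Jacobian, and is discarded.\<close>
  define P where "P = (\<Sum>k\<in>UNIV. \<Sum>l\<in>UNIV. jac z k i * B.lee_hess k l (T z) * cnj (jac z l j))"
  define Q where "Q = (\<Sum>k\<in>UNIV. (\<Sum>l\<in>UNIV. jac z k i * jac z l j * dz l (B.lee k) (T z)) + d k * B.lee k (T z))"
  have "(\<Sum>k\<in>UNIV. jac z k i * (\<Sum>l\<in>UNIV. \<zeta> * jac z l j * dz l (B.lee k) (T z) + cnj (\<zeta> * jac z l j) * B.lee_hess k l (T z))
        + d k * \<zeta> * B.lee k (T z)) = \<zeta> * Q + cnj \<zeta> * P" for \<zeta>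
    unfolding P_def Q_def sum_distrib_left distrib_left sum.distrib[symmetric]
    by (intro sum.cong refl) (simp add: sum.distrib sum_distrib_left algebra_simps)
  then have "((\<lambda>\<zeta>. A.lee i (line \<zeta>)) has_derivative (\<lambda>\<zeta>. \<zeta> * Q + cnj \<zeta> * P)) (at 0)"
    using R by simp
  then have "(\<lambda>\<zeta>. \<zeta> * dz j (A.lee i) z + cnj \<zeta> * A.lee_hess i j z) = (\<lambda>\<zeta>. \<zeta> * Q + cnj \<zeta> * P)"
    by (rule has_derivative_unique[OF L])
  then have "\<zeta> * dz j (A.lee i) z + cnj \<zeta> * A.lee_hess i j z = \<zeta> * Q + cnj \<zeta> * P" for \<zeta>
    by (rule fun_cong)
  then have "(dz j (A.lee i) z - Q) * \<zeta> + (A.lee_hess i j z - P) * cnj \<zeta> = 0" for \<zeta>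
    by (simp add: algebra_simps)
  then have "A.lee_hess i j z - P = 0" by (rule sesquilinear_coeffs_zero(2))
  then show ?thesis by (simp add: P_def)
qed

definition jacT :: "complex^'n \<Rightarrow> complex^'n^'n" where "jacT z = (\<chi> i k. jac z k i)"

definition jacC :: "complex^'n \<Rightarrow> complex^'n^'n" where "jacC z = (\<chi> l j. cnj (jac z l j))"

lemma sandwich_components:
  "(jacT z ** X ** jacC z) $ i $ j = (\<Sum>k\<in>UNIV. \<Sum>l\<in>UNIV. jac z k i * X $ k $ l * cnj (jac z l j))"
proof -
  have "(jacT z ** X ** jacC z) $ i $ j = (\<Sum>l\<in>UNIV. \<Sum>k\<in>UNIV. jac z k i * X $ k $ l * cnj (jac z l j))"
    by (simp add: matrix_matrix_mult_def jacT_def jacC_def sum_distrib_right)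
  then show ?thesis by (subst sum.swap)
qed

lemma inv_h_T:
  assumes z: "z \<in> U"
  shows "matrix_inv (h2 (T z)) = jacC z ** matrix_inv (h1 z) ** jacT z"
proof -
  have h: "h1 z = jacT z ** h2 (T z) ** jacC z"
    by (simp add: vec_eq_iff sandwich_components h_T_components[OF z])
  have "jacT z ** (h2 (T z) ** jacC z ** matrix_inv (h1 z)) = mat 1"
    using matrix_inv_right(1)[OF A.invertible_h[OF in_S(1)[OF z]]] h by (simp add: matrix_mul_assoc)
  \<comment> \<open>A one-sided inverse of a square matrix is two-sided, so the factor
    \<open>jacT z\<close> may be moved from the left end of the product to the right end.
    Invertibility of the Jacobian is thereby obtained from that of the metric.\<close>
  then have 1: "h2 (T z) ** (jacC z ** matrix_inv (h1 z) ** jacT z) = mat 1"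
    using matrix_left_right_inverse by (metis matrix_mul_assoc)
  have "matrix_inv (h2 (T z)) = matrix_inv (h2 (T z)) ** (h2 (T z) ** (jacC z ** matrix_inv (h1 z) ** jacT z))"
    by (simp add: 1)
  also have "\<dots> = jacC z ** matrix_inv (h1 z) ** jacT z"
    using matrix_inv_right(2)[OF B.invertible_h[OF in_S(2)[OF z]]] by (simp add: matrix_mul_assoc)
  finally show ?thesis .
qed

text \<open>Congruence by the Jacobian cancels between the Hessian and the inverse metric by
  cyclicity of the trace. This is the invariance that makes \<mu> a function on the
  manifold.\<close>

lemma lee_trace_T:
  assumes z: "z \<in> U"
  shows "A.lee_trace z = B.lee_trace (T z)"
proof -
  define LA where "LA = (\<chi> k l. A.lee_hess k l z)"
  define LB where "LB = (\<chi> k l. B.lee_hess k l (T z))"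
  have LA: "LA = jacT z ** LB ** jacC z"
    by (simp add: vec_eq_iff sandwich_components LA_def LB_def lee_hess_T[OF z])
  have "A.lee_trace z = trace (LA ** matrix_inv (h1 z))"
    by (simp add: A.lee_trace_def A.inv_h_def LA_def trace_def matrix_matrix_mult_def)
  also have "\<dots> = trace (jacT z ** (LB ** jacC z ** matrix_inv (h1 z)))"
    by (simp add: LA matrix_mul_assoc)
  also have "\<dots> = trace (LB ** (jacC z ** matrix_inv (h1 z) ** jacT z))"
    by (subst trace_mul_sym) (simp add: matrix_mul_assoc)
  also have "\<dots> = B.lee_trace (T z)"
    unfolding inv_h_T[OF z, symmetric]
    by (simp add: B.lee_trace_def B.inv_h_def LB_def trace_def matrix_matrix_mult_def)
  finally show ?thesis .
qed

lemma lee_vec_T: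
  assumes z: "z \<in> U"
  shows "B.lee_vec k (T z) = (\<Sum>i\<in>UNIV. jac z k i * A.lee_vec i z)"
proof -
  have "B.lee_vec k (T z) = (\<Sum>l\<in>UNIV. (\<Sum>i\<in>UNIV. (\<Sum>j\<in>UNIV. cnj (jac z l j) * A.inv_h z j i) * jac z k i) * cnj (B.lee l (T z)))"
    by (simp add: B.lee_vec_def B.inv_h_def inv_h_T[OF z] A.inv_h_def matrix_matrix_mult_def jacC_def jacT_def)
  also have "\<dots> = (\<Sum>l\<in>UNIV. \<Sum>i\<in>UNIV. \<Sum>j\<in>UNIV. jac z k i * (A.inv_h z j i * cnj (jac z l j * B.lee l (T z))))"
    unfolding sum_distrib_right by (intro sum.cong refl) (simp add: mult_ac)
  also have "\<dots> = (\<Sum>i\<in>UNIV. \<Sum>l\<in>UNIV. \<Sum>j\<in>UNIV. jac z k i * (A.inv_h z j i * cnj (jac z l j * B.lee l (T z))))"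
    by (rule sum.swap)
  also have "\<dots> = (\<Sum>i\<in>UNIV. \<Sum>j\<in>UNIV. \<Sum>l\<in>UNIV. jac z k i * (A.inv_h z j i * cnj (jac z l j * B.lee l (T z))))"
    by (rule sum.cong[OF refl sum.swap])
  also have "\<dots> = (\<Sum>i\<in>UNIV. jac z k i * A.lee_vec i z)"
    unfolding A.lee_vec_def lee_T[OF z] cnj_sum sum_distrib_left by (rule refl)
  finally show ?thesis .
qed

lemma dz_T:
  assumes z: "z \<in> U" and u: "u differentiable (at (T z))"
  shows "dz i (\<lambda>x. u (T x)) z = (\<Sum>k\<in>UNIV. jac z k i * dz k u (T z))"
proof -
  have D: "((\<lambda>x. u (T x)) has_derivative (\<lambda>v. frechet_derivative u (at (T z)) (frechet_derivative T (at z) v))) (at z)"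
    using u by (intro has_derivative_compose[OF vec_holomorphic_frechet(1)[OF holo z]]) (simp add: frechet_derivative_works)
  then have diff: "(\<lambda>x. u (T x)) differentiable (at z)" using differentiable_def by blast
  have "frechet_derivative (\<lambda>x. u (T x)) (at z) (axis i \<alpha>) =
    (\<Sum>k\<in>UNIV. \<alpha> * jac z k i * dz k u (T z) + cnj (\<alpha> * jac z k i) * dzbar k u (T z))" for \<alpha>
    unfolding frechet_derivative_at[OF D, symmetric] frechet_derivative_dz[OF u] dT_axis[OF z] ..
  then have "\<alpha> * dz i (\<lambda>x. u (T x)) z + cnj \<alpha> * dzbar i (\<lambda>x. u (T x)) z =
    \<alpha> * (\<Sum>k\<in>UNIV. jac z k i * dz k u (T z)) + cnj \<alpha> * (\<Sum>k\<in>UNIV. cnj (jac z k i) * dzbar k u (T z))" for \<alpha>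
    unfolding frechet_derivative_axis[OF diff] by (simp add: sum.distrib sum_distrib_left mult.assoc)
  then have "(dz i (\<lambda>x. u (T x)) z - (\<Sum>k\<in>UNIV. jac z k i * dz k u (T z))) * \<alpha> +
     (dzbar i (\<lambda>x. u (T x)) z - (\<Sum>k\<in>UNIV. cnj (jac z k i) * dzbar k u (T z))) * cnj \<alpha> = 0" for \<alpha>
    by (simp add: algebra_simps)
  then have "dz i (\<lambda>x. u (T x)) z - (\<Sum>k\<in>UNIV. jac z k i * dz k u (T z)) = 0"
    by (rule sesquilinear_coeffs_zero(1))
  then show ?thesis by simp
qed

text \<open>The Jacobian in the transformation of the vector field is the one that the chain rule
  produces for \<open>u\<close>, so the derivative along the field does not depend on the
  chart.\<close>

lemma lee_vec_dz_T:
  assumes z: "z \<in> U" and u: "u differentiable (at (T z))"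
  shows "(\<Sum>i\<in>UNIV. A.lee_vec i z * dz i (\<lambda>x. u (T x)) z) = (\<Sum>k\<in>UNIV. B.lee_vec k (T z) * dz k u (T z))"
proof -
  have "(\<Sum>i\<in>UNIV. A.lee_vec i z * dz i (\<lambda>x. u (T x)) z) =
    (\<Sum>i\<in>UNIV. \<Sum>k\<in>UNIV. jac z k i * A.lee_vec i z * dz k u (T z))"
    unfolding dz_T[OF assms] sum_distrib_left by (simp add: mult_ac)
  also have "\<dots> = (\<Sum>k\<in>UNIV. \<Sum>i\<in>UNIV. jac z k i * A.lee_vec i z * dz k u (T z))" by (rule sum.swap)
  also have "\<dots> = (\<Sum>k\<in>UNIV. B.lee_vec k (T z) * dz k u (T z))"
    unfolding lee_vec_T[OF z] sum_distrib_right ..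
  finally show ?thesis .
qed

lemma vol_density_T:
  assumes z: "z \<in> U"
  shows "vol_density h1 z = \<bar>det (rmat (frechet_derivative T (at z)))\<bar> * vol_density h2 (T z)"
  by (rule vol_density_pullback[where H = "h1 z" and g = h2 and h = h1])
    (simp_all only: linear_dT[OF z] h_T[OF z])

end

section \<open>Compact locally conformal Kaehler manifolds\<close>

lemma Re_of_real_mult: "Re (complex_of_real x * w) = x * Re w"
  by simp

lemma Ck_on_Un:
  assumes "open S" "open T" "Ck_on k S f" "Ck_on k T f"
  shows "Ck_on k (S \<union> T) f"
  using assms(3,4)
proof (induction k arbitrary: f)
  case 0
  then show ?case using assms(1,2) by (simp add: continuous_on_open_Un)
next
  case (Suc k)
  then show ?case by simp blast
qed

definition zext :: "'v set \<Rightarrow> ('v \<Rightarrow> real) \<Rightarrow> 'v \<Rightarrow> real" where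
  "zext S F z = (if z \<in> S then F z else 0)"

text \<open>The open sets \<open>S\<close> and \<open>- L\<close> cover the space; on the first the
  extension is \<open>F\<close>, on the second it is zero.\<close>

lemma Ck_on_zext:
  fixes S :: "(complex^'n) set"
  assumes S: "open S" and L: "compact L" "L \<subseteq> S" and F: "Ck_on k S F" "\<And>z. z \<in> S - L \<Longrightarrow> F z = 0"
  shows "Ck_on k UNIV (zext S F)"
proof -
  have "open (- L)" by (rule open_Compl[OF compact_imp_closed[OF L(1)]])
  have "Ck_on k (S \<union> - L) (zext S F)"
  proof (rule Ck_on_Un[OF S \<open>open (- L)\<close>])
    show "Ck_on k S (zext S F)"
      using F(1) by (subst Ck_on_cong[OF S, of _ F]) (simp_all add: zext_def)
    show "Ck_on k (- L) (zext S F)"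
      using F(2) by (subst Ck_on_cong[OF \<open>open (- L)\<close>, of _ "\<lambda>z. 0"]) (auto simp: zext_def Ck_on_const)
  qed
  moreover have "S \<union> - L = UNIV" using L(2) by blast
  ultimately show ?thesis by simp
qed

lemma test_fun_zext:
  fixes S :: "(complex^'n::finite) set"
  assumes "open S" "compact L" "L \<subseteq> S" "continuous_on S F" "\<And>z. z \<in> S - L \<Longrightarrow> F z = 0"
  shows "test_fun (zext S F)"
proof -
  have "continuous_on UNIV (zext S F)"
    using Ck_on_zext[of S L 0 F] assms by simp
  moreover have "zext S F z = 0" if "z \<notin> L" for z
    using assms(5) that by (simp add: zext_def)
  ultimately show ?thesis unfolding test_fun_def using assms(2) by blast
qed

context local_lck_hsc
begin

text \<open>An ODE-type uniqueness argument: on a small ball the maximum \<open>m\<close> of \<open>\<bar>\<mu>\<bar>\<close> satisfies \<open>m \<le> m / 2\<close>.\<close>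

lemma mu_zero_open:
  assumes z: "z \<in> S" "mu z = 0"
  obtains r where "r > 0" "ball z r \<subseteq> S" "\<And>y. y \<in> ball z r \<Longrightarrow> mu y = 0"
proof -
  obtain r0 where r0: "r0 > 0" "cball z r0 \<subseteq> S" using open_S z(1) open_contains_cball by blast
  \<comment> \<open>The sum over the real basis bounds the operator norm of
    \<open>\<theta> y\<close> and is continuous in \<open>y\<close>, so it is bounded on the closed
    ball.\<close>
  define N where "N y = (\<Sum>b\<in>Basis. \<bar>\<theta> y b\<bar>)" for y
  have "continuous_on S N" unfolding N_def
    by (intro continuous_intros smooth_onD(3)[OF smooth_\<theta>])
  then have "continuous_on (cball z r0) N" using r0(2) continuous_on_subset by blast
  then have "bounded (N ` cball z r0)" by (intro compact_imp_bounded compact_continuous_image compact_cball)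
  then obtain K where K: "K > 0" "\<And>y. y \<in> cball z r0 \<Longrightarrow> N y \<le> K"
    unfolding bounded_pos by force
  have \<theta>N: "\<bar>\<theta> y v\<bar> \<le> K * norm v" if y: "y \<in> cball z r0" for y v
  proof -
    have L: "linear (\<theta> y)" using linear_\<theta> y r0(2) by blast
    have "\<theta> y v = (\<Sum>b\<in>Basis. (v \<bullet> b) *\<^sub>R \<theta> y b)"
      by (subst euclidean_representation[of v, symmetric]) (simp only: linear_sum[OF L] linear_scale[OF L])
    then have "\<bar>\<theta> y v\<bar> \<le> (\<Sum>b\<in>Basis. \<bar>v \<bullet> b\<bar> * \<bar>\<theta> y b\<bar>)"
      by (simp only:) (rule order.trans[OF sum_abs], simp add: abs_mult)
    also have "\<dots> \<le> (\<Sum>b\<in>Basis. norm v * \<bar>\<theta> y b\<bar>)"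
      by (intro sum_mono mult_right_mono Basis_le_norm) auto
    also have "\<dots> = N y * norm v" by (simp add: N_def sum_distrib_left mult.commute)
    also have "\<dots> \<le> K * norm v" using K(2)[OF y] by (rule mult_right_mono) simp
    finally show ?thesis .
  qed
  define r where "r = min r0 (1 / (2 * K))"
  have r: "r > 0" "r \<le> r0" "K * r \<le> 1 / 2" using r0 K(1) by (auto simp: r_def min_def field_simps)
  have sub: "cball z r \<subseteq> cball z r0" using r(2) by (rule subset_cball)
  have inS: "y \<in> S" if "y \<in> cball z r" for y using that sub r0(2) by blast
  have "continuous_on (cball z r) (\<lambda>y. \<bar>mu y\<bar>)"
    by (intro continuous_intros continuous_at_imp_continuous_on ballI)
       (rule has_derivative_continuous[OF mu_has_derivative[OF inS]])
  then obtain y1 where y1: "y1 \<in> cball z r" "\<And>y. y \<in> cball z r \<Longrightarrow> \<bar>mu y\<bar> \<le> \<bar>mu y1\<bar>"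
    using continuous_attains_sup[of "cball z r" "\<lambda>y. \<bar>mu y\<bar>"] r(1) by auto
  have "norm (mu y1 - mu z) \<le> (K * \<bar>mu y1\<bar>) * norm (y1 - z)"
  proof (rule differentiable_bound[OF convex_cball[of z r]])
    show "(mu has_derivative (\<lambda>v. - mu y * \<theta> y v)) (at y within cball z r)" if "y \<in> cball z r" for y
      by (rule has_derivative_at_withinI[OF mu_has_derivative[OF inS[OF that]]])
    show "onorm (\<lambda>v. - mu y * \<theta> y v) \<le> K * \<bar>mu y1\<bar>" if "y \<in> cball z r" for y
    proof (rule onorm_le)
      fix v
      have "norm (- mu y * \<theta> y v) = \<bar>mu y\<bar> * \<bar>\<theta> y v\<bar>" by (simp add: abs_mult)
      also have "\<dots> \<le> \<bar>mu y1\<bar> * (K * norm v)"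
        using y1(2)[OF that] \<theta>N[of y v] that sub by (intro mult_mono) auto
      finally show "norm (- mu y * \<theta> y v) \<le> K * \<bar>mu y1\<bar> * norm v" by (simp add: mult_ac)
    qed
  qed (use y1 r in auto)
  also have "\<dots> \<le> (K * \<bar>mu y1\<bar>) * r"
    using y1(1) K(1) by (intro mult_left_mono) (auto simp: dist_norm norm_minus_commute)
  also have "\<dots> = (K * r) * \<bar>mu y1\<bar>" by simp
  also have "\<dots> \<le> 1 / 2 * \<bar>mu y1\<bar>" using r(3) by (rule mult_right_mono) simp
  finally have "\<bar>mu y1\<bar> \<le> 0" using z(2) by simp
  then have zero: "mu y = 0" if "y \<in> cball z r" for y using y1(2)[OF that] by linarith
  show thesis
    by (rule that[of r]) (use r(1) inS zero in auto)
qed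

end

section \<open>Charts and transition maps of the compact manifold\<close>

locale lck_manifold =
  fixes M :: "'a topology" and A :: "('a, 'n::finite) chart set"
    and h :: "('a, 'n) chart \<Rightarrow> 'n local_metric" and \<theta> :: "('a, 'n) chart \<Rightarrow> ('n, real) form1"
    and c :: "'a \<Rightarrow> real"
  assumes card: "CARD('n) \<ge> 2" and manifold: "complex_manifold M A" and compact_M: "compact_space M"
    and metric: "hermitian_metric A h" and one_form: "real_one_form A \<theta>" and closed: "closed_one_form A \<theta>"
    and lck_eq: "\<And>\<phi> z u v w. \<phi> \<in> A \<Longrightarrow> z \<in> chart_image \<phi> \<Longrightarrow>
      ext_d2 (fundamental_form (h \<phi>)) z u v w = wedge12 (\<theta> \<phi>) (fundamental_form (h \<phi>)) z u v w"
    and c_nonpos: "\<And>p. p \<in> topspace M \<Longrightarrow> c p \<le> 0"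
    and curvature: "pointwise_hol_sect_curv A h c"
begin

lemma chart:
  assumes "\<phi> \<in> A"
  shows "openin M (fst \<phi>)" "open (chart_image \<phi>)"
    "homeomorphic_map (subtopology M (fst \<phi>)) (top_of_set (chart_image \<phi>)) (snd \<phi>)"
  using manifold assms unfolding complex_manifold_def chart_on_def by blast+

lemma fst_subset: "\<phi> \<in> A \<Longrightarrow> fst \<phi> \<subseteq> topspace M"
  using chart(1) openin_subset by blast

lemma topspace_chart: "\<phi> \<in> A \<Longrightarrow> topspace (subtopology M (fst \<phi>)) = fst \<phi>"
  by (simp add: Int_absorb1 fst_subset)

lemma inj_chart: "\<phi> \<in> A \<Longrightarrow> inj_on (snd \<phi>) (fst \<phi>)"
  using homeomorphic_imp_injective_map[OF chart(3)] topspace_chart by simp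

lemma chart_inv_left: "\<phi> \<in> A \<Longrightarrow> p \<in> fst \<phi> \<Longrightarrow> chart_inv \<phi> (snd \<phi> p) = p"
  unfolding chart_inv_def by (rule inv_into_f_f[OF inj_chart])

lemma chart_inv_in: "z \<in> chart_image \<phi> \<Longrightarrow> chart_inv \<phi> z \<in> fst \<phi>"
  unfolding chart_inv_def chart_image_def by (rule inv_into_into)

lemma chart_inv_right: "z \<in> chart_image \<phi> \<Longrightarrow> snd \<phi> (chart_inv \<phi> z) = z"
  unfolding chart_inv_def chart_image_def by (rule f_inv_into_f)

lemma chart_image_mem: "p \<in> fst \<phi> \<Longrightarrow> snd \<phi> p \<in> chart_image \<phi>"
  unfolding chart_image_def by (rule imageI)

lemma chart_image_mono: "K \<subseteq> fst \<phi> \<Longrightarrow> snd \<phi> ` K \<subseteq> chart_image \<phi>"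
  unfolding chart_image_def by (rule image_mono)

lemma chart_inv_topspace: "\<phi> \<in> A \<Longrightarrow> z \<in> chart_image \<phi> \<Longrightarrow> chart_inv \<phi> z \<in> topspace M"
  using chart_inv_in fst_subset by blast

lemma chart_cover: "p \<in> topspace M \<Longrightarrow> \<exists>\<phi>\<in>A. p \<in> fst \<phi>"
  using manifold unfolding complex_manifold_def by blast

lemma open_image_chart:
  assumes \<phi>: "\<phi> \<in> A" and W: "openin M W"
  shows "open (snd \<phi> ` (fst \<phi> \<inter> W))"
proof -
  have "openin (subtopology M (fst \<phi>)) (fst \<phi> \<inter> W)"
    using W by (auto simp: openin_subtopology)
  then have "openin (top_of_set (chart_image \<phi>)) (snd \<phi> ` (fst \<phi> \<inter> W))"
    using homeomorphic_imp_open_map[OF chart(3)[OF \<phi>]] unfolding open_map_def by blast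
  then show ?thesis using chart(2)[OF \<phi>] openin_open_trans by blast
qed

lemma open_preimage_chart:
  assumes \<phi>: "\<phi> \<in> A" and V: "open V"
  shows "openin M {p \<in> fst \<phi>. snd \<phi> p \<in> V}"
proof -
  have "continuous_map (subtopology M (fst \<phi>)) (top_of_set (chart_image \<phi>)) (snd \<phi>)"
    by (rule homeomorphic_imp_continuous_map[OF chart(3)[OF \<phi>]])
  moreover have "openin (top_of_set (chart_image \<phi>)) (chart_image \<phi> \<inter> V)"
    using V by (simp add: openin_open_Int)
  ultimately have "openin (subtopology M (fst \<phi>)) {p \<in> topspace (subtopology M (fst \<phi>)). snd \<phi> p \<in> chart_image \<phi> \<inter> V}"
    by (rule openin_continuous_map_preimage)
  moreover have "{p \<in> topspace (subtopology M (fst \<phi>)). snd \<phi> p \<in> chart_image \<phi> \<inter> V} = {p \<in> fst \<phi>. snd \<phi> p \<in> V}"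
    using topspace_chart[OF \<phi>] chart_image_mem[of _ \<phi>] by auto
  ultimately show ?thesis using chart(1)[OF \<phi>] openin_trans_full by auto
qed

lemma compact_image_chart:
  assumes \<phi>: "\<phi> \<in> A" and K: "compactin M K" "K \<subseteq> fst \<phi>"
  shows "compact (snd \<phi> ` K)"
proof -
  have "compactin (subtopology M (fst \<phi>)) K" using K by (simp add: compactin_subtopology)
  then have "compactin (top_of_set (chart_image \<phi>)) (snd \<phi> ` K)"
    by (rule image_compactin[OF _ homeomorphic_imp_continuous_map[OF chart(3)[OF \<phi>]]])
  then show ?thesis by (simp add: compactin_subtopology)
qed

lemma compact_inv_chart:
  assumes \<phi>: "\<phi> \<in> A" and K: "compact K" "K \<subseteq> chart_image \<phi>"
  shows "compactin M (chart_inv \<phi> ` K)"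
proof -
  obtain g where g: "homeomorphic_maps (subtopology M (fst \<phi>)) (top_of_set (chart_image \<phi>)) (snd \<phi>) g"
    using chart(3)[OF \<phi>] homeomorphic_map_maps by blast
  have "chart_inv \<phi> z = g z" if "z \<in> chart_image \<phi>" for z
  proof -
    have "g (snd \<phi> (chart_inv \<phi> z)) = chart_inv \<phi> z"
      using g chart_inv_in[OF that] topspace_chart[OF \<phi>] unfolding homeomorphic_maps_def by simp
    then show ?thesis using chart_inv_right[OF that] by simp
  qed
  then have "chart_inv \<phi> ` K = g ` K" using K(2) by (intro image_cong) auto
  moreover have "compactin (top_of_set (chart_image \<phi>)) K" using K by (simp add: compactin_subtopology)
  then have "compactin (subtopology M (fst \<phi>)) (g ` K)"
    using image_compactin g unfolding homeomorphic_maps_def by blast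
  ultimately show ?thesis by (simp add: compactin_subtopology)
qed

lemma closed_compactin: "compactin M K \<Longrightarrow> closedin M K"
  using manifold compactin_imp_closedin unfolding complex_manifold_def by blast

lemma overlap_props:
  assumes \<phi>: "\<phi> \<in> A" and \<psi>: "\<psi> \<in> A"
  shows "open (overlap \<phi> \<psi>)" "overlap \<phi> \<psi> \<subseteq> chart_image \<phi>"
    "\<And>z. z \<in> overlap \<phi> \<psi> \<longleftrightarrow> z \<in> chart_image \<phi> \<and> chart_inv \<phi> z \<in> fst \<psi>"
proof -
  show "open (overlap \<phi> \<psi>)" unfolding overlap_def by (rule open_image_chart[OF \<phi> chart(1)[OF \<psi>]])
  show "overlap \<phi> \<psi> \<subseteq> chart_image \<phi>" unfolding overlap_def chart_image_def by blast
  show "z \<in> overlap \<phi> \<psi> \<longleftrightarrow> z \<in> chart_image \<phi> \<and> chart_inv \<phi> z \<in> fst \<psi>" for z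
  proof
    assume "z \<in> overlap \<phi> \<psi>"
    then obtain p where "p \<in> fst \<phi>" "p \<in> fst \<psi>" "z = snd \<phi> p" unfolding overlap_def by blast
    then show "z \<in> chart_image \<phi> \<and> chart_inv \<phi> z \<in> fst \<psi>"
      using chart_inv_left[OF \<phi>] chart_image_mem[of p \<phi>] by auto
  next
    assume z: "z \<in> chart_image \<phi> \<and> chart_inv \<phi> z \<in> fst \<psi>"
    then have "snd \<phi> (chart_inv \<phi> z) \<in> overlap \<phi> \<psi>"
      unfolding overlap_def using chart_inv_in by blast
    then show "z \<in> overlap \<phi> \<psi>" using z chart_inv_right[of z \<phi>] by simp
  qed
qed

lemma transition_props:
  assumes \<phi>: "\<phi> \<in> A" and \<psi>: "\<psi> \<in> A" and z: "z \<in> overlap \<phi> \<psi>"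
  shows "chart_inv \<psi> (transition \<phi> \<psi> z) = chart_inv \<phi> z" "transition \<phi> \<psi> z \<in> overlap \<psi> \<phi>"
    "transition \<psi> \<phi> (transition \<phi> \<psi> z) = z" "transition \<phi> \<psi> z \<in> chart_image \<psi>"
proof -
  have z': "z \<in> chart_image \<phi>" "chart_inv \<phi> z \<in> fst \<psi>" using z overlap_props(3)[OF \<phi> \<psi>] by auto
  show 1: "chart_inv \<psi> (transition \<phi> \<psi> z) = chart_inv \<phi> z"
    using chart_inv_left[OF \<psi> z'(2)] by (simp add: transition_def)
  show 2: "transition \<phi> \<psi> z \<in> chart_image \<psi>"
    using chart_image_mem[OF z'(2)] by (simp add: transition_def)
  show "transition \<phi> \<psi> z \<in> overlap \<psi> \<phi>"
    using 1 2 chart_inv_in[OF z'(1)] overlap_props(3)[OF \<psi> \<phi>] by simp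
  show "transition \<psi> \<phi> (transition \<phi> \<psi> z) = z"
    using 1 chart_inv_right[OF z'(1)] by (simp add: transition_def)
qed

lemma transition_image:
  assumes \<phi>: "\<phi> \<in> A" and \<psi>: "\<psi> \<in> A"
  shows "transition \<phi> \<psi> ` overlap \<phi> \<psi> = overlap \<psi> \<phi>" "inj_on (transition \<phi> \<psi>) (overlap \<phi> \<psi>)"
proof -
  show "transition \<phi> \<psi> ` overlap \<phi> \<psi> = overlap \<psi> \<phi>"
  proof
    show "transition \<phi> \<psi> ` overlap \<phi> \<psi> \<subseteq> overlap \<psi> \<phi>" using transition_props(2)[OF \<phi> \<psi>] by blast
    show "overlap \<psi> \<phi> \<subseteq> transition \<phi> \<psi> ` overlap \<phi> \<psi>"
    proof
      fix z assume z: "z \<in> overlap \<psi> \<phi>"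
      show "z \<in> transition \<phi> \<psi> ` overlap \<phi> \<psi>"
        using transition_props(2,3)[OF \<psi> \<phi> z] by (intro image_eqI[of _ _ "transition \<psi> \<phi> z"]) simp_all
    qed
  qed
  show "inj_on (transition \<phi> \<psi>) (overlap \<phi> \<psi>)"
    by (rule inj_on_inverseI) (rule transition_props(3)[OF \<phi> \<psi>])
qed

lemma local_hsc:
  assumes \<phi>: "\<phi> \<in> A"
  shows "local_lck_hsc (chart_image \<phi>) (h \<phi>) (\<theta> \<phi>) (\<lambda>z. c (chart_inv \<phi> z))"
proof (intro local_lck_hsc.intro local_lck.intro local_lck_hsc_axioms.intro)
  show "open (chart_image \<phi>)" by (rule chart(2)[OF \<phi>])
  show "smooth_on (chart_image \<phi>) (\<lambda>z. h \<phi> z $ i $ j)" for i j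
    using metric \<phi> unfolding hermitian_metric_def by blast
  show "h \<phi> z $ j $ i = cnj (h \<phi> z $ i $ j)" if "z \<in> chart_image \<phi>" for z i j
    using metric \<phi> that unfolding hermitian_metric_def by blast
  show "0 < Re (herm (h \<phi> z) X X)" if "z \<in> chart_image \<phi>" "X \<noteq> 0" for z X
    using metric \<phi> that unfolding hermitian_metric_def by blast
  show "linear (\<theta> \<phi> z)" if "z \<in> chart_image \<phi>" for z
    using one_form \<phi> that unfolding real_one_form_def by blast
  show "smooth_on (chart_image \<phi>) (\<lambda>z. \<theta> \<phi> z v)" for v
    using one_form \<phi> unfolding real_one_form_def by blast
  show "ext_d1 (\<theta> \<phi>) z u v = 0" if "z \<in> chart_image \<phi>" for z u v
    using closed \<phi> that unfolding closed_one_form_def by blast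
  show "ext_d2 (fundamental_form (h \<phi>)) z u v w = wedge12 (\<theta> \<phi>) (fundamental_form (h \<phi>)) z u v w"
    if "z \<in> chart_image \<phi>" for z u v w
    by (rule lck_eq[OF \<phi> that])
  show "hol_sect_curv (h \<phi>) z X = complex_of_real (c (chart_inv \<phi> z))"
    if "z \<in> chart_image \<phi>" "X \<noteq> 0" for z X
  proof -
    have "hol_sect_curv (h \<phi>) (snd \<phi> (chart_inv \<phi> z)) X = complex_of_real (c (chart_inv \<phi> z))"
      using curvature \<phi> chart_inv_in[OF that(1)] that(2) unfolding pointwise_hol_sect_curv_def by blast
    then show ?thesis using chart_inv_right[OF that(1)] by simp
  qed
  show "2 \<le> CARD('n)" by (rule card)
qed

lemma local: "\<phi> \<in> A \<Longrightarrow> local_lck (chart_image \<phi>) (h \<phi>) (\<theta> \<phi>)"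
  using local_hsc local_lck_hsc.axioms(1) by blast

lemma transition_lck:
  assumes \<phi>: "\<phi> \<in> A" and \<psi>: "\<psi> \<in> A"
  shows "lck_transition (chart_image \<phi>) (chart_image \<psi>) (h \<phi>) (h \<psi>) (\<theta> \<phi>) (\<theta> \<psi>) (transition \<phi> \<psi>) (overlap \<phi> \<psi>)"
proof (intro lck_transition.intro local \<phi> \<psi> lck_transition_axioms.intro)
  show "open (overlap \<phi> \<psi>)" "overlap \<phi> \<psi> \<subseteq> chart_image \<phi>" by (rule overlap_props[OF \<phi> \<psi>])+
  show "transition \<phi> \<psi> ` overlap \<phi> \<psi> \<subseteq> chart_image \<psi>" using transition_props(4)[OF \<phi> \<psi>] by blast
  show "vec_holomorphic_on (transition \<phi> \<psi>) (overlap \<phi> \<psi>)"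
    using manifold \<phi> \<psi> unfolding complex_manifold_def by blast
  show "\<theta> \<phi> z v = \<theta> \<psi> (transition \<phi> \<psi> z) (frechet_derivative (transition \<phi> \<psi>) (at z) v)"
    if "z \<in> overlap \<phi> \<psi>" for z v
    using one_form \<phi> \<psi> that unfolding real_one_form_def by blast
  show "herm (h \<phi> z) u v = herm (h \<psi> (transition \<phi> \<psi> z))
      (frechet_derivative (transition \<phi> \<psi>) (at z) u) (frechet_derivative (transition \<phi> \<psi>) (at z) v)"
    if "z \<in> overlap \<phi> \<psi>" for z u v
    using metric \<phi> \<psi> that unfolding hermitian_metric_def by blast
qed

section \<open>The global function \<mu> and its zero set\<close>

abbreviation "lmu \<phi> \<equiv> local_lck_hsc.mu (h \<phi>) (\<theta> \<phi>) (\<lambda>z. c (chart_inv \<phi> z))"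
abbreviation "ltrace \<phi> \<equiv> local_lck.lee_trace (h \<phi>) (\<theta> \<phi>)"
abbreviation "llee \<phi> \<equiv> local_lck.lee (\<theta> \<phi>)"
abbreviation "lvec \<phi> \<equiv> local_lck.lee_vec (h \<phi>) (\<theta> \<phi>)"

definition gmu :: "'a \<Rightarrow> real" where
  "gmu p = (let \<phi> = SOME \<phi>. \<phi> \<in> A \<and> p \<in> fst \<phi> in lmu \<phi> (snd \<phi> p))"

text \<open>The arbitrary choice of a chart in \<open>gmu\<close> is harmless:
  \<open>lee_trace\<close> is invariant under transitions, and \<open>c\<close> is already a
  function on the manifold.\<close>

lemma gmu_chart:
  assumes \<phi>: "\<phi> \<in> A" and z: "z \<in> chart_image \<phi>"
  shows "gmu (chart_inv \<phi> z) = lmu \<phi> z"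
proof -
  define p where "p = chart_inv \<phi> z"
  define \<psi> where "\<psi> = (SOME \<psi>. \<psi> \<in> A \<and> p \<in> fst \<psi>)"
  have "\<exists>\<psi>. \<psi> \<in> A \<and> p \<in> fst \<psi>" using \<phi> chart_inv_in[OF z] by (intro exI[of _ \<phi>]) (simp add: p_def)
  then have \<psi>: "\<psi> \<in> A" "p \<in> fst \<psi>" unfolding \<psi>_def by (metis (mono_tags, lifting) someI_ex)+
  have zo: "z \<in> overlap \<phi> \<psi>" using overlap_props(3)[OF \<phi> \<psi>(1)] z \<psi>(2) by (simp add: p_def)
  have "ltrace \<phi> z = ltrace \<psi> (transition \<phi> \<psi> z)"
    by (rule lck_transition.lee_trace_T[OF transition_lck[OF \<phi> \<psi>(1)] zo])
  then have "lmu \<phi> z = lmu \<psi> (transition \<phi> \<psi> z)"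
    using transition_props(1)[OF \<phi> \<psi>(1) zo]
    by (simp add: local_lck_hsc.mu_def[OF local_hsc[OF \<phi>]] local_lck_hsc.mu_def[OF local_hsc[OF \<psi>(1)]])
  moreover have "gmu p = lmu \<psi> (snd \<psi> p)" by (simp add: gmu_def \<psi>_def Let_def)
  moreover have "transition \<phi> \<psi> z = snd \<psi> p" by (simp add: transition_def p_def)
  ultimately show ?thesis by (simp add: p_def)
qed

definition zeros :: "'a set" where "zeros = {p \<in> topspace M. gmu p = 0}"

lemma openin_zeros: "openin M zeros"
proof (subst openin_subopen, intro ballI)
  fix p assume p: "p \<in> zeros"
  then have "p \<in> topspace M" by (simp add: zeros_def)
  then obtain \<phi> where \<phi>: "\<phi> \<in> A" "p \<in> fst \<phi>" using chart_cover by blast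
  have zp: "snd \<phi> p \<in> chart_image \<phi>" by (rule chart_image_mem[OF \<phi>(2)])
  have "lmu \<phi> (snd \<phi> p) = 0"
    using gmu_chart[OF \<phi>(1) zp] p chart_inv_left[OF \<phi>] by (simp add: zeros_def)
  then obtain r where r: "r > 0" "ball (snd \<phi> p) r \<subseteq> chart_image \<phi>"
    "\<And>y. y \<in> ball (snd \<phi> p) r \<Longrightarrow> lmu \<phi> y = 0"
    using local_lck_hsc.mu_zero_open[OF local_hsc[OF \<phi>(1)] zp] by metis
  let ?W = "{q \<in> fst \<phi>. snd \<phi> q \<in> ball (snd \<phi> p) r}"
  have "?W \<subseteq> zeros"
  proof
    fix q assume q: "q \<in> ?W"
    then have "gmu q = lmu \<phi> (snd \<phi> q)"
      using gmu_chart[OF \<phi>(1) chart_image_mem] chart_inv_left[OF \<phi>(1)] by force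
    then show "q \<in> zeros" using r(3) q fst_subset[OF \<phi>(1)] by (auto simp: zeros_def)
  qed
  moreover have "p \<in> ?W" using \<phi>(2) r(1) by simp
  moreover have "openin M ?W" by (rule open_preimage_chart[OF \<phi>(1) open_ball])
  ultimately show "\<exists>T. openin M T \<and> p \<in> T \<and> T \<subseteq> zeros" by blast
qed

lemma continuous_lmu: "\<phi> \<in> A \<Longrightarrow> continuous_on (chart_image \<phi>) (lmu \<phi>)"
  by (intro continuous_at_imp_continuous_on ballI)
     (rule has_derivative_continuous[OF local_lck_hsc.mu_has_derivative[OF local_hsc]])

lemma openin_nonzeros: "openin M (topspace M - zeros)"
proof (subst openin_subopen, intro ballI)
  fix p assume p: "p \<in> topspace M - zeros"
  then obtain \<phi> where \<phi>: "\<phi> \<in> A" "p \<in> fst \<phi>" using chart_cover by blast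
  let ?V = "{z \<in> chart_image \<phi>. lmu \<phi> z \<in> - {0}}"
  have "open ?V"
  proof -
    have "open (chart_image \<phi> \<inter> lmu \<phi> -` (- {0}))"
      by (rule continuous_open_preimage[OF continuous_lmu[OF \<phi>(1)] chart(2)[OF \<phi>(1)]]) (simp add: open_Compl)
    moreover have "?V = chart_image \<phi> \<inter> lmu \<phi> -` (- {0})" by blast
    ultimately show ?thesis by simp
  qed
  let ?W = "{q \<in> fst \<phi>. snd \<phi> q \<in> ?V}"
  have gm: "gmu q = lmu \<phi> (snd \<phi> q)" if "q \<in> fst \<phi>" for q
    using gmu_chart[OF \<phi>(1) chart_image_mem[OF that]] chart_inv_left[OF \<phi>(1) that] by simp
  have "?W \<subseteq> topspace M - zeros"
    using gm fst_subset[OF \<phi>(1)] by (auto simp: zeros_def)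
  moreover have "p \<in> ?W"
    using p gm[OF \<phi>(2)] chart_image_mem[OF \<phi>(2)] \<phi>(2) by (auto simp: zeros_def)
  moreover have "openin M ?W" by (rule open_preimage_chart[OF \<phi>(1) \<open>open ?V\<close>])
  ultimately show "\<exists>T. openin M T \<and> p \<in> T \<and> T \<subseteq> topspace M - zeros" by blast
qed

section \<open>Continuously differentiable functions and their derivative along the Lee
  field\<close>

definition C1 :: "('a \<Rightarrow> real) \<Rightarrow> bool" where
  "C1 g \<longleftrightarrow> (\<forall>\<phi>\<in>A. Ck_on 1 (chart_image \<phi>) (\<lambda>z. g (chart_inv \<phi> z)))"

lemma C1_D:
  assumes "C1 g" "\<phi> \<in> A"
  shows "Ck_on 1 (chart_image \<phi>) (\<lambda>z. g (chart_inv \<phi> z))"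
    "continuous_on (chart_image \<phi>) (\<lambda>z. g (chart_inv \<phi> z))"
    "z \<in> chart_image \<phi> \<Longrightarrow> (\<lambda>z. g (chart_inv \<phi> z)) differentiable (at z)"
proof -
  show 1: "Ck_on 1 (chart_image \<phi>) (\<lambda>z. g (chart_inv \<phi> z))" using assms by (simp add: C1_def)
  show "continuous_on (chart_image \<phi>) (\<lambda>z. g (chart_inv \<phi> z))"
    using Ck_on_SucD[of 0] 1 by (simp del: Ck_on.simps(2) add: Ck_on.simps(1)[symmetric] del: Ck_on.simps(1))
  show "z \<in> chart_image \<phi> \<Longrightarrow> (\<lambda>z. g (chart_inv \<phi> z)) differentiable (at z)" using 1 by simp
qed

lemma C1_mult: "C1 f \<Longrightarrow> C1 g \<Longrightarrow> C1 (\<lambda>p. f p * g p)"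
  unfolding C1_def by (intro ballI Ck_on_mult chart(2)) blast+

lemma C1_sum: "(\<And>i. i \<in> I \<Longrightarrow> C1 (g i)) \<Longrightarrow> C1 (\<lambda>p. \<Sum>i\<in>I. g i p)"
proof (induction I rule: infinite_finite_induct)
  case (insert x I)
  then have "C1 (\<lambda>p. g x p + (\<Sum>i\<in>I. g i p))"
    unfolding C1_def using chart(2) by (intro ballI Ck_on_add) auto
  then show ?case using insert by simp
qed (simp_all add: C1_def Ck_on_const del: Ck_on.simps)

lemma C1_inverse: "C1 g \<Longrightarrow> (\<And>p. p \<in> topspace M \<Longrightarrow> g p \<noteq> 0) \<Longrightarrow> C1 (\<lambda>p. inverse (g p))"
  unfolding C1_def using chart_inv_topspace by (intro ballI Ck_on_inverse chart(2)) blast+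

text \<open>The zero set and its complement are both open, so every chart splits into two open
  pieces on which the indicator is constant. Cutting off to \<open>zeros\<close> therefore costs no
  differentiability and adds no derivative.\<close>

lemma indicator_zeros_local:
  assumes \<phi>: "\<phi> \<in> A"
  obtains U1 U2 where "open U1" "open U2" "chart_image \<phi> = U1 \<union> U2"
    "\<And>z. z \<in> U1 \<Longrightarrow> chart_inv \<phi> z \<in> zeros" "\<And>z. z \<in> U2 \<Longrightarrow> chart_inv \<phi> z \<notin> zeros"
proof
  let ?U1 = "snd \<phi> ` (fst \<phi> \<inter> zeros)" let ?U2 = "snd \<phi> ` (fst \<phi> \<inter> (topspace M - zeros))"
  show "open ?U1" by (rule open_image_chart[OF \<phi> openin_zeros])
  show "open ?U2" by (rule open_image_chart[OF \<phi> openin_nonzeros])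
  show "chart_image \<phi> = ?U1 \<union> ?U2" unfolding chart_image_def using fst_subset[OF \<phi>] by blast
  show "chart_inv \<phi> z \<in> zeros" if "z \<in> ?U1" for z using that chart_inv_left[OF \<phi>] by auto
  show "chart_inv \<phi> z \<notin> zeros" if "z \<in> ?U2" for z using that chart_inv_left[OF \<phi>] by auto
qed

lemma C1_indicator_zeros: "C1 (\<lambda>p. of_bool (p \<in> zeros))"
  unfolding C1_def
proof
  fix \<phi> assume \<phi>: "\<phi> \<in> A"
  obtain U1 U2 where U: "open U1" "open U2" "chart_image \<phi> = U1 \<union> U2"
    "\<And>z. z \<in> U1 \<Longrightarrow> chart_inv \<phi> z \<in> zeros" "\<And>z. z \<in> U2 \<Longrightarrow> chart_inv \<phi> z \<notin> zeros"
    by (rule indicator_zeros_local[OF \<phi>]) (rule that)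
  show "Ck_on 1 (chart_image \<phi>) (\<lambda>z. of_bool (chart_inv \<phi> z \<in> zeros))"
    unfolding U(3)
  proof (rule Ck_on_Un[OF U(1,2)])
    show "Ck_on 1 U1 (\<lambda>z. of_bool (chart_inv \<phi> z \<in> zeros))"
      by (subst Ck_on_cong[OF U(1), of _ "\<lambda>z. 1"]) (simp_all add: U(4) Ck_on_const del: Ck_on.simps)
    show "Ck_on 1 U2 (\<lambda>z. of_bool (chart_inv \<phi> z \<in> zeros))"
      by (subst Ck_on_cong[OF U(2), of _ "\<lambda>z. 0"]) (simp_all add: U(5) Ck_on_const del: Ck_on.simps)
  qed
qed

text \<open>The derivative of \<open>g\<close> along the vector field dual to the Lee form, and the divergence of that
  field with respect to the density \<open>dens\<close>; see \<open>divergence_lee_vec\<close>.\<close>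

definition lie :: "('a, 'n) chart \<Rightarrow> ('a \<Rightarrow> real) \<Rightarrow> complex^'n \<Rightarrow> real" where
  "lie \<phi> g z = Re (\<Sum>i\<in>UNIV. lvec \<phi> i z * dz i (\<lambda>x. complex_of_real (g (chart_inv \<phi> x))) z)"

definition divg :: "('a, 'n) chart \<Rightarrow> complex^'n \<Rightarrow> real" where
  "divg \<phi> z = Re (ltrace \<phi> z + (of_nat CARD('n) - 1) * (\<Sum>i\<in>UNIV. llee \<phi> i z * lvec \<phi> i z))"

abbreviation "dens \<phi> \<equiv> vol_density (h \<phi>)"

lemma differentiable_of_real_C1:
  assumes "C1 g" "\<phi> \<in> A" "z \<in> chart_image \<phi>"
  shows "(\<lambda>x. complex_of_real (g (chart_inv \<phi> x))) differentiable (at z)"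
  using C1_D(3)[OF assms] bounded_linear.has_derivative[OF bounded_linear_of_real]
  unfolding differentiable_def by blast

lemma lie_transition:
  assumes g: "C1 g" and \<phi>: "\<phi> \<in> A" and \<psi>: "\<psi> \<in> A" and z: "z \<in> overlap \<phi> \<psi>"
  shows "lie \<phi> g z = lie \<psi> g (transition \<phi> \<psi> z)"
proof -
  have "dz i (\<lambda>x. complex_of_real (g (chart_inv \<phi> x))) z =
      dz i (\<lambda>x. complex_of_real (g (chart_inv \<psi> (transition \<phi> \<psi> x)))) z" for i
    by (rule dz_cong(1)[OF overlap_props(1)[OF \<phi> \<psi>] z]) (simp add: transition_props(1)[OF \<phi> \<psi>])
  then show ?thesis
    unfolding lie_def
    using lck_transition.lee_vec_dz_T[OF transition_lck[OF \<phi> \<psi>] z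
        differentiable_of_real_C1[OF g \<psi> transition_props(4)[OF \<phi> \<psi> z]]] by simp
qed

lemma lie_sum:
  assumes "\<And>k. k \<in> I \<Longrightarrow> C1 (g k)" "\<phi> \<in> A" "z \<in> chart_image \<phi>"
  shows "lie \<phi> (\<lambda>p. \<Sum>k\<in>I. g k p) z = (\<Sum>k\<in>I. lie \<phi> (g k) z)"
proof -
  have "dz i (\<lambda>x. complex_of_real (\<Sum>k\<in>I. g k (chart_inv \<phi> x))) z =
    (\<Sum>k\<in>I. dz i (\<lambda>x. complex_of_real (g k (chart_inv \<phi> x))) z)" for i
    unfolding of_real_sum by (rule dz_sum(1)) (rule differentiable_of_real_C1[OF assms(1) assms(2,3)])
  then have "lie \<phi> (\<lambda>p. \<Sum>k\<in>I. g k p) z =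
    Re (\<Sum>i\<in>UNIV. \<Sum>k\<in>I. lvec \<phi> i z * dz i (\<lambda>x. complex_of_real (g k (chart_inv \<phi> x))) z)"
    by (simp add: lie_def sum_distrib_left)
  also have "\<dots> = (\<Sum>k\<in>I. lie \<phi> (g k) z)"
    unfolding lie_def Re_sum[symmetric] by (subst sum.swap) (rule refl)
  finally show ?thesis .
qed

lemma lie_cong_locally:
  assumes "open W" "z \<in> W" "\<And>x. x \<in> W \<Longrightarrow> f (chart_inv \<phi> x) = g (chart_inv \<phi> x)"
  shows "lie \<phi> f z = lie \<phi> g z"
proof -
  have "dz i (\<lambda>x. complex_of_real (f (chart_inv \<phi> x))) z = dz i (\<lambda>x. complex_of_real (g (chart_inv \<phi> x))) z" for i
    by (rule dz_cong(1)[OF assms(1,2)]) (simp add: assms(3))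
  then show ?thesis by (simp add: lie_def)
qed

lemma lie_const [simp]: "lie \<phi> (\<lambda>p. k) z = 0"
  by (simp add: lie_def)

lemma lie_indicator_zeros:
  assumes "\<phi> \<in> A" "z \<in> chart_image \<phi>"
  shows "lie \<phi> (\<lambda>p. of_bool (p \<in> zeros)) z = 0"
proof -
  obtain U1 U2 where U: "open U1" "open U2" "chart_image \<phi> = U1 \<union> U2"
    "\<And>z. z \<in> U1 \<Longrightarrow> chart_inv \<phi> z \<in> zeros" "\<And>z. z \<in> U2 \<Longrightarrow> chart_inv \<phi> z \<notin> zeros"
    by (rule indicator_zeros_local[OF assms(1)]) (rule that)
  from assms(2) U(3) consider "z \<in> U1" | "z \<in> U2" by blast
  then show ?thesis
  proof cases
    case 1
    then have "lie \<phi> (\<lambda>p. of_bool (p \<in> zeros)) z = lie \<phi> (\<lambda>p. 1) z"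
      by (intro lie_cong_locally[OF U(1)]) (simp_all add: U(4))
    then show ?thesis by simp
  next
    case 2
    then have "lie \<phi> (\<lambda>p. of_bool (p \<in> zeros)) z = lie \<phi> (\<lambda>p. 0) z"
      by (intro lie_cong_locally[OF U(2)]) (simp_all add: U(5))
    then show ?thesis by simp
  qed
qed

lemma lie_off_support:
  assumes \<phi>: "\<phi> \<in> A" and K: "closedin M K" "\<And>p. p \<in> topspace M - K \<Longrightarrow> g p = 0"
    and z: "z \<in> chart_image \<phi>" "chart_inv \<phi> z \<notin> K"
  shows "lie \<phi> g z = 0"
proof -
  let ?W = "snd \<phi> ` (fst \<phi> \<inter> (topspace M - K))"
  have "open ?W" by (rule open_image_chart[OF \<phi>]) (rule openin_diff[OF openin_topspace K(1)])
  moreover have "z \<in> ?W"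
    using z chart_inv_in[OF z(1)] chart_inv_topspace[OF \<phi> z(1)] chart_inv_right[OF z(1)]
    by (intro image_eqI[of _ _ "chart_inv \<phi> z"]) auto
  ultimately have "lie \<phi> g z = lie \<phi> (\<lambda>p. 0) z"
    by (rule lie_cong_locally) (use K(2) chart_inv_left[OF \<phi>] in auto)
  then show ?thesis by simp
qed

lemma continuous_lie:
  assumes g: "C1 g" and \<phi>: "\<phi> \<in> A"
  shows "continuous_on (chart_image \<phi>) (lie \<phi> g)"
proof -
  have "continuous_on (chart_image \<phi>) (dz i (\<lambda>x. complex_of_real (g (chart_inv \<phi> x))))" for i
  proof -
    have "continuous_on (chart_image \<phi>)
        (\<lambda>z. complex_of_real (frechet_derivative (\<lambda>x. g (chart_inv \<phi> x)) (at z) v))" for v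
      using C1_D(1)[OF g \<phi>] by (intro continuous_intros) simp
    then have "continuous_on (chart_image \<phi>)
        (\<lambda>z. frechet_derivative (\<lambda>x. complex_of_real (g (chart_inv \<phi> x))) (at z) v)" for v
      by (rule continuous_on_eq)
         (simp add: frechet_derivative_bounded_linear[OF bounded_linear_of_real C1_D(3)[OF g \<phi>]])
    then show ?thesis unfolding dz_def[abs_def] by (intro continuous_intros) simp_all
  qed
  then show ?thesis
    unfolding lie_def[abs_def]
    by (intro continuous_intros smooth_onD(3)[OF local_lck.smooth_lee_vec[OF local[OF \<phi>]]])
qed

lemma dens_dz:
  assumes \<phi>: "\<phi> \<in> A" and z: "z \<in> chart_image \<phi>"
  shows "(\<lambda>x. complex_of_real (dens \<phi> x)) differentiable (at z)"
    "dz i (\<lambda>x. complex_of_real (dens \<phi> x)) z = complex_of_real (dens \<phi> z) * local_lck.Gam_trace (h \<phi>) i z"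
proof -
  interpret local_lck "chart_image \<phi>" "h \<phi>" "\<theta> \<phi>" by (rule local[OF \<phi>])
  define dh where "dh v k l = frechet_derivative (\<lambda>x. h \<phi> x $ k $ l) (at z) v" for v k l
  define t where "t v = (\<Sum>k\<in>UNIV. \<Sum>l\<in>UNIV. inv_h z l k * dh v k l)" for v
  have dhc: "cnj (dh v k l) = dh v l k" for v k l
  proof -
    have "frechet_derivative (\<lambda>x. h \<phi> x $ l $ k) (at z) = frechet_derivative (\<lambda>x. cnj (h \<phi> x $ k $ l)) (at z)"
      by (rule frechet_derivative_cong_open[OF open_S z]) (rule hermitian)
    then show ?thesis
      unfolding dh_def by (simp add: frechet_derivative_bounded_linear[OF bounded_linear_cnj differentiable_h[OF z]])
  qed
  have t_real: "complex_of_real (Re (t v)) = t v" for v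
  proof -
    have "cnj (t v) = (\<Sum>k\<in>UNIV. \<Sum>l\<in>UNIV. inv_h z k l * dh v l k)"
      by (simp add: t_def inv_h_hermitian[OF z] dhc)
    also have "\<dots> = t v" unfolding t_def by (rule sum.swap)
    finally show ?thesis by (simp add: complex_eq_iff)
  qed
  have D: "((\<lambda>x. complex_of_real (dens \<phi> x)) has_derivative (\<lambda>v. complex_of_real (dens \<phi> z) * t v)) (at z)"
  proof -
    have "((\<lambda>x. complex_of_real (dens \<phi> x)) has_derivative (\<lambda>v. complex_of_real (dens \<phi> z * Re (t v)))) (at z)"
      unfolding t_def dh_def
      by (rule bounded_linear.has_derivative[OF bounded_linear_of_real vol_density_has_derivative[OF z]])
    then show ?thesis unfolding of_real_mult t_real .
  qed
  then show "(\<lambda>x. complex_of_real (dens \<phi> x)) differentiable (at z)" using differentiable_def by blast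
  have "(t (axis i 1) - \<i> * t (axis i \<i>)) / 2 =
    (\<Sum>k\<in>UNIV. \<Sum>l\<in>UNIV. inv_h z l k * ((dh (axis i 1) k l - \<i> * dh (axis i \<i>) k l) / 2))"
    unfolding t_def sum_distrib_left sum_subtractf[symmetric] sum_divide_distrib
    by (intro sum.cong refl) (simp add: algebra_simps)
  also have "\<dots> = Gam_trace i z"
    unfolding Gam_trace_def chern_Gamma_def inv_h_def dz_def dh_def by (rule refl)
  finally have "(t (axis i 1) - \<i> * t (axis i \<i>)) / 2 = Gam_trace i z" .
  moreover have "dz i (\<lambda>x. complex_of_real (dens \<phi> x)) z =
      complex_of_real (dens \<phi> z) * ((t (axis i 1) - \<i> * t (axis i \<i>)) / 2)"
    unfolding dz_def frechet_derivative_at[OF D, symmetric] by (simp add: algebra_simps)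
  ultimately show "dz i (\<lambda>x. complex_of_real (dens \<phi> x)) z = complex_of_real (dens \<phi> z) * Gam_trace i z"
    by simp
qed

lemma Ck_on_1_I:
  assumes "\<And>z. z \<in> S \<Longrightarrow> (f has_derivative f' z) (at z)" "\<And>v. continuous_on S (\<lambda>z. f' z v)"
  shows "Ck_on 1 S f"
proof -
  have "continuous_on S (\<lambda>z. frechet_derivative f (at z) v)" for v
    by (rule continuous_on_eq[OF assms(2)[of v]]) (simp add: frechet_derivative_at[OF assms(1), symmetric])
  moreover have "f differentiable (at z)" if "z \<in> S" for z
    using assms(1)[OF that] differentiable_def by blast
  ultimately show ?thesis by simp
qed

lemma continuous_dens: "\<phi> \<in> A \<Longrightarrow> continuous_on (chart_image \<phi>) (dens \<phi>)"
  by (intro continuous_at_imp_continuous_on ballI)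
     (rule has_derivative_continuous[OF local_lck.vol_density_has_derivative[OF local]])

lemma Ck_on_dens:
  assumes \<phi>: "\<phi> \<in> A"
  shows "Ck_on 1 (chart_image \<phi>) (dens \<phi>)"
proof (rule Ck_on_1_I)
  interpret local_lck "chart_image \<phi>" "h \<phi>" "\<theta> \<phi>" by (rule local[OF \<phi>])
  show "(dens \<phi> has_derivative (\<lambda>v. dens \<phi> z *
     Re (\<Sum>k\<in>UNIV. \<Sum>l\<in>UNIV. inv_h z l k * frechet_derivative (\<lambda>x. h \<phi> x $ k $ l) (at z) v))) (at z)"
    if "z \<in> chart_image \<phi>" for z
    by (rule vol_density_has_derivative[OF that])
  show "continuous_on (chart_image \<phi>) (\<lambda>z. dens \<phi> z *
     Re (\<Sum>k\<in>UNIV. \<Sum>l\<in>UNIV. inv_h z l k * frechet_derivative (\<lambda>x. h \<phi> x $ k $ l) (at z) v))" for v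
    by (intro continuous_intros continuous_dens \<phi> smooth_onD(3)[OF smooth_inv_h]
        smooth_onD(3)[OF smooth_onD(2)[OF smooth_h]])
qed

section \<open>Integration by parts in a chart and change of charts\<close>

lemma test_fun_chart:
  assumes \<phi>: "\<phi> \<in> A" and K: "compactin M K" "K \<subseteq> fst \<phi>"
    and F: "continuous_on (chart_image \<phi>) F" "\<And>z. z \<in> chart_image \<phi> \<Longrightarrow> chart_inv \<phi> z \<notin> K \<Longrightarrow> F z = 0"
  shows "test_fun (zext (chart_image \<phi>) F)"
proof (rule test_fun_zext[OF chart(2)[OF \<phi>] compact_image_chart[OF \<phi> K] _ F(1)])
  show "snd \<phi> ` K \<subseteq> chart_image \<phi>" by (rule chart_image_mono[OF K(2)])
  show "F z = 0" if "z \<in> chart_image \<phi> - snd \<phi> ` K" for z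
    using that F(2)[of z] chart_inv_right[of z \<phi>] by force
qed

lemma continuous_divg: "\<phi> \<in> A \<Longrightarrow> continuous_on (chart_image \<phi>) (divg \<phi>)"
proof -
  assume \<phi>: "\<phi> \<in> A"
  interpret local_lck "chart_image \<phi>" "h \<phi>" "\<theta> \<phi>" by (rule local[OF \<phi>])
  have "smooth_on (chart_image \<phi>) (lee_hess k l)" for k l
    unfolding lee_hess_def[abs_def] by (intro smooth_on_dzbar open_S smooth_lee)
  then have "continuous_on (chart_image \<phi>) (ltrace \<phi>)"
    unfolding lee_trace_def[abs_def] by (intro continuous_intros smooth_onD(3)[OF smooth_inv_h] smooth_onD(3))
  then show "continuous_on (chart_image \<phi>) (divg \<phi>)"
    unfolding divg_def[abs_def]
    by (intro continuous_intros smooth_onD(3)[OF smooth_lee] smooth_onD(3)[OF smooth_lee_vec])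
qed

text \<open>Derivatives of compactly supported functions integrate to zero. For the field
  \<open>dens \<phi>\<close> times \<open>lee_vec\<close> times \<open>g\<close>, the product rule
  leaves \<open>g\<close> times the divergence of the Lee field plus the derivative of
  \<open>g\<close> along it.\<close>

lemma integration_by_parts:
  assumes \<phi>: "\<phi> \<in> A" and g: "C1 g" and K: "compactin M K" "K \<subseteq> fst \<phi>"
    and gK: "\<And>p. p \<in> topspace M - K \<Longrightarrow> g p = 0"
  shows "test_fun (zext (chart_image \<phi>) (\<lambda>z. dens \<phi> z * (g (chart_inv \<phi> z) * divg \<phi> z)))"
    "test_fun (zext (chart_image \<phi>) (\<lambda>z. dens \<phi> z * lie \<phi> g z))"
    "cint (zext (chart_image \<phi>) (\<lambda>z. dens \<phi> z * (g (chart_inv \<phi> z) * divg \<phi> z))) +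
     cint (zext (chart_image \<phi>) (\<lambda>z. dens \<phi> z * lie \<phi> g z)) = 0"
proof -
  interpret local_lck "chart_image \<phi>" "h \<phi>" "\<theta> \<phi>" by (rule local[OF \<phi>])
  let ?S = "chart_image \<phi>"
  define G where "G z = g (chart_inv \<phi> z)" for z
  have G0: "G z = 0" if "z \<in> ?S" "chart_inv \<phi> z \<notin> K" for z
    unfolding G_def using gK chart_inv_topspace[OF \<phi> that(1)] that(2) by blast
  show t1: "test_fun (zext ?S (\<lambda>z. dens \<phi> z * (g (chart_inv \<phi> z) * divg \<phi> z)))"
    by (rule test_fun_chart[OF \<phi> K])
       (use G0 in \<open>auto simp: G_def intro!: continuous_intros continuous_dens continuous_divg \<phi> C1_D(2)[OF g]\<close>)
  show t2: "test_fun (zext ?S (\<lambda>z. dens \<phi> z * lie \<phi> g z))"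
    by (rule test_fun_chart[OF \<phi> K])
       (use lie_off_support[where K = K and g = g, OF \<phi> closed_compactin[OF K(1)] gK] in
         \<open>auto intro!: continuous_intros continuous_dens continuous_lie \<phi> g\<close>)
  define F where "F L i z = dens \<phi> z * L (lee_vec i z) * G z" for L :: "complex \<Rightarrow> real" and i z
  have F1: "Ck_on 1 ?S (F L i)" if "bounded_linear L" for L i
    unfolding F_def
    using Ck_on_dens[OF \<phi>] C1_D(1)[OF g \<phi>] smooth_lee_vec[of i]
    by (intro Ck_on_mult[OF open_S] Ck_on_bounded_linear[OF open_S that]) (simp_all add: G_def smooth_on_def del: Ck_on.simps)
  have F0: "F L i z = 0" if "z \<in> ?S" "chart_inv \<phi> z \<notin> K" for L i z
    using G0[OF that] by (simp add: F_def)
  have FE: "Ck_on 1 UNIV (zext ?S (F L i))" if "bounded_linear L" for L i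
  proof (rule Ck_on_zext[OF open_S compact_image_chart[OF \<phi> K] _ F1[OF that]])
    show "snd \<phi> ` K \<subseteq> ?S" by (rule chart_image_mono[OF K(2)])
    show "F L i z = 0" if "z \<in> ?S - snd \<phi> ` K" for z
      using that F0[of z] chart_inv_right[of z \<phi>] by force
  qed
  have FT: "test_fun (zext ?S (F L i))" if "bounded_linear L" for L i
    using Ck_on_SucD[of 0 ?S "F L i"] F1[OF that] F0 by (intro test_fun_chart[OF \<phi> K]) simp_all
  \<comment> \<open>Real divergence of the field whose complex components are called
    \<open>C i\<close> below: derivatives of real parts in real directions and of imaginary parts in
    imaginary directions. It equals twice the real part of the sum of
    \<open>dz i (C i)\<close>.\<close>
  define E where "E z = (\<Sum>i\<in>UNIV. frechet_derivative (zext ?S (F Re i)) (at z) (axis i 1)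
      + frechet_derivative (zext ?S (F Im i)) (at z) (axis i \<i>))" for z
  have tE: "test_fun (\<lambda>z. frechet_derivative (zext ?S (F Re i)) (at z) (axis i 1)
      + frechet_derivative (zext ?S (F Im i)) (at z) (axis i \<i>))" for i
    by (intro test_fun_add cint_derivative_eq_0(2) FT FE bounded_linear_Re bounded_linear_Im)
  have "cint E = (\<Sum>i\<in>UNIV. cint (\<lambda>z. frechet_derivative (zext ?S (F Re i)) (at z) (axis i 1)
      + frechet_derivative (zext ?S (F Im i)) (at z) (axis i \<i>)))"
    unfolding E_def by (rule cint_sum) (rule tE)
  also have "\<dots> = 0"
    by (simp add: cint_add[OF cint_derivative_eq_0(2)[OF FT FE] cint_derivative_eq_0(2)[OF FT FE]]
        cint_derivative_eq_0(1)[OF FT FE] bounded_linear_Re bounded_linear_Im)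
  finally have cE: "cint E = 0" .
  have "E z = 2 * (zext ?S (\<lambda>z. dens \<phi> z * (g (chart_inv \<phi> z) * divg \<phi> z)) z + zext ?S (\<lambda>z. dens \<phi> z * lie \<phi> g z) z)" for z
  proof (cases "z \<in> ?S")
    case False
    have "frechet_derivative (zext ?S (F L i)) (at z) v = 0" for L i v
    proof (rule frechet_derivative_eq_0_off_support)
      show "closed (snd \<phi> ` K)" by (rule compact_imp_closed[OF compact_image_chart[OF \<phi> K]])
      show "zext ?S (F L i) x = 0" if "x \<notin> snd \<phi> ` K" for x
        using that F0[of x] chart_inv_right[of x \<phi>] by (force simp: zext_def)
      show "z \<notin> snd \<phi> ` K" using False chart_image_mono[OF K(2)] by blast
    qed
    then show ?thesis using False by (simp add: E_def zext_def)
  next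
    case z: True
    define C where "C i x = complex_of_real (dens \<phi> x) * lee_vec i x * complex_of_real (G x)" for i x
    have dW: "lee_vec i differentiable (at z)" for i using smooth_onD(1)[OF smooth_lee_vec z] .
    have dG: "(\<lambda>x. complex_of_real (G x)) differentiable (at z)"
      unfolding G_def by (rule differentiable_of_real_C1[OF g \<phi> z])
    note dr = dens_dz[OF \<phi> z]
    have dC: "C i differentiable (at z)" for i
      unfolding C_def[abs_def] by (intro differentiable_mult dr dW dG)
    have ReC: "Re (C i x) = F Re i x" "Im (C i x) = F Im i x" for i x
      by (simp_all add: C_def F_def)
    have fd: "frechet_derivative (zext ?S (F L i)) (at z) v = L (frechet_derivative (C i) (at z) v)"
      if L: "bounded_linear L" "\<And>x. L (C i x) = F L i x" for L i v
    proof -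
      have "frechet_derivative (zext ?S (F L i)) (at z) = frechet_derivative (\<lambda>x. L (C i x)) (at z)"
        by (rule frechet_derivative_cong_open[OF open_S z]) (simp add: zext_def L(2))
      then show ?thesis by (simp add: frechet_derivative_bounded_linear[OF L(1) dC])
    qed
    have "E z = 2 * Re (\<Sum>i\<in>UNIV. dz i (C i) z)"
      unfolding E_def fd[OF bounded_linear_Re ReC(1)] fd[OF bounded_linear_Im ReC(2)] dz_def
      by (simp add: sum_distrib_left add_divide_distrib)
    also have "(\<Sum>i\<in>UNIV. dz i (C i) z) =
      complex_of_real (G z) * (\<Sum>i\<in>UNIV. dz i (\<lambda>x. complex_of_real (dens \<phi> x) * lee_vec i x) z) +
      complex_of_real (dens \<phi> z) * (\<Sum>i\<in>UNIV. lee_vec i z * dz i (\<lambda>x. complex_of_real (G x)) z)"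
      unfolding C_def[abs_def] dz_mult(1)[OF differentiable_mult[OF dr(1) dW] dG]
      by (simp add: sum.distrib sum_distrib_left mult_ac)
    also have "(\<Sum>i\<in>UNIV. dz i (\<lambda>x. complex_of_real (dens \<phi> x) * lee_vec i x) z) =
      complex_of_real (dens \<phi> z) * (lee_trace z + (of_nat CARD('n) - 1) * (\<Sum>i\<in>UNIV. lee i z * lee_vec i z))"
      by (rule divergence_lee_vec[OF z dr])
    also have "2 * Re (complex_of_real (G z) * (complex_of_real (dens \<phi> z) *
        (lee_trace z + (of_nat CARD('n) - 1) * (\<Sum>i\<in>UNIV. lee i z * lee_vec i z))) +
      complex_of_real (dens \<phi> z) * (\<Sum>i\<in>UNIV. lee_vec i z * dz i (\<lambda>x. complex_of_real (G x)) z)) =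
      2 * (dens \<phi> z * (G z * divg \<phi> z) + dens \<phi> z * lie \<phi> g z)"
      unfolding divg_def lie_def G_def[symmetric] plus_complex.simps(1) Re_of_real_mult
      by (simp only: mult_ac)
    finally show ?thesis using z by (simp add: zext_def G_def)
  qed
  then have "E = (\<lambda>z. 2 * (zext ?S (\<lambda>z. dens \<phi> z * (g (chart_inv \<phi> z) * divg \<phi> z)) z + zext ?S (\<lambda>z. dens \<phi> z * lie \<phi> g z) z))"
    by blast
  then have "cint E = 2 * (cint (zext ?S (\<lambda>z. dens \<phi> z * (g (chart_inv \<phi> z) * divg \<phi> z))) + cint (zext ?S (\<lambda>z. dens \<phi> z * lie \<phi> g z)))"
    by (simp only: cint_cmult cint_add[OF t1 t2])
  then show "cint (zext ?S (\<lambda>z. dens \<phi> z * (g (chart_inv \<phi> z) * divg \<phi> z))) +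
     cint (zext ?S (\<lambda>z. dens \<phi> z * lie \<phi> g z)) = 0"
    using cE by simp
qed

text \<open>The density absorbs the Jacobian factor of the change of variables. Since
  \<open>K\<close> lies in both charts, both integrands vanish off the overlap, so restricting to it
  loses nothing.\<close>

lemma cint_chart_change:
  assumes \<phi>: "\<phi> \<in> A" and \<psi>: "\<psi> \<in> A" and K: "compactin M K" "K \<subseteq> fst \<phi>" "K \<subseteq> fst \<psi>"
    and F: "continuous_on (chart_image \<psi>) F" "\<And>z. z \<in> chart_image \<psi> \<Longrightarrow> chart_inv \<psi> z \<notin> K \<Longrightarrow> F z = 0"
    and G: "\<And>z. z \<in> chart_image \<phi> \<Longrightarrow> chart_inv \<phi> z \<notin> K \<Longrightarrow> G z = 0"
    and GF: "\<And>z. z \<in> overlap \<phi> \<psi> \<Longrightarrow> G z = F (transition \<phi> \<psi> z)"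
  shows "cint (zext (chart_image \<phi>) (\<lambda>z. dens \<phi> z * G z)) = cint (zext (chart_image \<psi>) (\<lambda>z. dens \<psi> z * F z))"
proof -
  let ?T = "transition \<phi> \<psi>" and ?f = "zext (chart_image \<psi>) (\<lambda>z. dens \<psi> z * F z)"
  interpret lck_transition "chart_image \<phi>" "chart_image \<psi>" "h \<phi>" "h \<psi>" "\<theta> \<phi>" "\<theta> \<psi>" ?T "overlap \<phi> \<psi>"
    by (rule transition_lck[OF \<phi> \<psi>])
  have tf: "test_fun ?f"
    by (rule test_fun_chart[OF \<psi> K(1,3)])
       (auto simp: F(2) intro!: continuous_intros continuous_dens \<psi> F(1))
  have "cint (\<lambda>z. if z \<in> overlap \<phi> \<psi> then \<bar>det (rmat (frechet_derivative ?T (at z)))\<bar> * ?f (?T z) else 0) = cint ?f"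
  proof (rule cint_change_of_variables[OF overlap_props(1)[OF \<phi> \<psi>]])
    show "open (?T ` overlap \<phi> \<psi>)" unfolding transition_image(1)[OF \<phi> \<psi>] by (rule overlap_props(1)[OF \<psi> \<phi>])
    show "inj_on ?T (overlap \<phi> \<psi>)" by (rule transition_image(2)[OF \<phi> \<psi>])
    show "(?T has_derivative frechet_derivative ?T (at z)) (at z)" if "z \<in> overlap \<phi> \<psi>" for z
      by (rule vec_holomorphic_frechet(1)[OF holo that])
    show "test_fun ?f" by (rule tf)
    show "?f z = 0" if "z \<notin> ?T ` overlap \<phi> \<psi>" for z
    proof (cases "z \<in> chart_image \<psi>")
      case True
      then have "chart_inv \<psi> z \<notin> fst \<phi>"
        using that overlap_props(3)[OF \<psi> \<phi>, of z] unfolding transition_image(1)[OF \<phi> \<psi>] by blast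
      then have "F z = 0" using F(2)[OF True] K(2) by blast
      then show ?thesis by (simp add: zext_def)
    qed (simp add: zext_def)
  qed
  moreover have "(\<lambda>z. if z \<in> overlap \<phi> \<psi> then \<bar>det (rmat (frechet_derivative ?T (at z)))\<bar> * ?f (?T z) else 0) =
    zext (chart_image \<phi>) (\<lambda>z. dens \<phi> z * G z)"
  proof
    fix z
    show "(if z \<in> overlap \<phi> \<psi> then \<bar>det (rmat (frechet_derivative ?T (at z)))\<bar> * ?f (?T z) else 0) =
      zext (chart_image \<phi>) (\<lambda>z. dens \<phi> z * G z) z"
    proof (cases "z \<in> overlap \<phi> \<psi>")
      case True
      then have "z \<in> chart_image \<phi>" using overlap_props(2)[OF \<phi> \<psi>] by blast
      then show ?thesis
        using True transition_props(4)[OF \<phi> \<psi> True] vol_density_T[OF True] GF[OF True] by (simp add: zext_def)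
    next
      case False
      have "zext (chart_image \<phi>) (\<lambda>z. dens \<phi> z * G z) z = 0"
      proof (cases "z \<in> chart_image \<phi>")
        case True
        then have "chart_inv \<phi> z \<notin> K" using False overlap_props(3)[OF \<phi> \<psi>, of z] K(3) by blast
        then show ?thesis using G[OF True] by (simp add: zext_def)
      qed (simp add: zext_def)
      with False show ?thesis by simp
    qed
  qed
  ultimately show ?thesis by simp
qed

end

section \<open>Partition of unity and vanishing of the Lee form\<close>

text \<open>Squaring the truncated quadratic makes it continuously differentiable across the
  boundary sphere. One continuous derivative is all that the integration by parts uses.\<close>

definition bump :: "complex^'n \<Rightarrow> real \<Rightarrow> complex^'n \<Rightarrow> real" where
  "bump y0 r y = (max 0 (r\<^sup>2 - (y - y0) \<bullet> (y - y0)))\<^sup>2"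

lemma has_derivative_max_square:
  fixes t :: real
  shows "((\<lambda>t. (max 0 t)\<^sup>2) has_field_derivative 2 * max 0 t) (at t)"
proof -
  consider "t > 0" | "t < 0" | "t = 0" by linarith
  then show ?thesis
  proof cases
    case 1
    have "((\<lambda>t. t\<^sup>2) has_field_derivative 2 * max 0 t) (at t)"
      using 1 by (auto intro!: derivative_eq_intros)
    then show ?thesis
      by (rule has_field_derivative_transform_within_open[of _ _ _ "{0<..}"]) (use 1 in auto)
  next
    case 2
    have "((\<lambda>t. 0 :: real) has_field_derivative 2 * max 0 t) (at t)"
      using 2 by simp
    then show ?thesis
      by (rule has_field_derivative_transform_within_open[of _ _ _ "{..<0}"]) (use 2 in auto)
  next
    case 3
    have "((\<lambda>h::real. (max 0 h)\<^sup>2 / h) \<longlongrightarrow> 0) (at 0)"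
    proof (rule Lim_null_comparison)
      show "\<forall>\<^sub>F h in at 0. norm ((max 0 h)\<^sup>2 / h) \<le> \<bar>h\<bar>"
        by (intro always_eventually allI) (auto simp: max_def power2_eq_square)
      show "((\<lambda>h::real. \<bar>h\<bar>) \<longlongrightarrow> 0) (at 0)" by (auto intro!: tendsto_eq_intros)
    qed
    then show ?thesis using 3 by (simp add: has_field_derivative_iff)
  qed
qed

lemma bump_has_derivative:
  "(bump y0 r has_derivative (\<lambda>v. - 4 * max 0 (r\<^sup>2 - (y - y0) \<bullet> (y - y0)) * ((y - y0) \<bullet> v))) (at y)"
proof -
  have "((\<lambda>y. r\<^sup>2 - (y - y0) \<bullet> (y - y0)) has_derivative (\<lambda>v. - 2 * ((y - y0) \<bullet> v))) (at y)"
    by (auto intro!: derivative_eq_intros simp: inner_commute)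
  from DERIV_compose_FDERIV[OF has_derivative_max_square this] show ?thesis
    unfolding bump_def[abs_def] by (simp add: mult_ac)
qed

lemma bump_nonneg: "bump y0 r y \<ge> 0"
  by (simp add: bump_def)

lemma bump_pos_iff: "r > 0 \<Longrightarrow> bump y0 r y > 0 \<longleftrightarrow> y \<in> ball y0 r"
proof -
  assume r: "r > 0"
  have "bump y0 r y > 0 \<longleftrightarrow> r\<^sup>2 - (norm (y - y0))\<^sup>2 > 0"
    by (auto simp: bump_def dot_square_norm max_def)
  also have "\<dots> \<longleftrightarrow> norm (y - y0) < r"
    using r power2_less_imp_less[of "norm (y - y0)" r] power_strict_mono[of "norm (y - y0)" r 2] by auto
  finally show ?thesis by (simp add: dist_norm norm_minus_commute)
qed

context lck_manifold
begin

lemma bump_function: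
  assumes p: "p \<in> topspace M"
  obtains \<phi> b K where "\<phi> \<in> A" "C1 b" "\<And>q. b q \<ge> 0" "b p > 0" "compactin M K" "K \<subseteq> fst \<phi>"
    "\<And>q. q \<notin> K \<Longrightarrow> b q = 0" "openin M {q. b q > 0}"
proof -
  obtain \<phi> where \<phi>: "\<phi> \<in> A" "p \<in> fst \<phi>" using chart_cover[OF p] by blast
  define y0 where "y0 = snd \<phi> p"
  obtain r where r: "r > 0" "cball y0 r \<subseteq> chart_image \<phi>"
    using chart(2)[OF \<phi>(1)] chart_image_mem[OF \<phi>(2)] unfolding y0_def[symmetric] open_contains_cball by blast
  define b where "b q = (if q \<in> fst \<phi> then bump y0 r (snd \<phi> q) else 0)" for q
  define K where "K = chart_inv \<phi> ` cball y0 r"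
  have K: "compactin M K" unfolding K_def by (rule compact_inv_chart[OF \<phi>(1) compact_cball r(2)])
  have Kf: "K \<subseteq> fst \<phi>" unfolding K_def using r(2) chart_inv_in by blast
  have b0: "b q = 0" if "q \<notin> K" for q
  proof (cases "q \<in> fst \<phi>")
    case True
    have "snd \<phi> q \<notin> ball y0 r"
    proof
      assume "snd \<phi> q \<in> ball y0 r"
      then have "chart_inv \<phi> (snd \<phi> q) \<in> K" unfolding K_def by (intro imageI) simp
      then show False using that chart_inv_left[OF \<phi>(1) True] by simp
    qed
    then show ?thesis using True bump_pos_iff[OF r(1), of y0 "snd \<phi> q"] bump_nonneg[of y0 r "snd \<phi> q"]
      by (simp add: b_def)
  qed (simp add: b_def)
  have C: "C1 b"
    unfolding C1_def
  proof
    fix \<psi> assume \<psi>: "\<psi> \<in> A"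
    let ?T = "transition \<psi> \<phi>" and ?V = "snd \<psi> ` (fst \<psi> \<inter> (topspace M - K))"
    have holo: "vec_holomorphic_on ?T (overlap \<psi> \<phi>)"
      using manifold \<phi> \<psi> unfolding complex_manifold_def by blast
    have oV: "open ?V"
      by (rule open_image_chart[OF \<psi>]) (rule openin_diff[OF openin_topspace closed_compactin[OF K]])
    have oO: "open (overlap \<psi> \<phi>)" by (rule overlap_props(1)[OF \<psi> \<phi>(1)])
    \<comment> \<open>Another chart is covered by its overlap with \<phi>, where \<open>b\<close> is
      the bump composed with the transition map, and by the points outside \<open>K\<close>, where
      \<open>b\<close> vanishes; the second set is open because \<open>K\<close> is closed.\<close>
    have un: "chart_image \<psi> = overlap \<psi> \<phi> \<union> ?V"
      unfolding chart_image_def overlap_def using fst_subset[OF \<psi>] Kf by blast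
    have 1: "Ck_on 1 (overlap \<psi> \<phi>) (\<lambda>z. bump y0 r (?T z))"
    proof (rule Ck_on_1_I)
      show "((\<lambda>z. bump y0 r (?T z)) has_derivative (\<lambda>v. - 4 * max 0 (r\<^sup>2 - (?T z - y0) \<bullet> (?T z - y0)) *
          ((?T z - y0) \<bullet> frechet_derivative ?T (at z) v))) (at z)" if "z \<in> overlap \<psi> \<phi>" for z
        by (rule has_derivative_compose[OF vec_holomorphic_frechet(1)[OF holo that] bump_has_derivative])
      have cT: "continuous_on (overlap \<psi> \<phi>) ?T"
        by (intro continuous_at_imp_continuous_on ballI) (rule has_derivative_continuous[OF vec_holomorphic_frechet(1)[OF holo]])
      have cD: "continuous_on (overlap \<psi> \<phi>) (\<lambda>z. frechet_derivative ?T (at z) v)" for v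
      proof -
        have "continuous_on (overlap \<psi> \<phi>) (\<lambda>z. \<chi> k. frechet_derivative ?T (at z) v $ k)"
          by (intro continuous_on_vec_lambda vec_holomorphic_derivative_continuous[OF oO holo])
        then show ?thesis by simp
      qed
      show "continuous_on (overlap \<psi> \<phi>) (\<lambda>z. - 4 * max 0 (r\<^sup>2 - (?T z - y0) \<bullet> (?T z - y0)) *
          ((?T z - y0) \<bullet> frechet_derivative ?T (at z) v))" for v
        by (intro continuous_intros cT cD)
    qed
    show "Ck_on 1 (chart_image \<psi>) (\<lambda>z. b (chart_inv \<psi> z))"
      unfolding un
    proof (rule Ck_on_Un[OF oO oV])
      show "Ck_on 1 (overlap \<psi> \<phi>) (\<lambda>z. b (chart_inv \<psi> z))"
      proof (rule Ck_on_cong[OF oO, THEN iffD2, OF _ 1])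
        fix z assume "z \<in> overlap \<psi> \<phi>"
        then show "b (chart_inv \<psi> z) = bump y0 r (?T z)"
          using overlap_props(3)[OF \<psi> \<phi>(1), of z] by (simp add: b_def transition_def)
      qed
      show "Ck_on 1 ?V (\<lambda>z. b (chart_inv \<psi> z))"
      proof (rule Ck_on_cong[OF oV, THEN iffD2, OF _ Ck_on_const])
        fix z assume "z \<in> ?V"
        then have "chart_inv \<psi> z \<notin> K" using chart_inv_left[OF \<psi>] by auto
        then show "b (chart_inv \<psi> z) = 0" by (rule b0)
      qed
    qed
  qed
  have "{q. b q > 0} = {q \<in> fst \<phi>. snd \<phi> q \<in> ball y0 r}"
    using bump_pos_iff[OF r(1), of y0] by (auto simp: b_def)
  then have o: "openin M {q. b q > 0}" using open_preimage_chart[OF \<phi>(1) open_ball] by simp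
  have "b q \<ge> 0" for q by (simp add: b_def bump_nonneg)
  moreover have "b p > 0" using \<phi>(2) r(1) bump_pos_iff[OF r(1), of y0 y0] by (simp add: b_def y0_def)
  ultimately show thesis using that[OF \<phi>(1) C _ _ K Kf b0 o] by blast
qed

text \<open>Where \<mu> vanishes, the trace of \<open>lee_hess\<close> is
  \<open>- 2 (n + 1) c\<close>, so the sign of the curvature makes it nonnegative; the squared norm
  of the Lee form adds to it with the factor \<open>n - 1\<close>.\<close>

lemma divg_nonneg_on_zeros:
  assumes \<phi>: "\<phi> \<in> A" and z: "z \<in> chart_image \<phi>" and zero: "chart_inv \<phi> z \<in> zeros"
  shows "divg \<phi> z \<ge> (real CARD('n) - 1) * Re (\<Sum>i\<in>UNIV. llee \<phi> i z * lvec \<phi> i z)" "divg \<phi> z \<ge> 0"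
proof -
  have "lmu \<phi> z = 0" using gmu_chart[OF \<phi> z] zero by (simp add: zeros_def)
  then have "Re (ltrace \<phi> z) + 2 * (real CARD('n) + 1) * c (chart_inv \<phi> z) = 0"
    unfolding local_lck_hsc.mu_def[OF local_hsc[OF \<phi>]] by simp
  then have "Re (ltrace \<phi> z) = - (2 * (real CARD('n) + 1) * c (chart_inv \<phi> z))"
    by (simp only: eq_neg_iff_add_eq_0)
  moreover have "2 * (real CARD('n) + 1) * c (chart_inv \<phi> z) \<le> 0"
    by (rule mult_nonneg_nonpos[OF _ c_nonpos[OF chart_inv_topspace[OF \<phi> z]]]) simp
  ultimately have t: "Re (ltrace \<phi> z) \<ge> 0" by linarith
  have "divg \<phi> z = Re (ltrace \<phi> z) + (real CARD('n) - 1) * Re (\<Sum>i\<in>UNIV. llee \<phi> i z * lvec \<phi> i z)"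
  proof -
    have "(of_nat CARD('n) - 1 :: complex) = complex_of_real (real CARD('n) - 1)" by simp
    then show ?thesis unfolding divg_def by (simp only: plus_complex.simps(1) Re_of_real_mult)
  qed
  then show 1: "divg \<phi> z \<ge> (real CARD('n) - 1) * Re (\<Sum>i\<in>UNIV. llee \<phi> i z * lvec \<phi> i z)" using t by simp
  have "0 \<le> (real CARD('n) - 1) * Re (\<Sum>i\<in>UNIV. llee \<phi> i z * lvec \<phi> i z)"
    using card local_lck.lee_lee_vec_nonneg[OF local[OF \<phi>] z] by (intro mult_nonneg_nonneg) auto
  then show "divg \<phi> z \<ge> 0" using 1 by linarith
qed

text \<open>The divergence of the Lee vector field is nonnegative on \<open>zeros\<close>; integrating it against a
  partition of unity shows that it vanishes there, and with it the Lee form.\<close>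

lemma theta_zero_on_zeros:
  assumes \<psi>: "\<psi> \<in> A" and z: "z \<in> chart_image \<psi>" and zero: "chart_inv \<psi> z \<in> zeros"
  shows "\<theta> \<psi> z v = 0"
proof -
  have "\<forall>p\<in>topspace M. \<exists>\<phi> b K. \<phi> \<in> A \<and> C1 b \<and> (\<forall>q. b q \<ge> 0) \<and> b p > 0 \<and> compactin M K \<and> K \<subseteq> fst \<phi>
     \<and> (\<forall>q. q \<notin> K \<longrightarrow> b q = 0) \<and> openin M {q. b q > 0}"
  proof
    fix p assume "p \<in> topspace M"
    then obtain \<phi> b K where "\<phi> \<in> A" "C1 b" "\<And>q. b q \<ge> 0" "b p > 0" "compactin M K" "K \<subseteq> fst \<phi>"
      "\<And>q. q \<notin> K \<Longrightarrow> b q = 0" "openin M {q. b q > 0}"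
      by (rule bump_function) (rule that)
    then show "\<exists>\<phi> b K. \<phi> \<in> A \<and> C1 b \<and> (\<forall>q. b q \<ge> 0) \<and> b p > 0 \<and> compactin M K \<and> K \<subseteq> fst \<phi>
     \<and> (\<forall>q. q \<notin> K \<longrightarrow> b q = 0) \<and> openin M {q. b q > 0}" by (intro exI[of _ \<phi>] exI[of _ b] exI[of _ K]) simp
  qed
  then obtain \<Phi> b K where *: "\<forall>p\<in>topspace M. \<Phi> p \<in> A \<and> C1 (b p) \<and> (\<forall>q. b p q \<ge> 0) \<and> b p p > 0 \<and> compactin M (K p) \<and> K p \<subseteq> fst (\<Phi> p)
     \<and> (\<forall>q. q \<notin> K p \<longrightarrow> b p q = 0) \<and> openin M {q. b p q > 0}"
    unfolding bchoice_iff by blast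
  have bump: "\<Phi> p \<in> A" "C1 (b p)" "b p q \<ge> 0" "b p p > 0" "compactin M (K p)" "K p \<subseteq> fst (\<Phi> p)"
    "q \<notin> K p \<Longrightarrow> b p q = 0" "openin M {q. b p q > 0}" if "p \<in> topspace M" for p q
    using * that by blast+
  define \<U> where "\<U> = (\<lambda>p. {q. b p q > 0}) ` topspace M"
  have "\<exists>\<F>. finite \<F> \<and> \<F> \<subseteq> \<U> \<and> topspace M \<subseteq> \<Union>\<F>"
    using compact_M unfolding compact_space_alt
  proof (elim allE[of _ \<U>] impE)
    show "(\<forall>U\<in>\<U>. openin M U) \<and> topspace M \<subseteq> \<Union>\<U>"
      using bump(4,8) by (auto simp: \<U>_def)
  qed
  then obtain P where P: "finite P" "P \<subseteq> topspace M" "topspace M \<subseteq> (\<Union>p\<in>P. {q. b p q > 0})"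
    unfolding \<U>_def by (metis finite_subset_image)
  define B where "B q = (\<Sum>p\<in>P. b p q)" for q
  have inP: "p \<in> topspace M" if "p \<in> P" for p using that P(2) by blast
  have Bpos: "B q > 0" if q: "q \<in> topspace M" for q
  proof -
    obtain p where "p \<in> P" "b p q > 0" using P(3) q by blast
    then show ?thesis unfolding B_def using bump(3)[OF inP] by (intro sum_pos2[OF P(1)]) auto
  qed
  \<comment> \<open>A partition of unity: the bumps are divided by their sum, which is positive
    everywhere because finitely many of the positivity sets cover the compact space.\<close>
  define pu where "pu p q = b p q * inverse (B q)" for p q
  define iZ where "iZ q = (of_bool (q \<in> zeros) :: real)" for q
  \<comment> \<open>Each member is cut off to \<open>zeros\<close>; the sum of all
    \<open>g p\<close> is the indicator of \<open>zeros\<close>, and the terms of the integral are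
    nonzero only where the divergence has a sign.\<close>
  define g where "g p q = iZ q * pu p q" for p q
  have CB: "C1 B" unfolding B_def by (rule C1_sum) (rule bump(2)[OF inP])
  have Cpu: "C1 (pu p)" if "p \<in> P" for p
    unfolding pu_def
    by (intro C1_mult bump(2)[OF inP[OF that]] C1_inverse CB) (use Bpos in \<open>force dest: less_imp_neq\<close>)
  have CZ: "C1 iZ" unfolding iZ_def by (rule C1_indicator_zeros)
  have Cg: "C1 (g p)" if "p \<in> P" for p
    unfolding g_def by (intro C1_mult CZ Cpu that)
  have pu0: "pu p q = 0" "g p q = 0" if "p \<in> P" "q \<notin> K p" for p q
    using bump(7)[OF inP[OF that(1)] that(2)] by (simp_all add: pu_def g_def)
  have sumpu: "(\<Sum>p\<in>P. pu p q) = 1" if "q \<in> topspace M" for q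
    using Bpos[OF that] by (simp add: pu_def sum_distrib_right[symmetric] B_def[symmetric])
  have punn: "pu p q \<ge> 0" if "p \<in> P" "q \<in> topspace M" for p q
    using Bpos[OF that(2)] bump(3)[OF inP[OF that(1)], of q] by (simp add: pu_def)
  \<comment> \<open>\<open>D p\<close> and \<open>X p\<close> are the two integrands of
    \<open>integration_by_parts\<close> for \<open>g p\<close> in its own chart: \<open>g p\<close>
    times the divergence, and the derivative of \<open>g p\<close> along the Lee field.\<close>
  define D where "D p = zext (chart_image (\<Phi> p)) (\<lambda>z. dens (\<Phi> p) z * (g p (chart_inv (\<Phi> p) z) * divg (\<Phi> p) z))" for p
  define X where "X p = zext (chart_image (\<Phi> p)) (\<lambda>z. dens (\<Phi> p) z * lie (\<Phi> p) (g p) z)" for p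
  have ibp: "test_fun (D p)" "test_fun (X p)" "cint (D p) + cint (X p) = 0" if "p \<in> P" for p
    unfolding D_def X_def
    using integration_by_parts[OF bump(1)[OF inP[OF that]] Cg[OF that] bump(5,6)[OF inP[OF that]], OF pu0(2)[OF that]] by blast+
  \<comment> \<open>The integrals of the \<open>X p\<close> live in different charts and cannot be
    added under one integral sign. A second copy of the partition of unity repairs this:
    \<open>Y r p q\<close> is the integrand for \<open>g p\<close> weighted by \<open>pu q\<close>
    and written in the chart of \<open>r\<close>, with \<open>r\<close> either \<open>p\<close> or
    \<open>q\<close>.\<close>
  define Y where "Y r p q = zext (chart_image (\<Phi> r)) (\<lambda>z. dens (\<Phi> r) z * (pu q (chart_inv (\<Phi> r) z) * lie (\<Phi> r) (g p) z))" for r p q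
  have lie0: "lie (\<Phi> r) (g p) z = 0" if "r \<in> P" "p \<in> P" "z \<in> chart_image (\<Phi> r)" "chart_inv (\<Phi> r) z \<notin> K p" for r p z
    by (rule lie_off_support[OF bump(1)[OF inP[OF that(1)]] closed_compactin[OF bump(5)[OF inP[OF that(2)]]] _ that(3,4)])
       (use pu0(2)[OF that(2)] in blast)
  have contY: "continuous_on (chart_image (\<Phi> r)) (\<lambda>z. pu q (chart_inv (\<Phi> r) z) * lie (\<Phi> r) (g p) z)"
    if "r \<in> P" "p \<in> P" "q \<in> P" for r p q
    by (intro continuous_intros C1_D(2)[OF Cpu] continuous_lie Cg bump(1)[OF inP] that)
  have tY: "test_fun (Y r p q)" if "r \<in> P" "p \<in> P" "q \<in> P" "r = p \<or> r = q" for r p q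
    unfolding Y_def
  proof (rule test_fun_chart[OF bump(1)[OF inP[OF that(1)]] bump(5,6)[OF inP[OF that(1)]]])
    show "continuous_on (chart_image (\<Phi> r)) (\<lambda>z. dens (\<Phi> r) z * (pu q (chart_inv (\<Phi> r) z) * lie (\<Phi> r) (g p) z))"
      by (intro continuous_on_mult[OF continuous_dens contY] bump(1)[OF inP] that)
    show "dens (\<Phi> r) z * (pu q (chart_inv (\<Phi> r) z) * lie (\<Phi> r) (g p) z) = 0"
      if "z \<in> chart_image (\<Phi> r)" "chart_inv (\<Phi> r) z \<notin> K r" for z
      using \<open>r = p \<or> r = q\<close> lie0[OF \<open>r \<in> P\<close> \<open>p \<in> P\<close> that(1)] pu0(1)[OF \<open>q \<in> P\<close>] that(2) by auto
  qed
  \<comment> \<open>The weights \<open>pu q\<close> sum to 1, so they can be inserted in the chart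
    of \<open>p\<close>.\<close>
  have X_sum: "cint (X p) = (\<Sum>q\<in>P. cint (Y p p q))" if p: "p \<in> P" for p
  proof -
    have "X p = (\<lambda>z. \<Sum>q\<in>P. Y p p q z)"
    proof
      fix z
      show "X p z = (\<Sum>q\<in>P. Y p p q z)"
      proof (cases "z \<in> chart_image (\<Phi> p)")
        case True
        have "(\<Sum>q\<in>P. Y p p q z) = dens (\<Phi> p) z * ((\<Sum>q\<in>P. pu q (chart_inv (\<Phi> p) z)) * lie (\<Phi> p) (g p) z)"
          unfolding Y_def zext_def using True by (simp add: sum_distrib_left sum_distrib_right)
        also have "(\<Sum>q\<in>P. pu q (chart_inv (\<Phi> p) z)) = 1"
          by (rule sumpu[OF chart_inv_topspace[OF bump(1)[OF inP[OF p]] True]])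
        finally show ?thesis using True by (simp add: X_def zext_def)
      qed (simp add: X_def Y_def zext_def)
    qed
    then show ?thesis by (simp only:) (rule cint_sum, rule tY[OF p p], auto)
  qed
  \<comment> \<open>The integrand vanishes off \<open>K p \<inter> K q\<close>, which lies in both
    charts, so the integral moves from the chart of \<open>p\<close> to that of
    \<open>q\<close>.\<close>
  have change: "cint (Y p p q) = cint (Y q p q)" if p: "p \<in> P" and q: "q \<in> P" for p q
    unfolding Y_def
  proof (rule cint_chart_change[OF bump(1)[OF inP[OF p]] bump(1)[OF inP[OF q]]])
    show "compactin M (K p \<inter> K q)"
      by (rule closed_Int_compactin[OF closed_compactin[OF bump(5)[OF inP[OF p]]] bump(5)[OF inP[OF q]]])
    show "K p \<inter> K q \<subseteq> fst (\<Phi> p)" "K p \<inter> K q \<subseteq> fst (\<Phi> q)" using bump(6)[OF inP[OF p]] bump(6)[OF inP[OF q]] by blast+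
    show "continuous_on (chart_image (\<Phi> q)) (\<lambda>z. pu q (chart_inv (\<Phi> q) z) * lie (\<Phi> q) (g p) z)"
      by (rule contY[OF q p q])
    show "pu q (chart_inv (\<Phi> q) z) * lie (\<Phi> q) (g p) z = 0"
      if "z \<in> chart_image (\<Phi> q)" "chart_inv (\<Phi> q) z \<notin> K p \<inter> K q" for z
      using that lie0[OF q p that(1)] pu0(1)[OF q] by auto
    show "pu q (chart_inv (\<Phi> p) z) * lie (\<Phi> p) (g p) z = 0"
      if "z \<in> chart_image (\<Phi> p)" "chart_inv (\<Phi> p) z \<notin> K p \<inter> K q" for z
      using that lie0[OF p p that(1)] pu0(1)[OF q] by auto
    show "pu q (chart_inv (\<Phi> p) z) * lie (\<Phi> p) (g p) z =
        pu q (chart_inv (\<Phi> q) (transition (\<Phi> p) (\<Phi> q) z)) * lie (\<Phi> q) (g p) (transition (\<Phi> p) (\<Phi> q) z)"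
      if "z \<in> overlap (\<Phi> p) (\<Phi> q)" for z
      using transition_props(1)[OF bump(1)[OF inP[OF p]] bump(1)[OF inP[OF q]] that]
        lie_transition[OF Cg[OF p] bump(1)[OF inP[OF p]] bump(1)[OF inP[OF q]] that] by simp
  qed
  \<comment> \<open>In the fixed chart of \<open>q\<close> the sum over \<open>p\<close> goes inside
    the derivative, where it becomes the indicator of \<open>zeros\<close>, whose derivative is
    zero.\<close>
  have Y_sum: "(\<Sum>p\<in>P. cint (Y q p q)) = 0" if q: "q \<in> P" for q
  proof -
    have "(\<Sum>p\<in>P. cint (Y q p q)) = cint (\<lambda>z. \<Sum>p\<in>P. Y q p q z)"
      by (rule cint_sum[symmetric]) (rule tY[OF q _ q], auto)
    also have "(\<lambda>z. \<Sum>p\<in>P. Y q p q z) = (\<lambda>z. 0)"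
    proof
      fix z
      show "(\<Sum>p\<in>P. Y q p q z) = 0"
      proof (cases "z \<in> chart_image (\<Phi> q)")
        case True
        have q': "\<Phi> q \<in> A" by (rule bump(1)[OF inP[OF q]])
        have "(\<Sum>p\<in>P. lie (\<Phi> q) (g p) z) = lie (\<Phi> q) (\<lambda>r. \<Sum>p\<in>P. g p r) z"
          by (rule lie_sum[symmetric, OF Cg q' True])
        also have "\<dots> = lie (\<Phi> q) (\<lambda>p. of_bool (p \<in> zeros)) z"
        proof (rule lie_cong_locally[OF chart(2)[OF q'] True])
          fix x assume "x \<in> chart_image (\<Phi> q)"
          then show "(\<Sum>p\<in>P. g p (chart_inv (\<Phi> q) x)) = of_bool (chart_inv (\<Phi> q) x \<in> zeros)"
            using sumpu[OF chart_inv_topspace[OF q']] by (simp add: g_def iZ_def sum_distrib_left[symmetric])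
        qed
        also have "\<dots> = 0" by (rule lie_indicator_zeros[OF q' True])
        finally show ?thesis using True
          by (simp add: Y_def zext_def sum_distrib_left[symmetric])
      qed (simp add: Y_def zext_def)
    qed
    finally show ?thesis by simp
  qed
  have "(\<Sum>p\<in>P. cint (X p)) = (\<Sum>p\<in>P. \<Sum>q\<in>P. cint (Y q p q))"
  proof (rule sum.cong[OF refl])
    fix p assume p: "p \<in> P"
    show "cint (X p) = (\<Sum>q\<in>P. cint (Y q p q))"
      unfolding X_sum[OF p] by (rule sum.cong[OF refl]) (rule change[OF p])
  qed
  also have "\<dots> = (\<Sum>q\<in>P. \<Sum>p\<in>P. cint (Y q p q))" by (rule sum.swap)
  also have "\<dots> = 0" by (simp add: Y_sum)
  finally have "(\<Sum>p\<in>P. cint (X p)) = 0" .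
  moreover have "(\<Sum>p\<in>P. cint (D p)) + (\<Sum>p\<in>P. cint (X p)) = 0"
    unfolding sum.distrib[symmetric] by (rule sum.neutral) (use ibp(3) in blast)
  ultimately have sumD: "(\<Sum>p\<in>P. cint (D p)) = 0" by simp
  have gd: "0 \<le> g p (chart_inv (\<Phi> p) z) * divg (\<Phi> p) z"
    if p: "p \<in> P" and z: "z \<in> chart_image (\<Phi> p)" for p z
  proof (cases "chart_inv (\<Phi> p) z \<in> zeros")
    case True
    have "0 \<le> g p (chart_inv (\<Phi> p) z)"
      using punn[OF p chart_inv_topspace[OF bump(1)[OF inP[OF p]] z]] by (simp add: g_def iZ_def)
    then show ?thesis using divg_nonneg_on_zeros(2)[OF bump(1)[OF inP[OF p]] z True] by simp
  qed (simp add: g_def iZ_def)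
  have Dnn: "D p z \<ge> 0" if p: "p \<in> P" for p z
  proof (cases "z \<in> chart_image (\<Phi> p)")
    case True
    have "dens (\<Phi> p) z \<ge> 0"
      by (rule less_imp_le[OF local_lck.vol_density_pos[OF local[OF bump(1)[OF inP[OF p]]] True]])
    then have "dens (\<Phi> p) z * (g p (chart_inv (\<Phi> p) z) * divg (\<Phi> p) z) \<ge> 0"
      by (rule mult_nonneg_nonneg[OF _ gd[OF p True]])
    then show ?thesis using True by (simp add: D_def zext_def)
  qed (simp add: D_def zext_def)
  \<comment> \<open>Nonnegative integrals with vanishing sum vanish one by one, and so do their
    continuous nonnegative integrands.\<close>
  have "cint (D p) = 0" if "p \<in> P" for p
    using sumD sum_nonneg_eq_0_iff[OF P(1), of "\<lambda>p. cint (D p)"] cint_nonneg[OF ibp(1) Dnn] that by blast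
  then have D0: "D p z = 0" if "p \<in> P" for p z
    using cint_eq_0_imp[OF ibp(1)[OF that] Dnn[OF that]] that by blast
  have qtop: "chart_inv \<psi> z \<in> topspace M" by (rule chart_inv_topspace[OF \<psi> z])
  then obtain p where p: "p \<in> P" "b p (chart_inv \<psi> z) > 0" using P(3) by blast
  let ?\<phi> = "\<Phi> p"
  have \<phi>: "?\<phi> \<in> A" by (rule bump(1)[OF inP[OF p(1)]])
  have "chart_inv \<psi> z \<in> K p" using bump(7)[OF inP[OF p(1)], of "chart_inv \<psi> z"] p(2) by force
  then have "chart_inv \<psi> z \<in> fst ?\<phi>" using bump(6)[OF inP[OF p(1)]] by blast
  then have zo: "z \<in> overlap \<psi> ?\<phi>" using overlap_props(3)[OF \<psi> \<phi>] z by simp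
  define w where "w = transition \<psi> ?\<phi> z"
  have w: "w \<in> chart_image ?\<phi>" "chart_inv ?\<phi> w = chart_inv \<psi> z"
    using transition_props(1,4)[OF \<psi> \<phi> zo] by (simp_all add: w_def)
  have "g p (chart_inv ?\<phi> w) > 0"
    using zero p(2) Bpos[OF qtop] by (simp add: g_def iZ_def pu_def w(2))
  moreover have "dens ?\<phi> w > 0" by (rule local_lck.vol_density_pos[OF local[OF \<phi>] w(1)])
  moreover have "dens ?\<phi> w * (g p (chart_inv ?\<phi> w) * divg ?\<phi> w) = 0"
    using D0[OF p(1), of w] w(1) by (simp add: D_def zext_def)
  \<comment> \<open>Density and weight are strictly positive at the point, so the divergence
    vanishes there; its lower bound then leaves no room for the squared norm of the Lee
    form.\<close>
  ultimately have "divg ?\<phi> w = 0" by simp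
  then have "(real CARD('n) - 1) * Re (\<Sum>i\<in>UNIV. llee ?\<phi> i w * lvec ?\<phi> i w) \<le> 0"
    using divg_nonneg_on_zeros(1)[OF \<phi> w(1)] zero w(2) by simp
  moreover have "real CARD('n) - 1 > 0" using card by simp
  ultimately have "Re (\<Sum>i\<in>UNIV. llee ?\<phi> i w * lvec ?\<phi> i w) \<le> 0"
    by (simp only: mult_le_0_iff) linarith
  then have "\<theta> ?\<phi> w u = 0" for u by (rule local_lck.lee_eq_0_if_lee_vec[OF local[OF \<phi>] w(1)])
  then show ?thesis
    using lck_transition.\<theta>_T[OF transition_lck[OF \<psi> \<phi>] zo] by (simp add: w_def)
qed

section \<open>The conformal factor\<close>

text \<open>Away from \<open>zeros\<close> the factor \<open>exp (- potential p)\<close> is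
  \<open>\<bar>gmu p\<bar>\<close>, so the Kaehler metric is the given one scaled by
  \<open>\<bar>\<mu>\<bar>\<close>. On \<open>zeros\<close>, where the given metric is Kaehler
  already, any constant would do and 0 leaves it unchanged.\<close>

definition potential :: "'a \<Rightarrow> real" where
  "potential p = (if gmu p = 0 then 0 else - ln \<bar>gmu p\<bar>)"

lemma potential_has_derivative:
  assumes \<phi>: "\<phi> \<in> A" and z: "z \<in> chart_image \<phi>"
  shows "((\<lambda>z. potential (chart_inv \<phi> z)) has_derivative \<theta> \<phi> z) (at z)"
proof -
  obtain U1 U2 where U: "open U1" "open U2" "chart_image \<phi> = U1 \<union> U2"
    "\<And>z. z \<in> U1 \<Longrightarrow> chart_inv \<phi> z \<in> zeros" "\<And>z. z \<in> U2 \<Longrightarrow> chart_inv \<phi> z \<notin> zeros"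
    by (rule indicator_zeros_local[OF \<phi>]) (rule that)
  from z U(3) consider "z \<in> U1" | "z \<in> U2" by blast
  then show ?thesis
  proof cases
    case 1
    have "\<theta> \<phi> z = (\<lambda>v. 0)"
      using theta_zero_on_zeros[OF \<phi> z U(4)[OF 1]] by blast
    then have "((\<lambda>z. 0) has_derivative \<theta> \<phi> z) (at z)" by simp
    then show ?thesis
      by (rule has_derivative_transform_within_open[OF _ U(1) 1])
         (use U(4) in \<open>simp add: potential_def zeros_def\<close>)
  next
    case 2
    have nz: "lmu \<phi> x \<noteq> 0" if "x \<in> U2" for x
      using U(5)[OF that] gmu_chart[OF \<phi>, of x] chart_inv_topspace[OF \<phi>, of x] that U(3) by (auto simp: zeros_def)
    \<comment> \<open>Near \<open>z\<close> the sign of \<mu> is constant, so its absolute value is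
      \<open>s\<close> times \<mu> on \<open>V\<close> and can be differentiated there.\<close>
    define s where "s = sgn (lmu \<phi> z)"
    define V where "V = {x \<in> U2. s * lmu \<phi> x \<in> {0<..}}"
    have cont: "continuous_on U2 (lmu \<phi>)" using continuous_lmu[OF \<phi>] U(3) continuous_on_subset by blast
    have "open (U2 \<inter> (\<lambda>x. s * lmu \<phi> x) -` {0<..})"
      by (intro continuous_open_preimage continuous_intros cont U(2) open_greaterThan)
    then have "open V" by (simp add: V_def vimage_def Int_def)
    have "s * lmu \<phi> z > 0" using nz[OF 2] by (simp add: s_def sgn_if)
    then have "z \<in> V" using 2 by (simp add: V_def)
    have "((\<lambda>x. s * lmu \<phi> x) has_derivative (\<lambda>v. s * (- lmu \<phi> z * \<theta> \<phi> z v))) (at z)"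
      by (intro has_derivative_mult_right local_lck_hsc.mu_has_derivative[OF local_hsc[OF \<phi>] z])
    then have L: "((\<lambda>x. - ln (s * lmu \<phi> x)) has_derivative
        (\<lambda>v. - (s * (- lmu \<phi> z * \<theta> \<phi> z v) * inverse (s * lmu \<phi> z)))) (at z)"
      using \<open>s * lmu \<phi> z > 0\<close> by (intro has_derivative_minus has_derivative_ln)
    have E: "- (s * (- lmu \<phi> z * \<theta> \<phi> z v) * inverse (s * lmu \<phi> z)) = \<theta> \<phi> z v" for v
    proof -
      have "s \<noteq> 0" "lmu \<phi> z \<noteq> 0" using \<open>s * lmu \<phi> z > 0\<close> by auto
      then show ?thesis by (simp add: field_simps)
    qed
    from L[unfolded E] show ?thesis
    proof (rule has_derivative_transform_within_open[OF _ \<open>open V\<close> \<open>z \<in> V\<close>])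
      fix x assume x: "x \<in> V"
      then have "x \<in> U2" "s * lmu \<phi> x > 0" by (auto simp: V_def)
      have "\<bar>s\<bar> = 1" using nz[OF 2] by (simp add: s_def sgn_if)
      then have "\<bar>lmu \<phi> x\<bar> = s * lmu \<phi> x" using \<open>s * lmu \<phi> x > 0\<close> by (metis abs_mult abs_of_pos mult_1)
      then show "- ln (s * lmu \<phi> x) = potential (chart_inv \<phi> x)"
        using nz[OF \<open>x \<in> U2\<close>] gmu_chart[OF \<phi>, of x] \<open>x \<in> U2\<close> U(3) by (simp add: potential_def)
    qed
  qed
qed

text \<open>The derivative is the Lee form, which is smooth by assumption; higher derivatives of the
  logarithm are not computed.\<close>

lemma smooth_potential:
  assumes \<phi>: "\<phi> \<in> A"
  shows "smooth_on (chart_image \<phi>) (\<lambda>z. potential (chart_inv \<phi> z))"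
proof (rule smooth_onI)
  show "(\<lambda>z. potential (chart_inv \<phi> z)) differentiable at z" if "z \<in> chart_image \<phi>" for z
    using potential_has_derivative[OF \<phi> that] differentiable_def by blast
  show "smooth_on (chart_image \<phi>) (\<lambda>z. frechet_derivative (\<lambda>z. potential (chart_inv \<phi> z)) (at z) v)" for v
  proof (rule smooth_on_cong[OF chart(2)[OF \<phi>], THEN iffD2, OF _ local_lck.smooth_\<theta>[OF local[OF \<phi>], of v]])
    show "frechet_derivative (\<lambda>z. potential (chart_inv \<phi> z)) (at y) v = \<theta> \<phi> y v" if "y \<in> chart_image \<phi>" for y
      using frechet_derivative_at[OF potential_has_derivative[OF \<phi> that]] by simp
  qed
qed

end

section \<open>Conformal change by the potential\<close>

lemma Ck_on_exp:
  fixes f :: "'v::real_normed_vector \<Rightarrow> real"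
  assumes S: "open S" and f: "smooth_on S f"
  shows "Ck_on k S (\<lambda>x. exp (f x))"
proof (induction k)
  case 0
  then show ?case using smooth_onD(3)[OF f] by (auto intro: continuous_on_exp)
next
  case (Suc k)
  have d: "((\<lambda>x. exp (f x)) has_derivative (\<lambda>v. exp (f y) * frechet_derivative f (at y) v)) (at y)"
    if "y \<in> S" for y
  proof -
    have "(f has_derivative frechet_derivative f (at y)) (at y)"
      using smooth_onD(1)[OF f that] frechet_derivative_works by blast
    from has_derivative_exp[OF this] show ?thesis by (simp add: mult.commute)
  qed
  have "Ck_on k S (\<lambda>x. frechet_derivative (\<lambda>x. exp (f x)) (at x) v)" for v
  proof (subst Ck_on_cong[OF S])
    show "frechet_derivative (\<lambda>x. exp (f x)) (at y) v = exp (f y) * frechet_derivative f (at y) v"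
      if "y \<in> S" for y
      by (simp add: frechet_derivative_at[OF d[OF that], symmetric])
    show "Ck_on k S (\<lambda>y. exp (f y) * frechet_derivative f (at y) v)"
      using Suc smooth_onD(2)[OF f] by (intro Ck_on_mult[OF S]) (simp_all add: smooth_on_def)
  qed
  with d show ?case by (auto simp: differentiable_def)
qed

lemma smooth_on_exp: "open S \<Longrightarrow> smooth_on S f \<Longrightarrow> smooth_on S (\<lambda>x. exp (f x :: real))"
  by (simp add: smooth_on_def[of S "\<lambda>x. exp (f x)"] Ck_on_exp)

lemma herm_scaleR: "herm (e *\<^sub>R H) u v = e *\<^sub>R herm H u v"
  by (simp add: herm_def scaleR_sum_right)

lemma fundamental_form_scaleR:
  "fundamental_form (\<lambda>z. e z *\<^sub>R g z) z u v = e z *\<^sub>R fundamental_form g z u v"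
  by (simp add: fundamental_form_def scaleR_sum_right[symmetric])

context lck_manifold
begin

text \<open>With \<open>df = \<theta>\<close>, the product rule gives \<open>d(exp (- f) \<omega>) =
  exp (- f) (d\<omega> - \<theta> \<and> \<omega>)\<close>, and the bracket is zero. Compatibility
  between charts holds because the factor is a function on the manifold.\<close>

lemma conformal_kaehler:
  "kaehler_metric A (\<lambda>\<phi> z. exp (- potential (chart_inv \<phi> z)) *\<^sub>R h \<phi> z)"
proof -
  define e :: "('a, 'n) chart \<Rightarrow> complex^'n \<Rightarrow> real" where "e \<phi> z = exp (- potential (chart_inv \<phi> z))" for \<phi> z
  have sm_e: "smooth_on (chart_image \<phi>) (e \<phi>)" if "\<phi> \<in> A" for \<phi>
    unfolding e_def[abs_def]
    by (intro smooth_on_exp smooth_on_minus smooth_potential chart(2) that)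
  have de: "(e \<phi> has_derivative (\<lambda>v. - \<theta> \<phi> z v * e \<phi> z)) (at z)" if "\<phi> \<in> A" "z \<in> chart_image \<phi>" for \<phi> z
    using has_derivative_exp[OF has_derivative_minus[OF potential_has_derivative[OF that]]]
    by (simp add: e_def[abs_def] mult.commute)
  have "hermitian_metric A (\<lambda>\<phi> z. e \<phi> z *\<^sub>R h \<phi> z)"
    unfolding hermitian_metric_def
  proof (intro conjI ballI allI impI)
    fix \<phi> assume \<phi>: "\<phi> \<in> A"
    interpret local_lck "chart_image \<phi>" "h \<phi>" "\<theta> \<phi>" by (rule local[OF \<phi>])
    show "smooth_on (chart_image \<phi>) (\<lambda>z. (e \<phi> z *\<^sub>R h \<phi> z) $ i $ j)" for i j
      unfolding vector_scaleR_component
      unfolding scaleR_conv_of_real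
      by (intro smooth_on_mult smooth_on_of_real open_S smooth_h sm_e \<phi>)
    fix z assume z: "z \<in> chart_image \<phi>"
    show "(e \<phi> z *\<^sub>R h \<phi> z) $ j $ i = cnj ((e \<phi> z *\<^sub>R h \<phi> z) $ i $ j)" for i j
      by (simp add: hermitian[OF z, symmetric])
    show "0 < Re (herm (e \<phi> z *\<^sub>R h \<phi> z) X X)" if "X \<noteq> 0" for X
      using positive[OF z that] by (simp add: herm_scaleR e_def)
  next
    fix \<phi> \<psi> z u v assume \<phi>: "\<phi> \<in> A" and \<psi>: "\<psi> \<in> A" and z: "z \<in> overlap \<phi> \<psi>"
    have "e \<psi> (transition \<phi> \<psi> z) = e \<phi> z" by (simp add: e_def transition_props(1)[OF \<phi> \<psi> z])
    then show "herm (e \<phi> z *\<^sub>R h \<phi> z) u v = herm (e \<psi> (transition \<phi> \<psi> z) *\<^sub>R h \<psi> (transition \<phi> \<psi> z))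
       (frechet_derivative (transition \<phi> \<psi>) (at z) u) (frechet_derivative (transition \<phi> \<psi>) (at z) v)"
      by (simp add: herm_scaleR lck_transition.h_T[OF transition_lck[OF \<phi> \<psi>] z])
  qed
  moreover have "ext_d2 (fundamental_form (\<lambda>z. e \<phi> z *\<^sub>R h \<phi> z)) z u v w = 0"
    if \<phi>: "\<phi> \<in> A" and z: "z \<in> chart_image \<phi>" for \<phi> z u v w
  proof -
    interpret local_lck "chart_image \<phi>" "h \<phi>" "\<theta> \<phi>" by (rule local[OF \<phi>])
    let ?\<omega> = "fundamental_form (h \<phi>)"
    have d\<omega>: "(\<lambda>x. ?\<omega> x v w) differentiable (at z)" for v w
      unfolding fundamental_form_def
      by (intro differentiable_mult differentiable_sum ballI differentiable_const differentiable_h[OF z] finite)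
    have "frechet_derivative (\<lambda>x. fundamental_form (\<lambda>z. e \<phi> z *\<^sub>R h \<phi> z) x v w) (at z) u =
      e \<phi> z *\<^sub>R frechet_derivative (\<lambda>x. ?\<omega> x v w) (at z) u - (\<theta> \<phi> z u * e \<phi> z) *\<^sub>R ?\<omega> z v w" for u v w
    proof -
      have "((\<lambda>x. e \<phi> x *\<^sub>R ?\<omega> x v w) has_derivative (\<lambda>u. e \<phi> z *\<^sub>R frechet_derivative (\<lambda>x. ?\<omega> x v w) (at z) u
         + (- \<theta> \<phi> z u * e \<phi> z) *\<^sub>R ?\<omega> z v w)) (at z)"
        by (rule has_derivative_scaleR[OF de[OF \<phi> z] d\<omega>[unfolded frechet_derivative_works]])
      from frechet_derivative_at[OF this, symmetric] show ?thesis
        unfolding fundamental_form_scaleR by simp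
    qed
    note D = this
    have "ext_d2 (fundamental_form (\<lambda>z. e \<phi> z *\<^sub>R h \<phi> z)) z u v w =
      e \<phi> z *\<^sub>R (ext_d2 ?\<omega> z u v w - wedge12 (\<theta> \<phi>) ?\<omega> z u v w)"
      unfolding ext_d2_def D wedge12_def by (simp add: algebra_simps)
    then show ?thesis using lck[OF z] by simp
  qed
  ultimately show ?thesis unfolding kaehler_metric_def e_def by blast
qed

lemma globally_conformal: "globally_conformal_kaehler A h"
  unfolding globally_conformal_kaehler_def
proof (intro conjI exI)
  show "hermitian_metric A h" by (rule metric)
  show "smooth_function A potential"
    unfolding smooth_function_def o_def using smooth_potential by blast
  show "kaehler_metric A (\<lambda>\<phi> z. exp (- potential (chart_inv \<phi> z)) *\<^sub>R h \<phi> z)" by (rule conformal_kaehler)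
  show "\<forall>\<phi>\<in>A. \<forall>z\<in>chart_image \<phi>. \<forall>u v. fundamental_form (h \<phi>) z u v = exp (potential (chart_inv \<phi> z)) *\<^sub>R
      fundamental_form (\<lambda>z. exp (- potential (chart_inv \<phi> z)) *\<^sub>R h \<phi> z) z u v"
    unfolding fundamental_form_scaleR by (simp add: exp_add[symmetric])
qed

end

theorem theorem1p2:
  fixes M :: "'a topology"
    and A :: "('a, 'n::finite) chart set"
    and h :: "('a, 'n) chart \<Rightarrow> 'n local_metric"
    and c :: "'a \<Rightarrow> real"
  assumes "CARD('n) \<ge> 2"
    and "complex_manifold M A"
    and "compact_space M"
    and "locally_conformal_kaehler A h"
    and "\<And>p. p \<in> topspace M \<Longrightarrow> c p \<le> 0"
    and "pointwise_hol_sect_curv A h c"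
  shows "globally_conformal_kaehler A h"
proof -
  obtain \<theta> where "hermitian_metric A h" "real_one_form A \<theta>" "closed_one_form A \<theta>"
    "\<forall>\<phi>\<in>A. \<forall>z\<in>chart_image \<phi>. \<forall>u v w. ext_d2 (fundamental_form (h \<phi>)) z u v w =
       wedge12 (\<theta> \<phi>) (fundamental_form (h \<phi>)) z u v w"
    using assms(4) unfolding locally_conformal_kaehler_def by blast
  then have "lck_manifold M A h \<theta> c"
    using assms by (intro lck_manifold.intro) blast+
  then show ?thesis by (rule lck_manifold.globally_conformal)
qed

end
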